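(* Let $(\mathbf x,B)$ be a seed of $\mathcal F$, and let $\mathbf y=(y_1,\dots,y_m)$ and $\mathbf z=(z_1,\dots,z_m)$ be disjoint clusters of $\mathcal A(\mathbf x,B)$. Suppose $U$ is a $K$-subalgebra of $\mathcal A(\mathbf x,B)$ which is a factorial ring and contains $$\{y_1,\dots,y_n,z_1,\dots,z_n,x_{n+1}^{\pm1},\dots,x_p^{\pm1},x_{p+1},\dots,x_m\}.$$ Then $U=\mathcal A(\mathbf x,B)=U(\mathbf y,\mathbf z)$. In particular $\mathcal A(\mathbf x,B)$ is factorial and all cluster variables of $\mathcal A(\mathbf x,B)$ are prime elements.
   Context: Let $K$ be a field of characteristic $0$ or $K=\mathbb Z$. Fix integers $m\ge p\ge n\ge 1$ with $m>1$, and let $\mathcal F=K(X_1,\dots,X_m)$. For $B=(b_{ij})\in M_{m,n}(\mathbb Z)$ the principal part $B^\circ$ is the $n\times n$ matrix formed by the first $n$ rows. $B$ is connected if the graph with vertices $1,\dots,m$ and an edge between $i$ and $j$ whenever $b_{ij}\neq 0$ or $b_{ji}\ne 0$ is connected. A square integer matrix $A$ is skew-symmetrizable if $DA$ is skew-symmetric for some diagonal integer matrix $D$ with positive diagonal entries. A seed of $\mathcal F$ is a pair $(\mathbf x,B)$ where $B\in M_{m,n}(\mathbb Z)$ is connected with $B^\circ$ skew-symmetrizable, and $\mathbf x=(x_1,\dots,x_m)$ is an $m$-tuple of elements of $\mathcal F$ algebraically independent over $K$. For $1\le k\le n$ the mutation $\mu_k(\mathbf x,B)=(\mathbf x',B')$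 is given by $b'_{ij}=-b_{ij}$ if $i=k$ or $j=k$, and $b'_{ij}=b_{ij}+\frac{|b_{ik}|b_{kj}+b_{ik}|b_{kj}|}{2}$ otherwise; $x'_s=x_s$ for $s\neq k$ and $x'_k=x_k^{-1}\big(\prod_{b_{ik}>0}x_i^{b_{ik}}+\prod_{b_{ik}<0}x_i^{-b_{ik}}\big)$. Two seeds are mutation equivalent if one is obtained from the other by a finite sequence of mutations $\mu_{i_1},\dots,\mu_{i_t}$ with $1\le i_j\le n$. The cluster algebra $\mathcal A(\mathbf x,B)$ is the $K$-subalgebra of $\mathcal F$ generated by $x_{n+1}^{\pm1},\dots,x_p^{\pm1},x_{p+1},\dots,x_m$ together with all elements $y_1,\dots,y_n$ for all seeds $(\mathbf y,C)$ mutation equivalent to $(\mathbf x,B)$; these $y_i$ ($1\le i\le n$) are the cluster variables, and for such a seed $\mathbf y$ is called a cluster (note $y_i=x_i$ for $n<i\le m$). Two clusters $\mathbf y,\mathbf z$ are disjoint if $\{y_1,\dots,y_n\}\cap\{z_1,\dots,z_n\}=\varnothing$. For a cluster $\mathbf y$ let $\mathscr L_{\mathbf y}=K[y_1^{\pm1},\dots,y_p^{\pm1},y_{p+1},\dots,y_m]\subseteq\mathcal F$, and set $U(\mathbf y,\mathbf z)=\mathscr L_{\mathbf y}\cap\mathscr L_{\mathbf z}$. *)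

theory Defs
  imports Main "HOL-Algebra.Ring_Divisibility"
begin

(* Indices are 1-based: rows/variables 1..m, mutable columns 1..n.
   Vectors are nat => 'a, matrices nat => nat => int; only entries in
   range matter. *)

text \<open>K-subalgebras of the ambient field: subrings containing K.\<close>
definition subalg :: "'a::field set \<Rightarrow> 'a set \<Rightarrow> bool" where
  "subalg K S \<longleftrightarrow> K \<subseteq> S \<and> 0 \<in> S \<and> 1 \<in> S \<and>
     (\<forall>a\<in>S. \<forall>b\<in>S. a + b \<in> S \<and> a - b \<in> S \<and> a * b \<in> S)"

definition gen_alg :: "'a::field set \<Rightarrow> 'a set \<Rightarrow> 'a set" where
  "gen_alg K G = \<Inter>{S. subalg K S \<and> G \<subseteq> S}"

definition subfield :: "'a::field set \<Rightarrow> bool" where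
  "subfield K \<longleftrightarrow> 0 \<in> K \<and> 1 \<in> K \<and>
     (\<forall>a\<in>K. \<forall>b\<in>K. a + b \<in> K \<and> a - b \<in> K \<and> a * b \<in> K) \<and>
     (\<forall>a\<in>K. a \<noteq> 0 \<longrightarrow> inverse a \<in> K)"

text \<open>Monomial x^alpha in variables x_1..x_m.\<close>
definition monom_val :: "nat \<Rightarrow> (nat \<Rightarrow> 'a::field) \<Rightarrow> (nat \<Rightarrow> nat) \<Rightarrow> 'a" where
  "monom_val m x \<alpha> = (\<Prod>i\<in>{1..m}. x i ^ \<alpha> i)"

definition exps :: "nat \<Rightarrow> (nat \<Rightarrow> nat) set" where
  "exps m = {\<alpha>. \<forall>i. i \<notin> {1..m} \<longrightarrow> \<alpha> i = 0}"

text \<open>f is the value of a polynomial with coefficients in K at x_1..x_m.\<close>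
definition is_poly_in :: "'a::field set \<Rightarrow> nat \<Rightarrow> (nat \<Rightarrow> 'a) \<Rightarrow> 'a \<Rightarrow> bool" where
  "is_poly_in K m x f \<longleftrightarrow> (\<exists>M c. finite M \<and> M \<subseteq> exps m \<and> (\<forall>\<alpha>\<in>M. c \<alpha> \<in> K) \<and>
       f = (\<Sum>\<alpha>\<in>M. c \<alpha> * monom_val m x \<alpha>))"

text \<open>x_1..x_m algebraically independent over K.\<close>
definition alg_indep :: "'a::field set \<Rightarrow> nat \<Rightarrow> (nat \<Rightarrow> 'a) \<Rightarrow> bool" where
  "alg_indep K m x \<longleftrightarrow> (\<forall>M c. finite M \<and> M \<subseteq> exps m \<and> (\<forall>\<alpha>\<in>M. c \<alpha> \<in> K) \<and>
       (\<Sum>\<alpha>\<in>M. c \<alpha> * monom_val m x \<alpha>) = 0 \<longrightarrow> (\<forall>\<alpha>\<in>M. c \<alpha> = 0))"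

text \<open>The ambient field is F = K(X_1,..,X_m): X algebraically independent over K
  and every element a quotient of polynomials in X over K.\<close>
definition rational_function_field :: "'a::field set \<Rightarrow> nat \<Rightarrow> (nat \<Rightarrow> 'a) \<Rightarrow> bool" where
  "rational_function_field K m X \<longleftrightarrow> alg_indep K m X \<and>
     (\<forall>f::'a. \<exists>P Q. is_poly_in K m X P \<and> is_poly_in K m X Q \<and> Q \<noteq> 0 \<and> f = P / Q)"

definition connected_mat :: "nat \<Rightarrow> nat \<Rightarrow> (nat \<Rightarrow> nat \<Rightarrow> int) \<Rightarrow> bool" where
  "connected_mat m n B \<longleftrightarrow>
     (let E = {(i,j). i \<in> {1..m} \<and> j \<in> {1..m} \<and>
                ((j \<in> {1..n} \<and> B i j \<noteq> 0) \<or> (i \<in> {1..n} \<and> B j i \<noteq> 0))}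
      in \<forall>i\<in>{1..m}. \<forall>j\<in>{1..m}. (i, j) \<in> E\<^sup>*)"

definition skew_symmetrizable :: "nat \<Rightarrow> (nat \<Rightarrow> nat \<Rightarrow> int) \<Rightarrow> bool" where
  "skew_symmetrizable n A \<longleftrightarrow> (\<exists>d::nat \<Rightarrow> int. (\<forall>i\<in>{1..n}. d i > 0) \<and>
     (\<forall>i\<in>{1..n}. \<forall>j\<in>{1..n}. d i * A i j = - (d j * A j i)))"

definition is_seed :: "'a::field set \<Rightarrow> nat \<Rightarrow> nat \<Rightarrow> (nat \<Rightarrow> 'a) \<Rightarrow> (nat \<Rightarrow> nat \<Rightarrow> int) \<Rightarrow> bool" where
  "is_seed K m n x B \<longleftrightarrow> connected_mat m n B \<and> skew_symmetrizable n B \<and> alg_indep K m x"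

definition mut_mat :: "nat \<Rightarrow> (nat \<Rightarrow> nat \<Rightarrow> int) \<Rightarrow> (nat \<Rightarrow> nat \<Rightarrow> int)" where
  "mut_mat k B = (\<lambda>i j. if i = k \<or> j = k then - B i j
      else B i j + (\<bar>B i k\<bar> * B k j + B i k * \<bar>B k j\<bar>) div 2)"

definition mut_vars :: "nat \<Rightarrow> nat \<Rightarrow> (nat \<Rightarrow> 'a::field) \<Rightarrow> (nat \<Rightarrow> nat \<Rightarrow> int) \<Rightarrow> (nat \<Rightarrow> 'a)" where
  "mut_vars m k x B = x(k := inverse (x k) *
      ((\<Prod>i\<in>{i\<in>{1..m}. B i k > 0}. x i ^ nat (B i k)) +
       (\<Prod>i\<in>{i\<in>{1..m}. B i k < 0}. x i ^ nat (- B i k))))"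

text \<open>One mutation step mu_k with 1 <= k <= n.\<close>
definition mut_step :: "nat \<Rightarrow> nat \<Rightarrow> ((nat \<Rightarrow> 'a::field) \<times> (nat \<Rightarrow> nat \<Rightarrow> int))
     \<Rightarrow> ((nat \<Rightarrow> 'a) \<times> (nat \<Rightarrow> nat \<Rightarrow> int)) \<Rightarrow> bool" where
  "mut_step m n s t \<longleftrightarrow> (\<exists>k\<in>{1..n}. t = (mut_vars m k (fst s) (snd s), mut_mat k (snd s)))"

definition mut_equiv :: "nat \<Rightarrow> nat \<Rightarrow> ((nat \<Rightarrow> 'a::field) \<times> (nat \<Rightarrow> nat \<Rightarrow> int))
     \<Rightarrow> ((nat \<Rightarrow> 'a) \<times> (nat \<Rightarrow> nat \<Rightarrow> int)) \<Rightarrow> bool" where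
  "mut_equiv m n = (mut_step m n)\<^sup>*\<^sup>*"

definition is_cluster :: "nat \<Rightarrow> nat \<Rightarrow> (nat \<Rightarrow> 'a::field) \<Rightarrow> (nat \<Rightarrow> nat \<Rightarrow> int) \<Rightarrow> (nat \<Rightarrow> 'a) \<Rightarrow> bool" where
  "is_cluster m n x B y \<longleftrightarrow> (\<exists>C. mut_equiv m n (x, B) (y, C))"

definition cluster_vars :: "nat \<Rightarrow> nat \<Rightarrow> (nat \<Rightarrow> 'a::field) \<Rightarrow> (nat \<Rightarrow> nat \<Rightarrow> int) \<Rightarrow> 'a set" where
  "cluster_vars m n x B = {y i | y i. is_cluster m n x B y \<and> i \<in> {1..n}}"

definition cluster_alg :: "'a::field set \<Rightarrow> nat \<Rightarrow> nat \<Rightarrow> nat \<Rightarrow> (nat \<Rightarrow> 'a) \<Rightarrow> (nat \<Rightarrow> nat \<Rightarrow> int) \<Rightarrow> 'a set" where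
  "cluster_alg K m n p x B = gen_alg K
     (x ` {n+1..p} \<union> (\<lambda>i. inverse (x i)) ` {n+1..p} \<union> x ` {p+1..m} \<union> cluster_vars m n x B)"

text \<open>L_y = K[y_1^{+-1},..,y_p^{+-1},y_{p+1},..,y_m].\<close>
definition laurent_alg :: "'a::field set \<Rightarrow> nat \<Rightarrow> nat \<Rightarrow> (nat \<Rightarrow> 'a) \<Rightarrow> 'a set" where
  "laurent_alg K m p y = gen_alg K (y ` {1..p} \<union> (\<lambda>i. inverse (y i)) ` {1..p} \<union> y ` {p+1..m})"

definition disjoint_clusters :: "nat \<Rightarrow> (nat \<Rightarrow> 'a) \<Rightarrow> (nat \<Rightarrow> 'a) \<Rightarrow> bool" where
  "disjoint_clusters n y z \<longleftrightarrow> y ` {1..n} \<inter> z ` {1..n} = {}"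

text \<open>A subring of the field viewed as an HOL-Algebra ring.\<close>
definition sub_ring :: "'a::field set \<Rightarrow> 'a ring" where
  "sub_ring S = \<lparr>carrier = S, monoid.mult = (*), one = 1, zero = 0, add = (+)\<rparr>"

end

theory Submission
  imports "HOL-Analysis.Continuum_Not_Denumerable" "HOL-Computational_Algebra.Polynomial" Defs
begin

text \<open>
  The inclusion of the cluster algebra in every Laurent ring is the Laurent phenomenon. When the columns
  of the exchange matrix are linearly independent, it follows from the mutation invariance of the upper
  bound, i.e. the intersection of the Laurent rings of a seed and of its neighbours; independence makes
  the exchange polynomials pairwise coprime. In general one adjoins an identity block to the matrix,
  works over algebraically independent reals and specializes. Since exchange relations are
  subtraction-free, the expansions are polynomial in the frozen variables and have positive coefficient sum.

  Units of a Laurent ring are monomials, and a negative exponent of \<open>y k\<close> is impossible in the Laurent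
  ring of the cluster mutated at \<open>k\<close>, because the exchange polynomial is not a unit there. Hence cluster
  variables are irreducible in the cluster algebra and in \<open>U\<close>, and two of them are associated only if
  they are equal. If \<open>f\<close> lies in the Laurent rings of \<open>y\<close> and \<open>z\<close>, it can be written over \<open>U\<close> with a
  monomial in \<open>y\<close> and with a monomial in \<open>z\<close> as denominator; these monomials are coprime in the
  factorial ring \<open>U\<close>, so \<open>f \<in> U\<close>.
\<close>

section \<open>Laurent monomials and their spans\<close>

text \<open>Adjoining an identity block requires \<open>m + n\<close> independent quantities, while
  the ambient field has transcendence degree \<open>m\<close>. Expansions have integer coefficients,
  so any field with enough elements independent over the integers can serve, and a countability
  argument finds them among the reals.

  Positivity is what turns associated cluster variables into equal ones. A unit of the cluster
  algebra is a unit \<open>c\<close> of \<open>K\<close> times a monomial in the invertible frozen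
  variables. If \<open>z j\<close> is such a multiple of \<open>y i\<close>, the expansions of
  \<open>z j\<close> in \<open>y\<close> and of \<open>y i\<close> in \<open>z\<close> show that
  \<open>c\<close> and its inverse are positive integers and that every exponent and its negative
  are nonnegative, so the unit is 1.

  \<open>K\<close> is treated as a unital subring, which covers fields and the integers at once.
  Unique factorization of Laurent polynomials is replaced by gradings: an equation is split by the
  degree in one variable, or by an additive function on exponents, and lowest components are
  compared.\<close>

definition iexps :: "nat set \<Rightarrow> (nat \<Rightarrow> int) set" where
  "iexps I = {e. \<forall>i. i \<notin> I \<longrightarrow> e i = 0}"

definition lmon :: "nat set \<Rightarrow> (nat \<Rightarrow> 'a::field) \<Rightarrow> (nat \<Rightarrow> int) \<Rightarrow> 'a" where
  "lmon I x e = (\<Prod>i\<in>I. x i powi e i)"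

definition unital_subring :: "'a::field set \<Rightarrow> bool" where
  "unital_subring K \<longleftrightarrow> 0 \<in> K \<and> 1 \<in> K \<and> (\<forall>a\<in>K. \<forall>b\<in>K. a + b \<in> K \<and> a - b \<in> K \<and> a * b \<in> K)"

text \<open>The set \<open>W\<close> carries all degree conditions: \<open>{e. e j = 0}\<close> is a
  graded piece, \<open>{e. e j \<ge> 0}\<close> a ring polynomial in \<open>x j\<close>,
  \<open>UNIV\<close> the whole Laurent ring. Since only exponents from \<open>iexps I\<close>
  enter, \<open>W\<close> can be written without regard to coordinates outside
  \<open>I\<close>.\<close>

inductive_set lspan :: "'a::field set \<Rightarrow> nat set \<Rightarrow> (nat \<Rightarrow> 'a) \<Rightarrow> (nat \<Rightarrow> int) set \<Rightarrow> 'a set"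
  for K I x W where
  zero: "0 \<in> lspan K I x W"
| add: "\<lbrakk>c \<in> K; e \<in> W; e \<in> iexps I; f \<in> lspan K I x W\<rbrakk> \<Longrightarrow> c * lmon I x e + f \<in> lspan K I x W"

text \<open>Exponents are confined to \<open>iexps I\<close> because \<open>lmon I x\<close> ignores
  coordinates outside \<open>I\<close>; otherwise distinct exponents could name the same
  monomial.\<close>

definition laurent_indep :: "'a::field set \<Rightarrow> nat set \<Rightarrow> (nat \<Rightarrow> 'a) \<Rightarrow> bool" where
  "laurent_indep K I x \<longleftrightarrow> (\<forall>i\<in>I. x i \<noteq> 0) \<and>
     (\<forall>M c. finite M \<longrightarrow> M \<subseteq> iexps I \<longrightarrow> (\<forall>e\<in>M. c e \<in> K) \<longrightarrow>
        (\<Sum>e\<in>M. c e * lmon I x e) = 0 \<longrightarrow> (\<forall>e\<in>M. c e = 0))"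

lemma unital_subringD:
  assumes "unital_subring K"
  shows "0 \<in> K" "1 \<in> K" "a \<in> K \<Longrightarrow> b \<in> K \<Longrightarrow> a + b \<in> K" "a \<in> K \<Longrightarrow> b \<in> K \<Longrightarrow> a - b \<in> K"
    "a \<in> K \<Longrightarrow> b \<in> K \<Longrightarrow> a * b \<in> K" "a \<in> K \<Longrightarrow> - a \<in> K" "a \<in> K \<Longrightarrow> a ^ n \<in> K"
proof -
  show "0 \<in> K" "1 \<in> K" "a \<in> K \<Longrightarrow> b \<in> K \<Longrightarrow> a + b \<in> K" "a \<in> K \<Longrightarrow> b \<in> K \<Longrightarrow> a - b \<in> K"
    "a \<in> K \<Longrightarrow> b \<in> K \<Longrightarrow> a * b \<in> K"
    using assms unfolding unital_subring_def by blast+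
  show "a \<in> K \<Longrightarrow> - a \<in> K"
    using assms unfolding unital_subring_def by (metis diff_0)
  show "a \<in> K \<Longrightarrow> a ^ n \<in> K"
    using assms unfolding unital_subring_def by (induction n) auto
qed

lemma lmon_nonzero: "finite I \<Longrightarrow> \<forall>i\<in>I. x i \<noteq> 0 \<Longrightarrow> lmon I x e \<noteq> 0"
  unfolding lmon_def by (simp add: power_int_not_zero)

lemma lmon_cong: "(\<And>i. i \<in> I \<Longrightarrow> x i = y i) \<Longrightarrow> (\<And>i. i \<in> I \<Longrightarrow> e i = f i) \<Longrightarrow> lmon I x e = lmon I y f"
  unfolding lmon_def by (intro prod.cong) auto

lemma lmon_zero [simp]: "lmon I x (\<lambda>_. 0) = 1"
  unfolding lmon_def by simp

lemma lmon_add: "\<forall>i\<in>I. x i \<noteq> 0 \<Longrightarrow> lmon I x (\<lambda>i. e i + f i) = lmon I x e * lmon I x f"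
  unfolding lmon_def by (simp add: power_int_add flip: prod.distrib)

lemma lmon_scale: "lmon I x (\<lambda>i. b * e i) = lmon I x e powi b"
proof -
  have "x i powi (b * e i) = (x i powi e i) powi b" for i
    by (simp add: mult.commute flip: power_int_mult)
  then show ?thesis
    unfolding lmon_def by (induction I rule: infinite_finite_induct) (auto simp: power_int_mult_distrib)
qed

lemma lmon_remove:
  assumes "finite I" "k \<in> I"
  shows "lmon I x e = x k powi e k * lmon I x (e(k := 0))"
proof -
  have "lmon I x e = x k powi e k * (\<Prod>i\<in>I - {k}. x i powi e i)"
    unfolding lmon_def using assms by (simp add: prod.remove)
  also have "(\<Prod>i\<in>I - {k}. x i powi e i) = (\<Prod>i\<in>I - {k}. x i powi (e(k := 0)) i)"
    by (intro prod.cong) auto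
  also have "\<dots> = lmon I x (e(k := 0))"
    unfolding lmon_def using assms by (simp add: prod.remove[of I k])
  finally show ?thesis .
qed

lemma lmon_upd_zero: "e k = 0 \<Longrightarrow> lmon I (x(k := u)) e = lmon I x e"
  unfolding lmon_def by (intro prod.cong) auto

lemma lmon_upd:
  assumes "finite I" "k \<in> I"
  shows "lmon I (x(k := u)) e = u powi e k * lmon I x (e(k := 0))"
  using lmon_remove[OF assms, of "x(k := u)" e] by (simp add: lmon_upd_zero)

lemma lmon_single:
  assumes "finite I" "k \<in> I"
  shows "lmon I x (\<lambda>i. if i = k then d else 0) = x k powi d"
proof -
  have "(\<lambda>i. if i = k then d else 0)(k := 0) = (\<lambda>_. 0)" by auto
  then show ?thesis using lmon_remove[OF assms, of x "\<lambda>i. if i = k then d else 0"] by simp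
qed

lemma iexps_add: "e \<in> iexps I \<Longrightarrow> f \<in> iexps I \<Longrightarrow> (\<lambda>i. e i + f i) \<in> iexps I"
  and iexps_upd: "e \<in> iexps I \<Longrightarrow> k \<in> I \<Longrightarrow> e(k := d) \<in> iexps I"
  and iexps_zero: "(\<lambda>_. 0) \<in> iexps I"
  and iexps_single: "k \<in> I \<Longrightarrow> (\<lambda>i. if i = k then d else 0) \<in> iexps I"
  unfolding iexps_def by auto

lemma lspan_mono: "f \<in> lspan K I x W \<Longrightarrow> K \<subseteq> K' \<Longrightarrow> W \<inter> iexps I \<subseteq> W' \<Longrightarrow> f \<in> lspan K' I x W'"
  by (induction rule: lspan.induct) (auto intro: lspan.intros)

lemma lspan_plus: "f \<in> lspan K I x W \<Longrightarrow> g \<in> lspan K I x W \<Longrightarrow> f + g \<in> lspan K I x W"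
  by (induction rule: lspan.induct) (auto intro: lspan.intros simp: add.assoc)

lemma lspan_term: "c \<in> K \<Longrightarrow> e \<in> W \<Longrightarrow> e \<in> iexps I \<Longrightarrow> c * lmon I x e \<in> lspan K I x W"
  using lspan.add[OF _ _ _ lspan.zero, of c K e W I x] by simp

lemma lspan_sum: "(\<And>i. i \<in> A \<Longrightarrow> f i \<in> lspan K I x W) \<Longrightarrow> (\<Sum>i\<in>A. f i) \<in> lspan K I x W"
  by (induction A rule: infinite_finite_induct) (auto intro: lspan.zero lspan_plus)

lemma lspan_union:
  assumes "f \<in> lspan K I x (W1 \<union> W2)"
  shows "\<exists>g\<in>lspan K I x W1. \<exists>h\<in>lspan K I x W2. f = g + h"
  using assms
proof (induction rule: lspan.induct)
  case zero
  show ?case using lspan.zero by (metis add.right_neutral)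
next
  case (add c e f)
  then obtain g h where gh: "g \<in> lspan K I x W1" "h \<in> lspan K I x W2" "f = g + h" by blast
  from add.hyps consider "e \<in> W1" | "e \<in> W2" by blast
  then show ?case
  proof cases
    case 1
    have "c * lmon I x e + g \<in> lspan K I x W1" using add.hyps gh 1 by (auto intro: lspan.add)
    then show ?thesis using gh by (metis add.assoc)
  next
    case 2
    have "c * lmon I x e + h \<in> lspan K I x W2" using add.hyps gh 2 by (auto intro: lspan.add)
    then show ?thesis using gh by (metis add.left_commute)
  qed
qed

lemma lspan_rep:
  assumes K: "unital_subring K" and "f \<in> lspan K I x W"
  shows "\<exists>M c. finite M \<and> M \<subseteq> W \<inter> iexps I \<and> (\<forall>e\<in>M. c e \<in> K \<and> c e \<noteq> 0) \<and> f = (\<Sum>e\<in>M. c e * lmon I x e)"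
  using assms(2)
proof (induction rule: lspan.induct)
  case zero
  show ?case by (rule exI[of _ "{}"]) simp
next
  case (add a e f)
  then obtain M c where M: "finite M" "M \<subseteq> W \<inter> iexps I" "\<forall>e\<in>M. c e \<in> K \<and> c e \<noteq> 0"
    "f = (\<Sum>e\<in>M. c e * lmon I x e)" by blast
  define b where "b = (if e \<in> M then a + c e else a)"
  define M' where "M' = (if b = 0 then M - {e} else insert e M)"
  have bK: "b \<in> K" using M add.hyps unital_subringD(3)[OF K] unfolding b_def by auto
  have "(\<Sum>r\<in>M'. (c(e := b)) r * lmon I x r) = a * lmon I x e + f"
  proof -
    have "(\<Sum>r\<in>M'. (c(e := b)) r * lmon I x r) = (\<Sum>r\<in>insert e M. (c(e := b)) r * lmon I x r)"
      using M(1) by (intro sum.mono_neutral_left) (auto simp: M'_def split: if_splits)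
    also have "\<dots> = b * lmon I x e + (\<Sum>r\<in>M - {e}. (c(e := b)) r * lmon I x r)"
      using M(1) by (simp add: sum.insert_remove)
    also have "(\<Sum>r\<in>M - {e}. (c(e := b)) r * lmon I x r) = (\<Sum>e\<in>M - {e}. c e * lmon I x e)"
      by (intro sum.cong) auto
    also have "b * lmon I x e + \<dots> = a * lmon I x e + f"
      unfolding b_def M(4) using M(1) by (auto simp: sum.remove[of M e] algebra_simps)
    finally show ?thesis .
  qed
  moreover have "finite M'" "M' \<subseteq> W \<inter> iexps I" "\<forall>e'\<in>M'. (c(e := b)) e' \<in> K \<and> (c(e := b)) e' \<noteq> 0"
    using M add.hyps bK unfolding M'_def by (auto split: if_splits)
  ultimately show ?case by (intro exI[of _ M'] exI[of _ "c(e := b)"]) auto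
qed

lemma lspan_empty: "f \<in> lspan K I x {} \<Longrightarrow> f = 0"
  by (induction rule: lspan.induct) auto

lemma lspan_singleton:
  assumes "unital_subring K" "f \<in> lspan K I x {e}"
  shows "\<exists>c\<in>K. f = c * lmon I x e"
  using assms(2)
proof (induction rule: lspan.induct)
  case zero
  show ?case using unital_subringD(1)[OF assms(1)] by (metis mult_zero_left)
next
  case (add c e' f)
  then obtain c' where "c' \<in> K" "f = c' * lmon I x e" by blast
  then have "c * lmon I x e' + f = (c + c') * lmon I x e" "c + c' \<in> K"
    using add.hyps unital_subringD(3)[OF assms(1)] by (auto simp: algebra_simps)
  then show ?case by blast
qed

section \<open>Uniqueness of expansions and comparison of graded components\<close>

locale laurent_ring =
  fixes K :: "'a::field set" and I :: "nat set" and x :: "nat \<Rightarrow> 'a"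
  assumes K: "unital_subring K" and fin: "finite I" and indep: "laurent_indep K I x"
begin

abbreviation L where "L \<equiv> lspan K I x"

lemma nz: "\<forall>i\<in>I. x i \<noteq> 0"
  using indep unfolding laurent_indep_def by blast

lemma nzD: "i \<in> I \<Longrightarrow> x i \<noteq> 0"
  using nz by blast

lemma lmon_nz: "lmon I x e \<noteq> 0"
  using lmon_nonzero[OF fin nz] .

lemmas lmon_plus = lmon_add[OF nz]

lemma lmon_uminus: "lmon I x (\<lambda>i. - e i) * lmon I x e = 1"
  using lmon_plus[of "\<lambda>i. - e i" e] by simp

lemma indepD: "\<lbrakk>finite M; M \<subseteq> iexps I; \<forall>e\<in>M. c e \<in> K; (\<Sum>e\<in>M. c e * lmon I x e) = 0; e \<in> M\<rbrakk> \<Longrightarrow> c e = 0"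
  using indep unfolding laurent_indep_def by blast

lemma L_mon: "e \<in> W \<Longrightarrow> e \<in> iexps I \<Longrightarrow> lmon I x e \<in> L W"
  using lspan_term[OF unital_subringD(2)[OF K], of e W I x] by simp

lemma L_one: "(\<lambda>_. 0) \<in> W \<Longrightarrow> 1 \<in> L W"
  using L_mon[of "\<lambda>_. 0" W] by (simp add: iexps_zero)

lemma L_mult:
  assumes "f \<in> L W1" "g \<in> L W2"
    and W: "\<And>e e'. \<lbrakk>e \<in> W1; e' \<in> W2; e \<in> iexps I; e' \<in> iexps I\<rbrakk> \<Longrightarrow> (\<lambda>i. e i + e' i) \<in> W3"
  shows "f * g \<in> L W3"
  using assms(1)
proof (induction rule: lspan.induct)
  case zero
  show ?case by (simp add: lspan.zero)
next
  case (add c e f)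
  have "c * lmon I x e * g \<in> L W3" using assms(2)
  proof (induction rule: lspan.induct)
    case zero
    show ?case by (simp add: lspan.zero)
  next
    case (add c' e' h)
    have "c * lmon I x e * (c' * lmon I x e' + h) = (c * c') * lmon I x (\<lambda>i. e i + e' i) + c * lmon I x e * h"
      by (simp add: lmon_plus algebra_simps)
    moreover have "c * c' \<in> K" using unital_subringD(5)[OF K] add.hyps \<open>c \<in> K\<close> by blast
    moreover have "(\<lambda>i. e i + e' i) \<in> W3" "(\<lambda>i. e i + e' i) \<in> iexps I"
      using add.hyps \<open>e \<in> W1\<close> \<open>e \<in> iexps I\<close> by (auto intro: W iexps_add)
    ultimately show ?case
      using add.IH by (simp only: lspan.add)
  qed
  with add show ?case by (simp add: distrib_right lspan_plus)
qed

lemma L_uminus: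
  assumes "f \<in> L W" shows "- f \<in> L W"
proof -
  have "f * (- 1) \<in> L W"
  proof (rule L_mult[OF assms])
    show "- 1 \<in> L {\<lambda>_. 0}"
      using lspan_term[OF unital_subringD(6)[OF K unital_subringD(2)[OF K]], of "\<lambda>_. 0" "{\<lambda>_. 0}" I x]
      by (simp add: iexps_zero)
  qed simp
  then show ?thesis by simp
qed

lemma L_diff: "f \<in> L W \<Longrightarrow> g \<in> L W \<Longrightarrow> f - g \<in> L W"
  using lspan_plus[of f K I x W "- g"] L_uminus by simp

lemma L_power:
  assumes "f \<in> L W" "(\<lambda>_. 0) \<in> W" "\<And>e e'. \<lbrakk>e \<in> W; e' \<in> W\<rbrakk> \<Longrightarrow> (\<lambda>i. e i + e' i) \<in> W"
  shows "f ^ n \<in> L W"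
  by (induction n) (use assms L_one in \<open>auto intro: L_mult\<close>)

text \<open>Independence forces the coefficients of two expansions of \<open>f\<close> to agree, so
  their supports coincide.\<close>

lemma L_Int:
  assumes "f \<in> L W1" "f \<in> L W2"
  shows "f \<in> L (W1 \<inter> W2)"
proof -
  obtain M c where M: "finite M" "M \<subseteq> W1 \<inter> iexps I" "\<forall>e\<in>M. c e \<in> K \<and> c e \<noteq> 0"
    "f = (\<Sum>e\<in>M. c e * lmon I x e)" using lspan_rep[OF K assms(1)] by blast
  obtain N d where N: "finite N" "N \<subseteq> W2 \<inter> iexps I" "\<forall>e\<in>N. d e \<in> K \<and> d e \<noteq> 0"
    "f = (\<Sum>e\<in>N. d e * lmon I x e)" using lspan_rep[OF K assms(2)] by blast
  define a where "a e = (if e \<in> M then c e else 0)" for e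
  define b where "b e = (if e \<in> N then d e else 0)" for e
  have "(\<Sum>e\<in>M \<union> N. (a e - b e) * lmon I x e) = (\<Sum>e\<in>M \<union> N. a e * lmon I x e) - (\<Sum>e\<in>M \<union> N. b e * lmon I x e)"
    by (simp add: left_diff_distrib sum_subtractf)
  also have "(\<Sum>e\<in>M \<union> N. a e * lmon I x e) = f"
    unfolding M(4) a_def using M(1) N(1) by (intro sum.mono_neutral_cong_right) auto
  also have "(\<Sum>e\<in>M \<union> N. b e * lmon I x e) = f"
    unfolding N(4) b_def using M(1) N(1) by (intro sum.mono_neutral_cong_right) auto
  finally have "(\<Sum>e\<in>M \<union> N. (a e - b e) * lmon I x e) = 0" by simp
  moreover have "\<forall>e\<in>M \<union> N. a e - b e \<in> K"
    unfolding a_def b_def using M N unital_subringD[OF K] by auto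
  ultimately have eq: "a e - b e = 0" if "e \<in> M \<union> N" for e
    using indepD[of "M \<union> N" "\<lambda>e. a e - b e" e] M N that by auto
  have "M \<subseteq> W1 \<inter> W2"
  proof
    fix e assume "e \<in> M"
    then have "e \<in> N" using eq[of e] M(3) unfolding a_def b_def by (auto split: if_splits)
    then show "e \<in> W1 \<inter> W2" using \<open>e \<in> M\<close> M N by blast
  qed
  then show ?thesis unfolding M(4) using M by (intro lspan_sum lspan_term) auto
qed

lemma L_disjoint: "f \<in> L W1 \<Longrightarrow> f \<in> L W2 \<Longrightarrow> W1 \<inter> W2 \<inter> iexps I = {} \<Longrightarrow> f = 0"
  using L_Int[of f W1 W2] lspan_empty lspan_mono[of f K I x "W1 \<inter> W2" K "{}"] by blast

text \<open>Comparison of components in a grading: typically \<open>W1\<close> is one degree and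
  \<open>W2\<close> contains only other degrees.\<close>

lemma L_component_eq:
  assumes "g + h = g' + h'" "g \<in> L W1" "g' \<in> L W1" "h \<in> L W2" "h' \<in> L W2" "W1 \<inter> W2 = {}"
  shows "g = g'"
proof -
  have "g - g' = h' - h" using assms(1) by (simp add: algebra_simps)
  then have "g - g' = 0" using assms L_disjoint[of "g - g'" W1 W2] L_diff by (metis inf_bot_left)
  then show ?thesis by simp
qed

lemma L_support:
  assumes M: "finite M" "M \<subseteq> iexps I" "\<forall>e\<in>M. c e \<in> K \<and> c e \<noteq> 0" and f: "(\<Sum>e\<in>M. c e * lmon I x e) \<in> L W"
  shows "M \<subseteq> W"
proof
  fix e assume e: "e \<in> M"
  show "e \<in> W"
  proof (rule ccontr)
    assume "e \<notin> W"
    have "c e * lmon I x e = 0"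
    proof (rule L_component_eq)
      show "c e * lmon I x e + (\<Sum>e\<in>M - {e}. c e * lmon I x e) = 0 + (\<Sum>e\<in>M. c e * lmon I x e)"
        using M(1) e by (simp add: sum.remove)
      show "(\<Sum>e\<in>M. c e * lmon I x e) \<in> L (- {e})" using \<open>e \<notin> W\<close> by (intro lspan_mono[OF f]) auto
      show "c e * lmon I x e \<in> L {e}" "(\<Sum>e\<in>M - {e}. c e * lmon I x e) \<in> L (- {e})"
        using M e by (auto intro!: lspan_sum lspan_term)
    qed (auto intro: lspan.zero)
    then show False using M e lmon_nz by auto
  qed
qed

lemma L_rep:
  assumes "f \<in> L UNIV"
  obtains M c where "finite M" "M \<subseteq> iexps I" "\<forall>e\<in>M. c e \<in> K \<and> c e \<noteq> 0"
    "f = (\<Sum>e\<in>M. c e * lmon I x e)" "\<And>W. f \<in> L W \<longleftrightarrow> M \<subseteq> W"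
proof -
  obtain M c where M: "finite M" "M \<subseteq> UNIV \<inter> iexps I" "\<forall>e\<in>M. c e \<in> K \<and> c e \<noteq> 0"
    "f = (\<Sum>e\<in>M. c e * lmon I x e)" using lspan_rep[OF K assms] by blast
  have "M \<subseteq> W" if "f \<in> L W" for W
    using L_support[of M c W] M that by simp
  moreover have "f \<in> L W" if "M \<subseteq> W" for W
    unfolding M(4) using M that by (intro lspan_sum lspan_term) auto
  ultimately show ?thesis using that[of M c] M by blast
qed

lemma L_UNIV: "f \<in> L W \<Longrightarrow> f \<in> L UNIV"
  by (rule lspan_mono) auto

lemma L_mult_UNIV: "f \<in> L UNIV \<Longrightarrow> g \<in> L UNIV \<Longrightarrow> f * g \<in> L UNIV"
  by (rule L_mult) auto

lemma L_var_powi: "k \<in> I \<Longrightarrow> (\<lambda>i. if i = k then d else 0) \<in> W \<Longrightarrow> x k powi d \<in> L W"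
  using L_mon[of "\<lambda>i. if i = k then d else 0" W] by (simp add: iexps_single lmon_single fin)

end

section \<open>Exchange relations\<close>

context laurent_ring
begin

text \<open>Only finitely many exponents occur in \<open>f\<close>; the bound starts the inductions
  on degree.\<close>

lemma L_bounded:
  fixes \<phi> :: "(nat \<Rightarrow> int) \<Rightarrow> int"
  assumes "f \<in> L W"
  shows "\<exists>b::nat. f \<in> L (W \<inter> {e. \<bar>\<phi> e\<bar> \<le> int b})"
  using assms
proof (induction rule: lspan.induct)
  case zero
  show ?case by (blast intro: lspan.zero)
next
  case (add c e f)
  then obtain b where b: "f \<in> L (W \<inter> {e. \<bar>\<phi> e\<bar> \<le> int b})" by blast
  let ?W = "W \<inter> {e'. \<bar>\<phi> e'\<bar> \<le> int (max b (nat \<bar>\<phi> e\<bar>))}"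
  have "f \<in> L ?W" by (rule lspan_mono[OF b]) auto
  moreover have "e \<in> ?W" using add.hyps by auto
  ultimately have "c * lmon I x e + f \<in> L ?W" using add.hyps by (intro lspan.add)
  then show ?case by blast
qed

text \<open>A monomial in the new variables with exponent \<open>e k\<close> is \<open>P\<close> to
  the power \<open>e k\<close> times a monomial of degree \<open>- e k\<close> in
  \<open>x k\<close>. As \<open>P\<close> is free of \<open>x k\<close>, a relation splits by that
  degree, and in each component the common power of \<open>P\<close> cancels.\<close>

lemma indep_exchange:
  assumes k: "k \<in> I" and P: "P \<in> L {e. e k = 0}" "P \<noteq> 0"
  shows "laurent_indep K I (x(k := P / x k))"
proof -
  let ?y = "x(k := P / x k)"
  have lm: "lmon I ?y e = P powi e k * lmon I x (e(k := - e k))" for e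
  proof -
    have "lmon I ?y e = (P / x k) powi e k * lmon I x (e(k := 0))"
      using lmon_upd[OF fin k] .
    moreover have "lmon I x (e(k := - e k)) = x k powi (- e k) * lmon I x (e(k := 0))"
      using lmon_remove[OF fin k, of x "e(k := - e k)"] by simp
    ultimately show ?thesis by (simp add: power_int_divide_distrib power_int_minus_divide)
  qed
  have "c e0 = 0" if M: "finite M" "M \<subseteq> iexps I" "\<forall>e\<in>M. c e \<in> K"
    and s: "(\<Sum>e\<in>M. c e * lmon I ?y e) = 0" and e0: "e0 \<in> M" for M c e0
  proof -
    \<comment> \<open>\<open>N\<close> is at least every \<open>- e k\<close>, so multiplying the
      relation by the \<open>N\<close>-th power of \<open>P\<close> leaves no negative power of
      \<open>P\<close>.\<close>
    define N where "N = (\<Sum>e\<in>M. \<bar>e k\<bar>)"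
    have N: "N + e k \<ge> 0" if "e \<in> M" for e
    proof -
      have "\<bar>e k\<bar> \<le> N" unfolding N_def using M(1) that by (intro member_le_sum) auto
      then show ?thesis by linarith
    qed
    define h where "h e = c e * (P ^ nat (N + e k) * lmon I x (e(k := - e k)))" for e
    have hL: "h e \<in> L {e'. e' k = - e k}" if "e \<in> M" for e
    proof -
      have p: "P ^ nat (N + e k) * lmon I x (e(k := - e k)) \<in> L {e'. e' k = - e k}"
      proof (rule L_mult[OF L_power[OF P(1)]])
        show "lmon I x (e(k := - e k)) \<in> L {e'. e' k = - e k}"
          using M that k by (intro L_mon iexps_upd) auto
      qed auto
      have "c e \<in> L {\<lambda>_. 0}"
        using lspan_term[of "c e" K "\<lambda>_. 0" "{\<lambda>_. 0}" I x] M that by (simp add: iexps_zero)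
      from L_mult[OF this p] show ?thesis unfolding h_def by auto
    qed
    have "(\<Sum>e\<in>M. h e) = P powi N * (\<Sum>e\<in>M. c e * lmon I ?y e)"
      unfolding sum_distrib_left
    proof (intro sum.cong refl)
      fix e assume "e \<in> M"
      then have "P ^ nat (N + e k) = P powi N * P powi e k"
        using N P(2) by (simp add: power_int_add flip: power_int_of_nat)
      then show "h e = P powi N * (c e * lmon I ?y e)" unfolding h_def lm by simp
    qed
    then have z: "(\<Sum>e\<in>M. h e) = 0" using s by simp
    define M0 where "M0 = {e\<in>M. e k = e0 k}"
    have "(\<Sum>e\<in>M. h e) = (\<Sum>e\<in>M0. h e) + (\<Sum>e\<in>M - M0. h e)"
      using M(1) by (subst sum.subset_diff[of M0 M]) (auto simp: M0_def)
    moreover have "(\<Sum>e\<in>M0. h e) \<in> L {e. e k = - e0 k}"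
      by (intro lspan_sum, rule lspan_mono[OF hL]) (auto simp: M0_def)
    moreover have "(\<Sum>e\<in>M - M0. h e) \<in> L {e. e k \<noteq> - e0 k}"
    proof (intro lspan_sum)
      fix e assume "e \<in> M - M0"
      then show "h e \<in> L {e. e k \<noteq> - e0 k}"
        by (intro lspan_mono[OF hL]) (auto simp: M0_def)
    qed
    ultimately have "(\<Sum>e\<in>M0. h e) = 0"
      using L_component_eq[of "\<Sum>e\<in>M0. h e" "\<Sum>e\<in>M - M0. h e" 0 0 "{e. e k = - e0 k}" "{e. e k \<noteq> - e0 k}"] z
      by (auto intro: lspan.zero)
    moreover have "(\<Sum>e\<in>M0. h e) = P ^ nat (N + e0 k) * (\<Sum>e\<in>M0. c e * lmon I x (e(k := - e k)))"
      unfolding sum_distrib_left by (intro sum.cong) (auto simp: h_def M0_def)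
    ultimately have s0: "(\<Sum>e\<in>M0. c e * lmon I x (e(k := - e k))) = 0" using P(2) by simp
    define \<phi> where "\<phi> e = e(k := - e k)" for e :: "nat \<Rightarrow> int"
    have inv: "\<phi> (\<phi> e) = e" for e unfolding \<phi>_def by auto
    then have inj: "inj_on \<phi> M0" by (metis inj_onI)
    have "(\<Sum>e\<in>\<phi> ` M0. c (\<phi> e) * lmon I x e) = 0"
      using s0 by (subst sum.reindex[OF inj]) (simp add: inv, simp add: \<phi>_def)
    moreover have "finite (\<phi> ` M0)" "\<phi> ` M0 \<subseteq> iexps I" "\<forall>e\<in>\<phi> ` M0. c (\<phi> e) \<in> K"
      using M k by (auto simp: M0_def inv) (auto simp: \<phi>_def intro: iexps_upd)
    ultimately have "c (\<phi> (\<phi> e0)) = 0"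
      using indepD[of "\<phi> ` M0" "\<lambda>e. c (\<phi> e)" "\<phi> e0"] e0 by (auto simp: M0_def)
    then show ?thesis by (simp add: inv)
  qed
  moreover have "\<forall>i\<in>I. ?y i \<noteq> 0" using nz k P(2) by auto
  ultimately show ?thesis unfolding laurent_indep_def by blast
qed

text \<open>Coprimality of two binomials that \<open>\<phi>\<close> separates. Multiplication by
  \<open>lmon I x \<beta>\<close> raises the degree while \<open>lmon I x \<gamma>\<close> preserves
  it, so the lowest component of \<open>g\<close> is \<open>1 + lmon I x \<gamma>\<close> times that
  of \<open>r\<close>. Splitting it off shortens the range of degrees of \<open>g\<close>, on whose
  width \<open>N\<close> the induction runs.\<close>

lemma coprime_binomials:
  fixes \<phi> :: "(nat \<Rightarrow> int) \<Rightarrow> int"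
  assumes V: "\<And>e e'. e \<in> V \<Longrightarrow> e' \<in> V \<Longrightarrow> (\<lambda>i. e i + e' i) \<in> V"
    and \<phi>: "\<And>e e'. \<phi> (\<lambda>i. e i + e' i) = \<phi> e + \<phi> e'"
    and \<beta>: "\<beta> \<in> iexps I" "\<beta> \<in> V" "\<phi> \<beta> > 0" and \<gamma>: "\<gamma> \<in> iexps I" "\<gamma> \<in> V" "\<phi> \<gamma> = 0"
    and g: "g \<in> L V" and r: "r \<in> L V"
    and eq: "g * (1 + lmon I x \<beta>) = (1 + lmon I x \<gamma>) * r"
  shows "\<exists>r'\<in>L V. g = (1 + lmon I x \<gamma>) * r'"
proof -
  let ?B = "lmon I x \<beta>" and ?C = "lmon I x \<gamma>"
  have B: "?B \<in> L (V \<inter> {\<beta>})" and C: "?C \<in> L (V \<inter> {\<gamma>})" using \<beta> \<gamma> by (auto intro: L_mon)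
  have main: "\<exists>r'\<in>L V. g = (1 + ?C) * r'"
    if "g \<in> L (V \<inter> {e. k \<le> \<phi> e \<and> \<phi> e < k + int N})" "r \<in> L V" "g * (1 + ?B) = (1 + ?C) * r" for g r k N
    using that
  proof (induction N arbitrary: g r k)
    case 0
    then have "g \<in> L {}" by (elim lspan_mono) auto
    then have "g = 0" by (rule lspan_empty)
    then show ?case using lspan.zero by (metis mult_zero_right)
  next
    case (Suc N)
    let ?V1 = "V \<inter> {e. \<phi> e = k}" and ?V2 = "V \<inter> {e. k + 1 \<le> \<phi> e \<and> \<phi> e < k + 1 + int N}"
      and ?V3 = "V \<inter> {e. \<phi> e \<noteq> k}"
    have "g \<in> L (?V1 \<union> ?V2)" by (rule lspan_mono[OF Suc.prems(1)]) auto
    then obtain g0 g1 where g: "g0 \<in> L ?V1" "g1 \<in> L ?V2" "g = g0 + g1" using lspan_union by blast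
    have "r \<in> L (?V1 \<union> ?V3)" by (rule lspan_mono[OF Suc.prems(2)]) auto
    then obtain r0 r1 where r: "r0 \<in> L ?V1" "r1 \<in> L ?V3" "r = r0 + r1" using lspan_union by blast
    have "g0 + (g1 + g1 * ?B + g0 * ?B) = (r0 + r0 * ?C) + (r1 + r1 * ?C)"
      using Suc.prems(3) unfolding g(3) r(3) by (simp add: algebra_simps)
    moreover have "r0 + r0 * ?C \<in> L ?V1"
      by (rule lspan_plus[OF r(1) L_mult[OF r(1) C]]) (auto simp: V \<phi> \<gamma>)
    moreover have "r1 + r1 * ?C \<in> L ?V3"
      by (rule lspan_plus[OF r(2) L_mult[OF r(2) C]]) (auto simp: V \<phi> \<gamma>)
    moreover have "g1 + g1 * ?B + g0 * ?B \<in> L ?V3"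
    proof (intro lspan_plus)
      show "g1 \<in> L ?V3" by (rule lspan_mono[OF g(2)]) auto
      show "g1 * ?B \<in> L ?V3" by (rule L_mult[OF g(2) B]) (use \<beta> in \<open>auto simp: V \<phi>\<close>)
      show "g0 * ?B \<in> L ?V3" by (rule L_mult[OF g(1) B]) (use \<beta> in \<open>auto simp: V \<phi>\<close>)
    qed
    moreover have "?V1 \<inter> ?V3 = {}" by auto
    ultimately have g0: "g0 = r0 + r0 * ?C" using g(1) L_component_eq by blast
    have rV: "r0 \<in> L V" "r0 * ?B \<in> L V"
      using lspan_mono[OF r(1), of K V] L_mult[OF r(1) B, of V] by (auto simp: V)
    \<comment> \<open>This is the equation with \<open>(1 + ?C) * r0 * (1 + ?B)\<close> subtracted
      from both sides.\<close>
    have "g1 * (1 + ?B) = (1 + ?C) * (r - (r0 + r0 * ?B))"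
      using Suc.prems(3) unfolding g(3) g0 by (simp add: algebra_simps)
    then obtain r' where "r' \<in> L V" "g1 = (1 + ?C) * r'"
      using Suc.IH[OF g(2) L_diff[OF Suc.prems(2) lspan_plus[OF rV]]] by blast
    then have "g = (1 + ?C) * (r' + r0)" "r' + r0 \<in> L V"
      using g(3) g0 rV lspan_plus by (auto simp: algebra_simps)
    then show ?case by blast
  qed
  obtain b :: nat where "g \<in> L (V \<inter> {e. \<bar>\<phi> e\<bar> \<le> int b})" using L_bounded[OF g, of \<phi>] by blast
  then have "g \<in> L (V \<inter> {e. - int b \<le> \<phi> e \<and> \<phi> e < - int b + int (2 * b + 1)})"
    by (elim lspan_mono) auto
  then show ?thesis using main r eq by blast
qed

end

text \<open>Both rings are Laurent polynomial rings in one variable, \<open>x j\<close> and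
  \<open>v j\<close> respectively, over the common coefficient ring \<open>L0\<close>; inside the
  field they are linked by \<open>x j * v j = Q\<close>.\<close>

locale laurent_exchange = laurent_ring +
  fixes j :: nat and Q :: 'a and v :: "nat \<Rightarrow> 'a"
  assumes j: "j \<in> I" and Q: "Q \<in> lspan K I x {e. e j = 0}" "Q \<noteq> 0"
    and v: "v = x(j := Q / x j)"
begin

sublocale new: laurent_ring K I v
  using K fin indep_exchange[OF j Q] unfolding v by unfold_locales

abbreviation "L0 \<equiv> L {e. e j = 0}"
abbreviation "LV \<equiv> lspan K I v UNIV"

lemma v_j: "v j = Q / x j"
  using v by simp

lemma L0_mult: "f \<in> L0 \<Longrightarrow> g \<in> L0 \<Longrightarrow> f * g \<in> L0"
  by (rule L_mult) auto

lemma L0_power: "f \<in> L0 \<Longrightarrow> f ^ n \<in> L0"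
  by (rule L_power) auto

lemma L0_new: "f \<in> L0 \<Longrightarrow> f \<in> LV"
proof (induction rule: lspan.induct)
  case zero
  show ?case by (rule lspan.zero)
next
  case (add c e f)
  then have "lmon I x e = lmon I v e" unfolding v by (simp add: lmon_upd_zero)
  then show ?case using add by (simp add: lspan.add)
qed

lemma old_var_new: "x j \<in> LV"
proof -
  have "x j = Q * v j powi (- 1)" using Q(2) nzD[OF j] by (simp add: v_j)
  then show ?thesis using L0_new[OF Q(1)] new.L_var_powi[OF j, of "- 1" UNIV] new.L_mult_UNIV by auto
qed

lemma nonneg_new: "f \<in> L {e. e j \<ge> 0} \<Longrightarrow> f \<in> LV"
proof (induction rule: lspan.induct)
  case zero
  show ?case by (rule lspan.zero)
next
  case (add c e f)
  have "c * lmon I x e = c * lmon I x (e(j := 0)) * x j ^ nat (e j)"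
    using lmon_remove[OF fin j, of x e] add.hyps by (simp add: power_int_def)
  moreover have "c * lmon I x (e(j := 0)) \<in> LV"
    using add.hyps j by (intro L0_new lspan_term iexps_upd) auto
  moreover have "x j ^ nat (e j) \<in> LV" by (rule new.L_power[OF old_var_new]) auto
  ultimately show ?case using add.IH by (simp only: lspan_plus new.L_mult_UNIV)
qed

lemma var_powi_cancel: "x j powi d * x j powi (- d) = 1"
  using nzD[OF j] by (simp add: power_int_minus power_int_not_zero)

lemma degree_shift: "f \<in> L {e. e j = a} \<longleftrightarrow> f * x j powi d \<in> L {e. e j = a + d}"
proof
  assume "f \<in> L {e. e j = a}"
  then show "f * x j powi d \<in> L {e. e j = a + d}"
    by (rule L_mult[OF _ L_var_powi[OF j, of d "{e. e j = d}"]]) auto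
next
  assume "f * x j powi d \<in> L {e. e j = a + d}"
  then have "f * x j powi d * x j powi (- d) \<in> L {e. e j = a}"
    by (rule L_mult[OF _ L_var_powi[OF j, of "- d" "{e. e j = - d}"]]) auto
  then show "f \<in> L {e. e j = a}" by (simp add: mult.assoc var_powi_cancel)
qed

text \<open>Degree \<open>- int b\<close> in \<open>x j\<close> is produced only by
  \<open>v j ^ b = Q ^ b / x j ^ b\<close>, so that component carries the factor
  \<open>Q ^ b\<close>. Negative powers of \<open>v j\<close> have powers of \<open>Q\<close> in the
  denominator and need not lie in the old ring; \<open>Q ^ N\<close> clears them.\<close>

lemma new_component:
  fixes b :: nat
  assumes "f \<in> LV"
  shows "\<exists>N r h. r \<in> L0 \<and> h \<in> L {e. e j \<noteq> - int b} \<and> Q ^ N * f = Q ^ (N + b) * r * x j powi (- int b) + h"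
  using assms
proof (induction rule: lspan.induct)
  case zero
  show ?case by (intro exI[of _ 0]) (auto intro: lspan.zero)
next
  case (add c e f)
  then obtain N r h where IH: "r \<in> L0" "h \<in> L {e. e j \<noteq> - int b}"
    "Q ^ N * f = Q ^ (N + b) * r * x j powi (- int b) + h" by blast
  define s where "s = c * lmon I x (e(j := 0))"
  have s: "s \<in> L0" unfolding s_def using add.hyps j by (intro lspan_term iexps_upd) auto
  define n where "n = nat (- e j)"
  have "c * lmon I v e = s * (Q / x j) powi e j"
    unfolding v s_def using lmon_upd[OF fin j, of x "Q / x j" e] by simp
  moreover have "Q ^ (n + N) * Q powi e j = Q ^ nat (int (n + N) + e j)"
  proof -
    have "Q ^ (n + N) * Q powi e j = Q powi (int (n + N) + e j)"
      using Q(2) power_int_add[of Q "int (n + N)" "e j"] by (simp del: of_nat_add)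
    also have "\<dots> = Q ^ nat (int (n + N) + e j)" unfolding n_def by (auto simp: power_int_def)
    finally show ?thesis .
  qed
  ultimately have t: "Q ^ (n + N) * (c * lmon I v e) = Q ^ nat (int (n + N) + e j) * s * x j powi (- e j)"
    by (simp add: power_int_divide_distrib power_int_minus_divide algebra_simps)
  have "Q ^ (n + N) * f = Q ^ n * (Q ^ N * f)" by (simp add: power_add)
  also have "\<dots> = Q ^ (n + N + b) * r * x j powi (- int b) + Q ^ n * h"
    unfolding IH(3) by (simp add: power_add algebra_simps)
  finally have f: "Q ^ (n + N) * f = Q ^ (n + N + b) * r * x j powi (- int b) + Q ^ n * h" .
  have h: "Q ^ n * h \<in> L {e. e j \<noteq> - int b}"
    by (rule L_mult[OF L0_power[OF Q(1)] IH(2)]) auto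
  show ?case
  proof (cases "e j = int b")
    case True
    then have "nat (int (n + N) + e j) = n + N + b" by simp
    then have "Q ^ (n + N) * (c * lmon I v e + f) = Q ^ (n + N + b) * (s + r) * x j powi (- int b) + Q ^ n * h"
      unfolding distrib_left t f using True by (simp add: algebra_simps)
    then show ?thesis using s IH(1) h lspan_plus by blast
  next
    case False
    define h' where "h' = Q ^ nat (int (n + N) + e j) * s * x j powi (- e j) + Q ^ n * h"
    have "Q ^ nat (int (n + N) + e j) * s * x j powi (- e j) \<in> L {e'. e' j = 0 + - e j}"
      using degree_shift L0_mult L0_power Q(1) s by blast
    then have "Q ^ nat (int (n + N) + e j) * s * x j powi (- e j) \<in> L {e. e j \<noteq> - int b}"
      by (rule lspan_mono) (use False in auto)
    then have "h' \<in> L {e. e j \<noteq> - int b}" unfolding h'_def using h lspan_plus by blast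
    moreover have "Q ^ (n + N) * (c * lmon I v e + f) = Q ^ (n + N + b) * r * x j powi (- int b) + h'"
      unfolding distrib_left t f h'_def by (simp add: algebra_simps)
    ultimately show ?thesis using IH(1) by blast
  qed
qed

lemma lowest_divisible:
  fixes b :: nat
  assumes "g * x j powi (- int b) + h \<in> LV" "g \<in> L0" "h \<in> L {e. e j > - int b}"
  shows "\<exists>r\<in>L0. g = Q ^ b * r"
proof -
  obtain N r h' where r: "r \<in> L0" "h' \<in> L {e. e j \<noteq> - int b}"
    "Q ^ N * (g * x j powi (- int b) + h) = Q ^ (N + b) * r * x j powi (- int b) + h'"
    using new_component[OF assms(1), of b] by blast
  have "Q ^ N * g * x j powi (- int b) = Q ^ (N + b) * r * x j powi (- int b)"
  proof (rule L_component_eq)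
    show "Q ^ N * g * x j powi (- int b) + Q ^ N * h = Q ^ (N + b) * r * x j powi (- int b) + h'"
      using r(3) by (simp add: algebra_simps)
    show "Q ^ N * g * x j powi (- int b) \<in> L {e. e j = 0 + - int b}"
      "Q ^ (N + b) * r * x j powi (- int b) \<in> L {e. e j = 0 + - int b}"
      using degree_shift L0_mult L0_power Q(1) assms(2) r(1) by blast+
    show "Q ^ N * h \<in> L {e. e j \<noteq> - int b}"
      by (rule L_mult[OF L0_power[OF Q(1)] assms(3)]) auto
  qed (use r in auto)
  then have "g = Q ^ b * r"
    using Q(2) nzD[OF j] by (simp add: power_add power_int_not_zero)
  then show ?thesis using r(1) by blast
qed

lemma cancel_factor:
  assumes l: "l \<in> L0" and cop: "\<forall>g\<in>L0. \<forall>r\<in>L0. g * l = Q * r \<longrightarrow> (\<exists>r'\<in>L0. g = Q * r')"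
    and "g \<in> L0" "r \<in> L0" "g * l = Q ^ n * r"
  shows "\<exists>r'\<in>L0. g = Q ^ n * r'"
  using assms(3-5)
proof (induction n arbitrary: g)
  case 0
  then show ?case by auto
next
  case (Suc n)
  have "g * l = Q * (Q ^ n * r)" using Suc.prems by (simp add: mult.assoc)
  then obtain g' where g': "g' \<in> L0" "g = Q * g'" using cop Suc.prems L0_mult L0_power Q(1) by blast
  then have "g' * l = Q ^ n * r" using Suc.prems(3) Q(2) by (simp add: mult.assoc)
  then show ?case using Suc.IH[OF g'(1) Suc.prems(2)] g'(2) by (auto simp: mult.assoc)
qed

text \<open>The lowest component of \<open>f * a\<close> comes from the lowest component
  \<open>g0\<close> of \<open>f\<close> and from \<open>l * v j\<close>. It is divisible by a power
  of \<open>Q\<close>, and coprimality of \<open>l\<close> to \<open>Q\<close> moves this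
  divisibility to \<open>g0\<close>, which is therefore an \<open>L0\<close>-multiple of a power of
  \<open>v j\<close>. Removing \<open>g0\<close> raises the degree bound of
  \<open>f\<close>.\<close>

lemma descend:
  fixes b :: nat
  assumes l: "l \<in> L0" and cop: "\<forall>g\<in>L0. \<forall>r\<in>L0. g * l = Q * r \<longrightarrow> (\<exists>r'\<in>L0. g = Q * r')"
    and a: "a = l * v j + a'" "a' \<in> L {e. e j \<ge> 0}" "a \<in> LV"
    and "f \<in> L {e. e j \<ge> - int b}" "f * a \<in> LV"
  shows "f \<in> LV"
  using assms(6-7)
proof (induction b arbitrary: f)
  case 0
  then show ?case using nonneg_new by simp
next
  case (Suc b)
  have "f \<in> L ({e. e j = - int (Suc b)} \<union> {e. e j \<ge> - int b})"
    by (rule lspan_mono[OF Suc.prems(1)]) auto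
  then obtain g0 f' where f: "g0 \<in> L {e. e j = - int (Suc b)}" "f' \<in> L {e. e j \<ge> - int b}" "f = g0 + f'"
    using lspan_union by blast
  define g where "g = g0 * x j powi (int (Suc b))"
  have g: "g \<in> L0"
    using degree_shift[of g0 "- int (Suc b)" "int (Suc b)"] f(1) unfolding g_def by simp
  have g0: "g0 = g * x j powi (- int (Suc b))"
    unfolding g_def by (simp only: mult.assoc var_powi_cancel mult_1_right)
  have xj: "x j powi (- int (Suc b)) * v j = Q * x j powi (- int (b + 2))"
  proof -
    have "x j powi (- int (Suc b)) * (x j powi (- 1)) = x j powi (- int (b + 2))"
      using nzD[OF j] by (subst power_int_add[symmetric]) auto
    moreover have "x j powi (- int (Suc b)) * (Q / x j) = Q * (x j powi (- int (Suc b)) * (x j powi (- 1)))"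
      by (simp add: divide_inverse)
    ultimately show ?thesis unfolding v_j by simp
  qed
  define h where "h = g0 * a' + f' * (l * v j) + f' * a'"
  \<comment> \<open>The degree is \<open>- (b + 2)\<close>: \<open>b + 1\<close> comes from
    \<open>g0\<close> and one more from \<open>v j = Q / x j\<close>. The extra factor
    \<open>Q\<close> cancels one of the \<open>b + 2\<close> obtained below.\<close>
  have "f * a = (g * l * Q) * x j powi (- int (b + 2)) + h"
    unfolding f(3) a(1) h_def distrib_left distrib_right
    using xj unfolding g0 by (simp add: algebra_simps)
  moreover have "h \<in> L {e. e j > - int (b + 2)}"
    unfolding h_def
  proof (intro lspan_plus)
    show "g0 * a' \<in> L {e. e j > - int (b + 2)}" by (rule L_mult[OF f(1) a(2)]) auto
    show "f' * a' \<in> L {e. e j > - int (b + 2)}" by (rule L_mult[OF f(2) a(2)]) auto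
    have "l * v j = (l * Q) * x j powi (- 1)" unfolding v_j by (simp add: divide_inverse)
    then have "l * v j \<in> L {e. e j = 0 + - 1}" using degree_shift L0_mult l Q(1) by metis
    then show "f' * (l * v j) \<in> L {e. e j > - int (b + 2)}" by (rule L_mult[OF f(2)]) auto
  qed
  ultimately obtain r where r: "r \<in> L0" "g * l * Q = Q ^ (b + 2) * r"
    using lowest_divisible[of "g * l * Q" "b + 2" h] Suc.prems(2) L0_mult g l Q(1) by metis
  then have "g * l = Q ^ Suc b * r" using Q(2) by simp
  then obtain r' where r': "r' \<in> L0" "g = Q ^ Suc b * r'" using cancel_factor[OF l cop g r(1)] by blast
  have "g0 = r' * v j ^ Suc b"
    unfolding g0 r'(2) v_j using nzD[OF j]
    by (simp add: power_divide power_int_minus divide_inverse power_inverse algebra_simps del: power_Suc of_nat_Suc)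
  moreover have "v j ^ Suc b \<in> LV"
    using new.L_power[OF new.L_var_powi[OF j, of 1 UNIV]] by (simp del: power_Suc)
  ultimately have g0V: "g0 \<in> LV" using L0_new[OF r'(1)] new.L_mult_UNIV by simp
  have "f' * a = f * a - g0 * a" unfolding f(3) by (simp add: algebra_simps)
  then have "f' * a \<in> LV" using Suc.prems(2) g0V a(3) new.L_mult_UNIV new.L_diff by simp
  then have "f' \<in> LV" using Suc.IH f(2) by blast
  then show ?case using g0V f(3) lspan_plus by blast
qed

lemma descend_power:
  assumes l: "l \<in> L0" and cop: "\<forall>g\<in>L0. \<forall>r\<in>L0. g * l = Q * r \<longrightarrow> (\<exists>r'\<in>L0. g = Q * r')"
    and a: "a = l * v j + a'" "a' \<in> L {e. e j \<ge> 0}" "a \<in> LV"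
    and f: "f \<in> L UNIV" "f * a ^ N \<in> LV"
  shows "f \<in> LV"
  using f
proof (induction N arbitrary: f)
  case 0
  then show ?case by simp
next
  case (Suc N)
  have "l * v j = (l * Q) * x j powi (- 1)" unfolding v_j by (simp add: divide_inverse)
  then have "l * v j \<in> L {e. e j = 0 + - 1}" using degree_shift L0_mult l Q(1) by metis
  then have "a \<in> L UNIV" unfolding a(1) using a(2) L_UNIV lspan_plus by blast
  then have "f * a \<in> LV"
    using Suc.IH[of "f * a"] Suc.prems L_mult_UNIV by (simp add: mult.assoc)
  moreover obtain b :: nat where "f \<in> L (UNIV \<inter> {e. \<bar>e j\<bar> \<le> int b})"
    using L_bounded[OF Suc.prems(1), of "\<lambda>e. e j"] by blast
  then have "f \<in> L {e. e j \<ge> - int b}" by (elim lspan_mono) auto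
  ultimately show ?case using descend[OF l cop a] by blast
qed

end

definition exch :: "nat set \<Rightarrow> (nat \<Rightarrow> 'a::field) \<Rightarrow> (nat \<Rightarrow> int) \<Rightarrow> 'a" where
  "exch I x b = lmon I x (\<lambda>i. max 0 (b i)) + lmon I x (\<lambda>i. max 0 (- b i))"

lemma exch_uminus: "exch I x (\<lambda>i. - b i) = exch I x b"
  unfolding exch_def by (simp add: add.commute)

lemma exch_upd: "b k = 0 \<Longrightarrow> exch I (x(k := u)) b = exch I x b"
  unfolding exch_def by (simp add: lmon_upd_zero)

context laurent_ring
begin

lemma exch_factor: "exch I x b = lmon I x (\<lambda>i. max 0 (- b i)) * (1 + lmon I x b)"
proof -
  have "(\<lambda>i. max 0 (b i)) = (\<lambda>i. max 0 (- b i) + b i)" by auto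
  then have "lmon I x (\<lambda>i. max 0 (b i)) = lmon I x (\<lambda>i. max 0 (- b i)) * lmon I x b"
    by (simp only: lmon_plus)
  then show ?thesis unfolding exch_def by (simp add: algebra_simps)
qed

lemma exch_mem: "b \<in> iexps I \<Longrightarrow> b k = 0 \<Longrightarrow> exch I x b \<in> L {e. e k = 0}"
  unfolding exch_def by (intro lspan_plus L_mon) (auto simp: iexps_def)

text \<open>The exponent of the prefactor is the minimum of \<open>\<alpha> s\<close> and
  \<open>\<beta> s\<close>: the greatest common monomial is taken out.\<close>

lemma exch_shift:
  "lmon I x \<alpha> + lmon I x \<beta> = lmon I x (\<lambda>s. \<beta> s - max 0 (- (\<alpha> s - \<beta> s))) * exch I x (\<lambda>s. \<alpha> s - \<beta> s)"
proof -
  have "lmon I x \<alpha> = lmon I x (\<lambda>s. (\<beta> s - max 0 (- (\<alpha> s - \<beta> s))) + max 0 (\<alpha> s - \<beta> s))"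
    by (rule lmon_cong) auto
  moreover have "lmon I x \<beta> = lmon I x (\<lambda>s. (\<beta> s - max 0 (- (\<alpha> s - \<beta> s))) + max 0 (- (\<alpha> s - \<beta> s)))"
    by (rule lmon_cong) auto
  ultimately show ?thesis unfolding exch_def by (simp only: lmon_plus distrib_left)
qed

lemma powers_lowest:
  assumes "l \<in> L {e. e j = 0}" "h \<in> L {e. e j \<ge> 1}"
  shows "\<exists>h'\<in>L {e. e j \<ge> 1}. (l + h) ^ b = l ^ b + h'"
proof (induction b)
  case 0
  show ?case by (rule bexI[OF _ lspan.zero]) simp
next
  case (Suc b)
  then obtain h' where h': "h' \<in> L {e. e j \<ge> 1}" "(l + h) ^ b = l ^ b + h'" by blast
  have "(l + h) ^ Suc b = l ^ Suc b + (l * h' + h * l ^ b + h * h')"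
    unfolding power_Suc h'(2) by (simp add: algebra_simps)
  moreover have "l * h' \<in> L {e. e j \<ge> 1}" by (rule L_mult[OF assms(1) h'(1)]) auto
  moreover have "h * l ^ b \<in> L {e. e j \<ge> 1}"
    by (rule L_mult[OF assms(2) L_power[OF assms(1)]]) auto
  moreover have "h * h' \<in> L {e. e j \<ge> 1}" by (rule L_mult[OF assms(2) h'(1)]) auto
  ultimately show ?case using lspan_plus by metis
qed

end

lemma exch_nonzero:
  fixes x :: "nat \<Rightarrow> 'a::field_char_0"
  assumes "laurent_ring K I x" "b \<in> iexps I"
  shows "exch I x b \<noteq> 0"
proof
  interpret laurent_ring K I x by fact
  assume "exch I x b = 0"
  then have s: "1 + lmon I x b = 0" unfolding exch_factor using lmon_nz by simp
  show False
  \<comment> \<open>For \<open>b = 0\<close> the two monomials coincide and the sum is 2, nonzero in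
    characteristic zero.\<close>
  proof (cases "b = (\<lambda>_. 0)")
    case True
    then show False using s by simp
  next
    case False
    have "(1::'a) = 0"
    proof (rule L_component_eq)
      show "1 + lmon I x b = 0 + 0" using s by simp
      show "1 \<in> L {\<lambda>_. 0}" by (rule L_one) simp
      show "lmon I x b \<in> L {b}" using assms(2) by (intro L_mon) auto
      show "{\<lambda>_. 0} \<inter> {b} = {}" using False by auto
    qed (auto intro: lspan.zero)
    then show False by simp
  qed
qed

text \<open>
  Writing \<open>t = x j\<close>, the product \<open>a = x i * u j\<close> lies in the target ring and has lowest \<open>t\<close>-term
  \<open>l * v j\<close> with \<open>l\<close> coprime to the exchange polynomial \<open>Q\<close> of \<open>v\<close>; some \<open>f * a ^ N\<close> lies in the
  target ring as well, and \<open>a\<close> can be divided out.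
\<close>
lemma exchange_transfer:
  fixes x y u v :: "nat \<Rightarrow> 'a::field_char_0"
  assumes R: "laurent_ring K I x" and ij: "i \<in> I" "j \<in> I" "i \<noteq> j"
    and b: "bi \<in> iexps I" "bj \<in> iexps I" "bi i = 0" "bj j = 0"
    and sgn: "bj i \<ge> 0" "bi j \<le> 0" "bj i = 0 \<longleftrightarrow> bi j = 0"
    and ind: "bj i = 0 \<Longrightarrow> \<exists>s r. bi s * bj r \<noteq> bi r * bj s"
    and bj': "bj' = (\<lambda>s. if s = i then - bj i else bj s + max 0 (bi s) * bj i)"
    and y: "y = x(i := exch I x bi / x i)" and u: "u = x(j := exch I x bj / x j)"
    and v: "v = y(j := exch I y bj' / y j)"
    and f: "f \<in> lspan K I y UNIV" "f \<in> lspan K I u UNIV"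
  shows "f \<in> lspan K I v UNIV"
proof -
  interpret X: laurent_ring K I x by fact
  interpret Y: laurent_exchange K I x i "exch I x bi" y
    using ij b X.exch_mem exch_nonzero[OF R] y by unfold_locales auto
  have bj'I: "bj' \<in> iexps I" and bj'j: "bj' j = 0"
    using b ij sgn unfolding bj' iexps_def by auto
  define Q where "Q = exch I y bj'"
  interpret W: laurent_exchange K I y j Q v
    using ij bj'I bj'j Y.new.exch_mem exch_nonzero[OF Y.new.laurent_ring_axioms] v unfolding Q_def
    by unfold_locales auto
  define b where "b = nat (bj i)"
  have bj_i: "bj i = int b" using sgn b_def by simp
  define \<delta> where "\<delta> s = (if s = i then 1 else 0 :: int)" for s
  have yj: "y j = x j" using y ij by simp
  have xy: "lmon I x e = lmon I y e" if "e i = 0" for e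
    using that unfolding y by (simp add: lmon_upd_zero)
  have yi_inv: "lmon I y (\<lambda>s. - \<delta> s) = inverse (y i)"
    using lmon_single[OF X.fin ij(1), of y "- 1"] unfolding \<delta>_def by (simp add: if_distrib cong: if_cong)
  \<comment> \<open>\<open>x i\<close> is the exchange polynomial divided by \<open>y i\<close>,
    hence a sum of two monomials in \<open>y\<close>. Since \<open>bi j \<le> 0\<close>, the
    variable \<open>y j\<close> is absent from \<open>A\<close> and has exponent
    \<open>- bi j\<close> in \<open>B\<close>.\<close>
  define A where "A = lmon I y (\<lambda>s. max 0 (bi s) - \<delta> s)"
  define B where "B = lmon I y (\<lambda>s. max 0 (- bi s) - \<delta> s)"
  have exy: "exch I x bi = exch I y bi" unfolding exch_def using b xy by simp
  have xi_P: "x i = exch I y bi * lmon I y (\<lambda>s. - \<delta> s)"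
    using X.nzD[OF ij(1)] Y.Q(2) unfolding yi_inv exy[symmetric] Y.v_j by simp
  have xi: "x i = A + B"
    unfolding xi_P A_def B_def exch_def distrib_right Y.new.lmon_plus[symmetric] by simp
  have A0: "A \<in> W.L0" unfolding A_def
    using b ij sgn by (intro Y.new.L_mon) (auto simp: \<delta>_def iexps_def)
  have Bj: "B \<in> Y.new.L {e. e j = - bi j}" unfolding B_def
    using b ij sgn by (intro Y.new.L_mon) (auto simp: \<delta>_def iexps_def)
  \<comment> \<open>\<open>l0\<close> is the part of \<open>x i\<close> free of \<open>y j\<close>:
    all of it for \<open>b = 0\<close>, only \<open>A\<close> otherwise.\<close>
  obtain l0 h0 where lh: "x i = l0 + h0" "l0 \<in> W.L0" "h0 \<in> Y.new.L {e. e j \<ge> 1}"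
    "b = 0 \<Longrightarrow> l0 = x i" "b \<noteq> 0 \<Longrightarrow> l0 = A"
  proof (cases "b = 0")
    case True
    then have "B \<in> W.L0" using Bj sgn bj_i by simp
    then show ?thesis using that[of "x i" 0] True xi A0 lspan_plus lspan.zero by fastforce
  next
    case False
    then have "bi j < 0" using sgn bj_i by auto
    then have "B \<in> Y.new.L {e. e j \<ge> 1}" by (intro lspan_mono[OF Bj]) auto
    then show ?thesis using that[of A B] False xi A0 by blast
  qed
  obtain h1 where h1: "h1 \<in> Y.new.L {e. e j \<ge> 1}" "x i ^ b = l0 ^ b + h1"
    using Y.new.powers_lowest[OF lh(2,3)] lh(1) by metis
  have l0b: "l0 ^ b = lmon I y (\<lambda>s. int b * (max 0 (bi s) - \<delta> s))"
  proof (cases "b = 0")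
    case True
    then show ?thesis by simp
  next
    case False
    then show ?thesis using lh(5) unfolding A_def by (simp add: lmon_scale)
  qed
  define pj where "pj = (\<lambda>s. max 0 (bj s))(i := 0)"
  define nj where "nj = (\<lambda>s. max 0 (- bj s))"
  have pn: "pj \<in> iexps I" "nj \<in> iexps I" "pj j = 0" "nj j = 0" "nj i = 0" "pj i = 0"
    using b ij sgn unfolding pj_def nj_def iexps_def by auto
  define w where "w = lmon I y (\<lambda>s. nj s - max 0 (- bj' s))"
  have w0: "w \<in> W.L0" unfolding w_def
    using pn bj'I bj'j by (intro Y.new.L_mon) (auto simp: iexps_def)
  \<comment> \<open>Putting \<open>l0\<close> for \<open>x i\<close> in the numerator of
    \<open>u j\<close> reproduces the mutation rule: the exponents of the two monomials differ by
    \<open>bj'\<close>. Hence the lowest part of \<open>u j\<close> is the monomial \<open>w\<close>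
    times \<open>v j\<close>.\<close>
  have wQ: "l0 ^ b * lmon I y pj + lmon I y nj = w * Q"
  proof -
    let ?\<alpha> = "\<lambda>s. int b * (max 0 (bi s) - \<delta> s) + pj s"
    have "(\<lambda>s. ?\<alpha> s - nj s) = bj'"
      unfolding bj' pj_def nj_def \<delta>_def using bj_i b by (auto simp: fun_eq_iff max_def)
    then show ?thesis
      using Y.new.exch_shift[of ?\<alpha> nj] unfolding w_def Q_def l0b by (simp add: Y.new.lmon_plus fun_eq_iff)
  qed
  define a1 where "a1 = h1 * lmon I y pj * y j powi (- 1)"
  have uj: "u j = w * v j + a1"
  proof -
    have "lmon I x (\<lambda>s. max 0 (bj s)) = x i ^ b * lmon I y pj"
      using lmon_remove[OF X.fin ij(1), of x "\<lambda>s. max 0 (bj s)"] bj_i xy[of pj] pn(6)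
      unfolding pj_def by simp
    then have "exch I x bj = w * Q + h1 * lmon I y pj"
      unfolding exch_def wQ[symmetric] h1(2) using xy[of nj] pn(5) unfolding nj_def by (simp add: algebra_simps)
    then show ?thesis unfolding u a1_def W.v_j using yj by (simp add: divide_inverse distrib_right)
  qed
  have a1: "a1 \<in> Y.new.L {e. e j \<ge> 0}"
  proof -
    have "h1 * lmon I y pj \<in> Y.new.L {e. e j \<ge> 1}"
      using pn by (intro Y.new.L_mult[OF h1(1) Y.new.L_mon[of pj "{pj}"]]) auto
    then show ?thesis unfolding a1_def
      by (rule Y.new.L_mult[OF _ Y.new.L_var_powi[OF ij(2), of "- 1" "{e. e j = - 1}"]]) auto
  qed
  \<comment> \<open>\<open>x i\<close> and \<open>u j\<close> are the only variables of
    \<open>u\<close> not shared with \<open>v\<close>, so a power of their product clears all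
    denominators of \<open>f\<close> over \<open>u\<close> that the target ring may lack.\<close>
  define a where "a = x i * u j"
  define a' where "a' = h0 * w * v j + x i * a1"
  have xi0: "x i \<in> Y.new.L {e. e j \<ge> 0}"
    unfolding lh(1) by (intro lspan_plus lspan_mono[OF lh(2)] lspan_mono[OF lh(3)]) auto
  have a_eq: "a = (l0 * w) * v j + a'"
    unfolding a_def a'_def uj lh(1) by (simp add: algebra_simps)
  have "a' \<in> Y.new.L {e. e j \<ge> 0}" unfolding a'_def
  proof (rule lspan_plus)
    have "h0 * (w * Q) \<in> Y.new.L {e. e j \<ge> 1}"
      by (rule Y.new.L_mult[OF lh(3) W.L0_mult[OF w0 W.Q(1)]]) auto
    then have "h0 * (w * Q) * y j powi (- 1) \<in> Y.new.L {e. e j \<ge> 0}"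
      by (rule Y.new.L_mult[OF _ Y.new.L_var_powi[OF ij(2), of "- 1" "{e. e j = - 1}"]]) auto
    then show "h0 * w * v j \<in> Y.new.L {e. e j \<ge> 0}" unfolding W.v_j by (simp add: divide_inverse mult.assoc)
    show "x i * a1 \<in> Y.new.L {e. e j \<ge> 0}" by (rule Y.new.L_mult[OF xi0 a1]) auto
  qed
  note a = a_eq this
  have vj: "v j \<in> W.LV" using W.new.L_var_powi[OF ij(2), of 1 UNIV] by simp
  have xiV: "x i \<in> W.LV" using W.nonneg_new[OF xi0] .
  have ujV: "u j \<in> W.LV" unfolding uj
    using lspan_plus[OF W.new.L_mult_UNIV[OF W.L0_new[OF w0] vj] W.nonneg_new[OF a1]] .
  have aV: "a \<in> W.LV" unfolding a_def using xiV ujV W.new.L_mult_UNIV by blast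
  have inv0: "lmon I y (\<lambda>s. - e s) \<in> W.L0" if "e \<in> iexps I" "e j = 0" for e
    using that by (intro Y.new.L_mon) (auto simp: iexps_def)
  have cop: "\<forall>g\<in>W.L0. \<forall>r\<in>W.L0. g * (l0 * w) = Q * r \<longrightarrow> (\<exists>r'\<in>W.L0. g = Q * r')"
  proof (intro ballI impI)
    fix g r assume g: "g \<in> W.L0" and r: "r \<in> W.L0" and eq: "g * (l0 * w) = Q * r"
    show "\<exists>r'\<in>W.L0. g = Q * r'"
    proof (cases "b = 0")
      case False
      \<comment> \<open>For \<open>b \<noteq> 0\<close> the factor \<open>l0 * w\<close> is a single
        monomial with exponent \<open>e\<close>, invertible in \<open>W.L0\<close>.\<close>
      define e where "e s = max 0 (bi s) - \<delta> s + (nj s - max 0 (- bj' s))" for s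
      have "l0 * w = lmon I y e"
        unfolding lh(5)[OF False] A_def w_def e_def by (simp only: Y.new.lmon_plus)
      then have "g = g * (l0 * w) * lmon I y (\<lambda>s. - e s)"
        using Y.new.lmon_uminus[of e] by (simp add: mult.commute mult.left_commute)
      then have "g = Q * (r * lmon I y (\<lambda>s. - e s))" unfolding eq by (simp add: mult.assoc)
      moreover have "lmon I y (\<lambda>s. - e s) \<in> W.L0"
        using b ij sgn pn bj'I bj'j by (intro inv0) (auto simp: e_def \<delta>_def iexps_def)
      ultimately show ?thesis using r W.L0_mult by blast
    next
      case True
      then have bij: "bj i = 0" "bi j = 0" using bj_i sgn by auto
      have bj'_eq: "bj' = bj" unfolding bj' using bij by auto
      obtain s t where st: "bi s * bj t \<noteq> bi t * bj s" using ind bij by blast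
      \<comment> \<open>\<open>\<phi>\<close> is a 2 by 2 minor taken against \<open>bj\<close>: it
        vanishes at \<open>bj\<close>, and \<open>\<sigma>\<close> makes it positive at
        \<open>bi\<close>. So \<open>1 + lmon I y bi\<close> and \<open>1 + lmon I y bj\<close> are
        coprime.\<close>
      define \<sigma> where "\<sigma> = (if bj t * bi s - bj s * bi t > 0 then 1 else - 1 :: int)"
      define \<phi> where "\<phi> e = \<sigma> * (bj t * e s - bj s * e t)" for e :: "nat \<Rightarrow> int"
      have \<phi>: "\<phi> (\<lambda>i. e i + e' i) = \<phi> e + \<phi> e'" for e e' unfolding \<phi>_def by (simp add: algebra_simps)
      have \<phi>i: "\<phi> bi > 0" using st unfolding \<phi>_def \<sigma>_def by (auto simp: algebra_simps)
      have \<phi>j: "\<phi> bj = 0" unfolding \<phi>_def by (simp add: algebra_simps)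
      define e1 where "e1 s = - \<delta> s + (max 0 (- bi s) + (nj s - max 0 (- bj s)))" for s
      have e1: "e1 \<in> iexps I" "e1 j = 0"
        using b ij pn bij by (auto simp: e1_def \<delta>_def iexps_def)
      have lw: "l0 * w = lmon I y e1 * (1 + lmon I y bi)"
        unfolding lh(4)[OF True] xi_P Y.new.exch_factor w_def bj'_eq e1_def
        by (simp only: Y.new.lmon_plus mult.assoc mult.commute mult.left_commute)
      have Qf: "Q = lmon I y nj * (1 + lmon I y bj)"
        unfolding Q_def bj'_eq Y.new.exch_factor nj_def ..
      have m1: "lmon I y e1 \<in> W.L0" using e1 by (intro Y.new.L_mon) auto
      have m2: "lmon I y nj \<in> W.L0" using pn by (intro Y.new.L_mon) auto
      have "g * lmon I y e1 * (1 + lmon I y bi) = (1 + lmon I y bj) * (r * lmon I y nj)"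
        using eq unfolding lw Qf by (simp add: mult.assoc mult.commute mult.left_commute)
      then obtain r' where r': "r' \<in> W.L0" "g * lmon I y e1 = (1 + lmon I y bj) * r'"
        using Y.new.coprime_binomials[where V = "{e. e j = 0}" and \<phi> = \<phi> and \<beta> = bi and \<gamma> = bj
            and g = "g * lmon I y e1" and r = "r * lmon I y nj"]
          \<phi> \<phi>i \<phi>j b bij W.L0_mult[OF g m1] W.L0_mult[OF r m2] by auto
      have "g = (g * lmon I y e1) * lmon I y (\<lambda>s. - e1 s)"
        using Y.new.lmon_uminus[of e1] by (simp add: mult.assoc mult.commute)
      also have "\<dots> = (1 + lmon I y bj) * r' * lmon I y (\<lambda>s. - e1 s)" unfolding r'(2) ..
      also have "\<dots> = Q * (r' * lmon I y (\<lambda>s. - e1 s) * lmon I y (\<lambda>s. - nj s))"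
        using Y.new.lmon_uminus[of nj] unfolding Qf by (simp add: mult.commute mult.left_commute)
      finally show ?thesis
        using W.L0_mult r'(1) inv0[OF e1] inv0[OF pn(2,4)] by blast
    qed
  qed
  \<comment> \<open>A threshold rather than a single \<open>N\<close>, so that terms needing
    different powers of \<open>a\<close> can be added.\<close>
  have "\<exists>N0. \<forall>N\<ge>N0. f * a ^ N \<in> W.LV" using f(2)
  proof (induction rule: lspan.induct)
    case zero
    show ?case by (simp add: lspan.zero)
  next
    case (add c e f)
    then obtain N0 where N0: "\<And>N. N \<ge> N0 \<Longrightarrow> f * a ^ N \<in> W.LV" by blast
    let ?e = "e(i := 0, j := 0)"
    have "(c * lmon I u e + f) * a ^ N \<in> W.LV" if "N \<ge> N0 + nat (- e i) + nat (- e j)" for N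
    proof -
      have uu: "u i = x i" using u ij by simp
      have nzu: "u i \<noteq> 0" "u j \<noteq> 0" using u ij X.nzD exch_nonzero[OF R b(2)] by auto
      have "lmon I u e = u i powi e i * (u j powi e j * lmon I u ?e)"
        using lmon_remove[OF X.fin ij(1), of u e] lmon_remove[OF X.fin ij(2), of u "e(i := 0)"] ij by simp
      also have "lmon I u ?e = lmon I v ?e"
        unfolding u v y using ij by (simp add: lmon_upd_zero)
      finally have "c * lmon I u e * a ^ N = (c * lmon I v ?e) * ((u i powi e i * u i ^ N) * (u j powi e j * u j ^ N))"
        unfolding a_def uu[symmetric] by (simp add: power_mult_distrib mult_ac)
      also have "u i powi e i * u i ^ N = u i ^ nat (e i + int N)"
        using that nzu power_int_add[of "u i" "e i" "int N"] by (auto simp: power_int_def split: if_splits)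
      also have "u j powi e j * u j ^ N = u j ^ nat (e j + int N)"
        using that nzu power_int_add[of "u j" "e j" "int N"] by (auto simp: power_int_def split: if_splits)
      finally have "c * lmon I u e * a ^ N = (c * lmon I v ?e) * (u i ^ nat (e i + int N) * u j ^ nat (e j + int N))" .
      moreover have "c * lmon I v ?e \<in> W.LV" using add.hyps ij by (intro lspan_term iexps_upd) auto
      moreover have "u i ^ nat (e i + int N) \<in> W.LV" unfolding uu by (rule W.new.L_power[OF xiV]) auto
      moreover have "u j ^ nat (e j + int N) \<in> W.LV" by (rule W.new.L_power[OF ujV]) auto
      ultimately have "c * lmon I u e * a ^ N \<in> W.LV" by (simp only: W.new.L_mult_UNIV)
      then show ?thesis unfolding distrib_right using N0[of N] that by (simp add: lspan_plus)
    qed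
    then show ?case by blast
  qed
  then obtain N where "f * a ^ N \<in> W.LV" by blast
  then show ?thesis
    using W.descend_power[OF W.L0_mult[OF lh(2) w0] cop a aV f(1)] by blast
qed

section \<open>Seeds and the Laurent phenomenon for independent columns\<close>

definition colv :: "nat \<Rightarrow> (nat \<Rightarrow> nat \<Rightarrow> int) \<Rightarrow> nat \<Rightarrow> nat \<Rightarrow> int" where
  "colv m B k = (\<lambda>s. if s \<in> {1..m} then B s k else 0)"

text \<open>Algebraic independence is put in Laurent form; connectedness is kept apart and enters
  only through nonzero columns.\<close>

definition lseed :: "'a::field set \<Rightarrow> nat \<Rightarrow> nat \<Rightarrow> (nat \<Rightarrow> 'a) \<Rightarrow> (nat \<Rightarrow> nat \<Rightarrow> int) \<Rightarrow> bool" where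
  "lseed K m n x B \<longleftrightarrow> n \<le> m \<and> laurent_ring K {1..m} x \<and> skew_symmetrizable n B"

definition indep_cols :: "nat \<Rightarrow> nat \<Rightarrow> (nat \<Rightarrow> nat \<Rightarrow> int) \<Rightarrow> bool" where
  "indep_cols m n B \<longleftrightarrow> (\<forall>w::nat \<Rightarrow> int. (\<forall>s\<in>{1..m}. (\<Sum>k\<in>{1..n}. B s k * w k) = 0) \<longrightarrow> (\<forall>k\<in>{1..n}. w k = 0))"

lemma colv_iexps: "colv m B k \<in> iexps {1..m}"
  unfolding colv_def iexps_def by simp

lemma mut_vars_exch: "mut_vars m k x B = x(k := exch {1..m} x (colv m B k) / x k)"
proof -
  have "(\<Prod>i\<in>{i\<in>{1..m}. B i k > 0}. x i ^ nat (B i k)) = lmon {1..m} x (\<lambda>i. max 0 (colv m B k i))"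
    unfolding lmon_def colv_def by (rule prod.mono_neutral_cong_left)
      (auto simp: power_int_def max_def order.order_iff_strict[of "0::int"] order.order_iff_strict[of _ "0::int"])
  moreover have "(\<Prod>i\<in>{i\<in>{1..m}. B i k < 0}. x i ^ nat (- B i k)) = lmon {1..m} x (\<lambda>i. max 0 (- colv m B k i))"
    unfolding lmon_def colv_def by (rule prod.mono_neutral_cong_left)
      (auto simp: power_int_def max_def order.order_iff_strict[of "0::int"] order.order_iff_strict[of _ "0::int"])
  ultimately show ?thesis
    unfolding mut_vars_def exch_def by (simp add: divide_inverse mult.commute)
qed

text \<open>The numerator is even, so the integer division is exact.\<close>

lemma mut_mat_term: "(\<bar>a\<bar> * b + a * \<bar>b\<bar>) div 2 = max 0 a * b + a * max 0 (- b)" for a b :: int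
proof -
  have "\<bar>a\<bar> * b + a * \<bar>b\<bar> = 2 * (max 0 a * b + a * max 0 (- b))"
    by (cases "a \<ge> 0"; cases "b \<ge> 0") (auto simp: max_def abs_if algebra_simps)
  then show ?thesis by simp
qed

lemma mut_mat_alt:
  "mut_mat k B i j = (if i = k \<or> j = k then - B i j else B i j + (max 0 (B i k) * B k j + B i k * max 0 (- B k j)))"
  unfolding mut_mat_def mut_mat_term ..

lemma mut_mat_involutive: "mut_mat k (mut_mat k B) = B"
  by (intro ext) (auto simp: mut_mat_alt max_def)

section \<open>Exchange matrices: signs, symmetrizers and independence of columns\<close>

lemma skew_sign:
  assumes "skew_symmetrizable n B" "i \<in> {1..n}" "j \<in> {1..n}"
  shows "B i i = 0" "B i j > 0 \<longleftrightarrow> B j i < 0" "B i j = 0 \<longleftrightarrow> B j i = 0"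
proof -
  obtain d where d: "\<forall>i\<in>{1..n}. d i > 0" "\<forall>i\<in>{1..n}. \<forall>j\<in>{1..n}. d i * B i j = - (d j * B j i)"
    using assms(1) unfolding skew_symmetrizable_def by blast
  have di: "d i > 0" and dj: "d j > 0" using d(1) assms(2,3) by auto
  have "d i * B i i = - (d i * B i i)" using d(2) assms by blast
  then show "B i i = 0" using di by simp
  have e: "d i * B i j = - (d j * B j i)" using d(2) assms by blast
  have "d i * B i j > 0 \<longleftrightarrow> B i j > 0" "d j * B j i < 0 \<longleftrightarrow> B j i < 0"
    using di dj by (auto simp: zero_less_mult_iff mult_less_0_iff)
  then show "B i j > 0 \<longleftrightarrow> B j i < 0" using e by linarith
  have "d i * B i j = 0 \<longleftrightarrow> B i j = 0" "d j * B j i = 0 \<longleftrightarrow> B j i = 0" using di dj by auto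
  then show "B i j = 0 \<longleftrightarrow> B j i = 0" using e by linarith
qed

text \<open>The same symmetrizer \<open>d\<close> serves. Rescaling by it turns positive parts in
  column \<open>k\<close> into negative parts in row \<open>k\<close>, which makes the correction
  terms antisymmetric.\<close>

lemma skew_mut:
  assumes "skew_symmetrizable n B" and k: "k \<in> {1..n}"
  shows "skew_symmetrizable n (mut_mat k B)"
proof -
  obtain d where d: "\<forall>i\<in>{1..n}. d i > 0" "\<forall>i\<in>{1..n}. \<forall>j\<in>{1..n}. d i * B i j = - (d j * B j i)"
    using assms(1) unfolding skew_symmetrizable_def by blast
  have "d i * mut_mat k B i j = - (d j * mut_mat k B j i)" if ij: "i \<in> {1..n}" "j \<in> {1..n}" for i j
  proof (cases "i = k \<or> j = k")
    case True
    then have "mut_mat k B i j = - B i j" "mut_mat k B j i = - B j i" by (auto simp: mut_mat_alt)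
    moreover have "d i * B i j = - (d j * B j i)" using d(2) ij by blast
    ultimately show ?thesis by simp
  next
    case False
    have ik: "d i * B i k = - (d k * B k i)" and jk: "d j * B j k = - (d k * B k j)"
      and ij': "d i * B i j = - (d j * B j i)"
      using d(2) ij k by blast+
    have p: "d i * max 0 (B i k) = d k * max 0 (- B k i)" "d j * max 0 (B j k) = d k * max 0 (- B k j)"
    proof -
      have m: "a * max 0 b = max 0 (a * b)" if "a > 0" for a b :: int
        using that by (auto simp: max_def zero_le_mult_iff mult_le_0_iff)
      have pos: "d i > 0" "d j > 0" "d k > 0" using d(1) ij k by auto
      show "d i * max 0 (B i k) = d k * max 0 (- B k i)" "d j * max 0 (B j k) = d k * max 0 (- B k j)"
        unfolding m[OF pos(1)] m[OF pos(2)] m[OF pos(3)] using ik jk by simp_all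
    qed
    have "d i * mut_mat k B i j = d i * B i j + (d i * max 0 (B i k)) * B k j + (d i * B i k) * max 0 (- B k j)"
      using False by (simp add: mut_mat_alt algebra_simps)
    also have "\<dots> = - (d j * B j i) + d k * max 0 (- B k i) * B k j - d k * B k i * max 0 (- B k j)"
      unfolding ij' p ik by simp
    also have "\<dots> = - (d j * B j i + (d j * max 0 (B j k)) * B k i + (d j * B j k) * max 0 (- B k i))"
      unfolding p jk by (simp add: algebra_simps)
    also have "\<dots> = - (d j * mut_mat k B j i)"
      using False by (simp add: mut_mat_alt algebra_simps)
    finally show ?thesis .
  qed
  then show ?thesis using d(1) unfolding skew_symmetrizable_def by blast
qed

text \<open>A kernel vector \<open>w\<close> of the mutated matrix becomes a kernel vector of
  \<open>B\<close> when its coordinate \<open>k\<close> is replaced by \<open>c\<close>, the total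
  coefficient that column \<open>k\<close> of \<open>B\<close> receives in the mutated relation. Row
  \<open>k\<close> of that relation kills the terms with \<open>max 0 (B s k)\<close>, because
  \<open>B k k = 0\<close>.\<close>

lemma indep_cols_mut:
  assumes skew: "skew_symmetrizable n B" and k: "k \<in> {1..n}" and nm: "n \<le> m" and ind: "indep_cols m n B"
  shows "indep_cols m n (mut_mat k B)"
  unfolding indep_cols_def
proof (intro allI impI)
  fix w :: "nat \<Rightarrow> int"
  assume z: "\<forall>s\<in>{1..m}. (\<Sum>j\<in>{1..n}. mut_mat k B s j * w j) = 0"
  let ?J = "{1..n} - {k}"
  define c where "c = (\<Sum>j\<in>?J. max 0 (- B k j) * w j) - w k"
  define w' where "w' = w(k := c)"
  have Bkk: "B k k = 0" using skew_sign(1)[OF skew k k] .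
  have split: "(\<Sum>j\<in>{1..n}. g j) = g k + (\<Sum>j\<in>?J. g j)" for g :: "nat \<Rightarrow> int"
    using k by (simp add: sum.remove)
  have row_k: "(\<Sum>j\<in>?J. B k j * w j) = 0"
  proof -
    have "(\<Sum>j\<in>{1..n}. mut_mat k B k j * w j) = 0" using z k nm by auto
    then show ?thesis unfolding split by (simp add: mut_mat_alt Bkk sum_negf)
  qed
  have "(\<Sum>j\<in>{1..n}. B s j * w' j) = 0" if s: "s \<in> {1..m}" for s
  proof (cases "s = k")
    case True
    have "(\<Sum>j\<in>?J. B k j * w' j) = (\<Sum>j\<in>?J. B k j * w j)" by (intro sum.cong) (auto simp: w'_def)
    then show ?thesis unfolding split using True row_k Bkk by simp
  next
    case False
    have "0 = (\<Sum>j\<in>{1..n}. mut_mat k B s j * w j)" using z s by simp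
    also have "\<dots> = - B s k * w k + (\<Sum>j\<in>?J. mut_mat k B s j * w j)"
      unfolding split by (simp add: mut_mat_alt)
    also have "(\<Sum>j\<in>?J. mut_mat k B s j * w j)
        = (\<Sum>j\<in>?J. B s j * w j + max 0 (B s k) * (B k j * w j) + B s k * (max 0 (- B k j) * w j))"
      using False by (intro sum.cong) (auto simp: mut_mat_alt algebra_simps)
    also have "\<dots> = (\<Sum>j\<in>?J. B s j * w j) + max 0 (B s k) * (\<Sum>j\<in>?J. B k j * w j)
        + B s k * (\<Sum>j\<in>?J. max 0 (- B k j) * w j)"
      by (simp add: sum.distrib sum_distrib_left)
    finally have "(\<Sum>j\<in>?J. B s j * w j) + B s k * c = 0"
      unfolding row_k c_def by (simp add: algebra_simps)
    moreover have "(\<Sum>j\<in>?J. B s j * w' j) = (\<Sum>j\<in>?J. B s j * w j)" by (intro sum.cong) (auto simp: w'_def)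
    ultimately show ?thesis unfolding split by (simp add: w'_def)
  qed
  then have w0: "\<forall>j\<in>{1..n}. w' j = 0" using ind unfolding indep_cols_def by blast
  then have wj: "w j = 0" if "j \<in> ?J" for j
    using bspec[OF w0, of j] that unfolding w'_def by (auto split: if_splits)
  moreover have "c = 0" using bspec[OF w0 k] unfolding w'_def by simp
  then have "w k = 0" unfolding c_def using wj by simp
  ultimately show "\<forall>k\<in>{1..n}. w k = 0" by blast
qed

text \<open>If all 2 by 2 minors of columns \<open>i\<close> and \<open>j\<close> vanished, then
  \<open>B s i\<close> times column \<open>j\<close> minus \<open>B s j\<close> times column
  \<open>i\<close> would be zero, where row \<open>s\<close> is chosen with \<open>B s i\<close>
  nonzero.\<close>

lemma indep_cols_pair:
  assumes ind: "indep_cols m n B" and ij: "i \<in> {1..n}" "j \<in> {1..n}" "i \<noteq> j"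
  shows "\<exists>s r. colv m B i s * colv m B j r \<noteq> colv m B i r * colv m B j s"
proof (rule ccontr)
  assume neg: "\<not> ?thesis"
  have "\<exists>s\<in>{1..m}. B s i \<noteq> 0"
  proof (rule ccontr)
    assume "\<not> ?thesis"
    then have "\<forall>s\<in>{1..m}. (\<Sum>k\<in>{1..n}. B s k * (if k = i then 1 else 0)) = 0"
      using ij by (simp add: if_distrib cong: if_cong)
    then show False using ind ij unfolding indep_cols_def by fastforce
  qed
  then obtain s where s: "s \<in> {1..m}" "B s i \<noteq> 0" by blast
  define w where "w k = (if k = j then B s i else 0) + (if k = i then - B s j else 0)" for k
  have "(\<Sum>k\<in>{1..n}. B r k * w k) = 0" if "r \<in> {1..m}" for r
  proof -
    have "(\<Sum>k\<in>{1..n}. B r k * w k)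
        = (\<Sum>k\<in>{1..n}. (if k = j then B r j * B s i else 0) + (if k = i then - (B r i * B s j) else 0))"
      using ij by (intro sum.cong) (auto simp: w_def)
    also have "\<dots> = B r j * B s i - B r i * B s j"
      using ij by (simp add: sum.distrib)
    also have "\<dots> = colv m B i s * colv m B j r - colv m B i r * colv m B j s"
      using s that by (simp add: colv_def)
    finally show ?thesis using neg by simp
  qed
  then have "w j = 0" using ind ij unfolding indep_cols_def by blast
  then show False using s ij unfolding w_def by simp
qed

section \<open>Mutation of seeds\<close>

lemma lseed_exchange:
  fixes x :: "nat \<Rightarrow> 'a::field_char_0"
  assumes "lseed K m n x B" "k \<in> {1..n}"
  shows "laurent_exchange K {1..m} x k (exch {1..m} x (colv m B k)) (mut_vars m k x B)"
proof -
  interpret laurent_ring K "{1..m}" x using assms unfolding lseed_def by blast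
  have "colv m B k k = 0" using assms skew_sign(1)[of n B k k] unfolding lseed_def colv_def by auto
  then show ?thesis
    using assms exch_mem[OF colv_iexps] exch_nonzero[OF laurent_ring_axioms colv_iexps]
    by unfold_locales (auto simp: lseed_def mut_vars_exch)
qed

lemma lseed_mut:
  fixes x :: "nat \<Rightarrow> 'a::field_char_0"
  assumes "lseed K m n x B" "k \<in> {1..n}"
  shows "lseed K m n (mut_vars m k x B) (mut_mat k B)"
proof -
  interpret laurent_exchange K "{1..m}" x k "exch {1..m} x (colv m B k)" "mut_vars m k x B"
    using lseed_exchange[OF assms] .
  show ?thesis using assms skew_mut new.laurent_ring_axioms unfolding lseed_def by blast
qed

lemma mut_vars_involutive:
  fixes x :: "nat \<Rightarrow> 'a::field_char_0"
  assumes "lseed K m n x B" "k \<in> {1..n}"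
  shows "mut_vars m k (mut_vars m k x B) (mut_mat k B) = x"
proof -
  interpret laurent_exchange K "{1..m}" x k "exch {1..m} x (colv m B k)" "mut_vars m k x B"
    using lseed_exchange[OF assms] .
  have "colv m (mut_mat k B) k = (\<lambda>i. - colv m B k i)" by (auto simp: colv_def mut_mat_alt)
  moreover have "colv m B k k = 0" using assms skew_sign(1)[of n B k k] unfolding lseed_def colv_def by auto
  ultimately have "exch {1..m} (mut_vars m k x B) (colv m (mut_mat k B) k) = exch {1..m} x (colv m B k)"
    unfolding mut_vars_exch by (simp add: exch_uminus exch_upd)
  then show ?thesis
    unfolding mut_vars_exch[of m k "mut_vars m k x B"] unfolding mut_vars_exch
    using Q(2) nzD[OF j] by (auto simp: fun_eq_iff)
qed

lemma mut_step_sym: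
  fixes x :: "nat \<Rightarrow> 'a::field_char_0"
  assumes "lseed K m n x B" "mut_step m n (x, B) (y, C)"
  shows "lseed K m n y C" "mut_step m n (y, C) (x, B)"
proof -
  obtain k where k: "k \<in> {1..n}" "y = mut_vars m k x B" "C = mut_mat k B"
    using assms(2) unfolding mut_step_def by auto
  show "lseed K m n y C" using lseed_mut[OF assms(1) k(1)] k by simp
  show "mut_step m n (y, C) (x, B)"
    unfolding mut_step_def k(2,3) using mut_vars_involutive[OF assms(1) k(1)]
    by (intro bexI[OF _ k(1)]) (simp add: mut_mat_involutive)
qed

text \<open>Induction along a mutation sequence that carries the seed property, so each step takes
  place in a Laurent ring.\<close>

lemma mut_equiv_induct [consumes 2, case_names refl step]:
  fixes x :: "nat \<Rightarrow> 'a::field_char_0"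
  assumes "mut_equiv m n (x, B) (z, D)" "lseed K m n x B" "P x B"
    and "\<And>y C k. \<lbrakk>mut_equiv m n (x, B) (y, C); lseed K m n y C; k \<in> {1..n}; P y C\<rbrakk>
       \<Longrightarrow> P (mut_vars m k y C) (mut_mat k C)"
  shows "P z D" "lseed K m n z D"
proof -
  have "P z D \<and> lseed K m n z D"
    using assms(1) unfolding mut_equiv_def
  proof (induction rule: rtranclp_induct2)
    case refl
    then show ?case using assms by blast
  next
    case (step y C z D)
    then obtain k where k: "k \<in> {1..n}" "z = mut_vars m k y C" "D = mut_mat k C"
      unfolding mut_step_def by auto
    have y: "lseed K m n y C" "P y C" using step by auto
    have "mut_equiv m n (x, B) (y, C)" using step unfolding mut_equiv_def by auto
    from assms(4)[OF this y(1) k(1) y(2)] lseed_mut[OF y(1) k(1)] show ?case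
      unfolding k(2,3) by auto
  qed
  then show "P z D" "lseed K m n z D" by blast+
qed

lemma mut_equiv_lseed:
  fixes x :: "nat \<Rightarrow> 'a::field_char_0"
  shows "mut_equiv m n (x, B) (z, D) \<Longrightarrow> lseed K m n x B \<Longrightarrow> lseed K m n z D"
  by (rule mut_equiv_induct(2)[where P = "\<lambda>_ _. True"]) auto

lemma mut_equiv_sym:
  fixes x :: "nat \<Rightarrow> 'a::field_char_0"
  assumes "mut_equiv m n (x, B) (z, D)" "lseed K m n x B"
  shows "mut_equiv m n (z, D) (x, B)"
  using assms
proof (induction rule: mut_equiv_induct(1))
  case refl
  show ?case by (simp add: mut_equiv_def)
next
  case (step y C k)
  have "mut_step m n (y, C) (mut_vars m k y C, mut_mat k C)"
    unfolding mut_step_def using step by auto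
  then show ?case
    using mut_step_sym(2)[OF step(2)] step(4) unfolding mut_equiv_def by (meson converse_rtranclp_into_rtranclp)
qed

lemma mut_equiv_trans: "mut_equiv m n s t \<Longrightarrow> mut_equiv m n t r \<Longrightarrow> mut_equiv m n s r"
  unfolding mut_equiv_def by simp

definition upper_bound :: "'a::field set \<Rightarrow> nat \<Rightarrow> nat \<Rightarrow> (nat \<Rightarrow> 'a) \<Rightarrow> (nat \<Rightarrow> nat \<Rightarrow> int) \<Rightarrow> 'a set" where
  "upper_bound K m n x B = {f \<in> lspan K {1..m} x UNIV. \<forall>k\<in>{1..n}. f \<in> lspan K {1..m} (mut_vars m k x B) UNIV}"

text \<open>Mutating again at \<open>k\<close> returns to the original seed. For another direction
  \<open>j\<close>, \<open>exchange_transfer\<close> applies to columns \<open>k\<close> and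
  \<open>j\<close>.\<close>

lemma upper_bound_mut:
  fixes x :: "nat \<Rightarrow> 'a::field_char_0"
  assumes x: "lseed K m n x B" and ind: "indep_cols m n B" and k: "k \<in> {1..n}"
    and f: "f \<in> upper_bound K m n x B"
  shows "f \<in> upper_bound K m n (mut_vars m k x B) (mut_mat k B)"
proof -
  have skew: "skew_symmetrizable n B" and nm: "n \<le> m" and R: "laurent_ring K {1..m} x"
    using x unfolding lseed_def by auto
  have "f \<in> lspan K {1..m} (mut_vars m j (mut_vars m k x B) (mut_mat k B)) UNIV" if j: "j \<in> {1..n}" for j
  proof (cases "j = k")
    case True
    then show ?thesis using f mut_vars_involutive[OF x k] unfolding upper_bound_def by simp
  next
    case False
    \<comment> \<open>Mutation of the variables is insensitive to the sign of the matrix, so we may assume \<open>0 \<le> B k j\<close>.\<close>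
    define \<sigma> where "\<sigma> = (if B k j \<ge> 0 then 1 else - 1 :: int)"
    define b where "b i s = \<sigma> * colv m B i s" for i s
    define bj' where "bj' = (\<lambda>s. if s = k then - b j k else b j s + max 0 (b k s) * b j k)"
    have ex: "exch {1..m} y (b i) = exch {1..m} y (colv m B i)" for y :: "nat \<Rightarrow> 'a" and i
      unfolding b_def \<sigma>_def using exch_uminus[of "{1..m}" y "colv m B i"] by simp
    have bj'_eq: "bj' = (\<lambda>s. \<sigma> * colv m (mut_mat k B) j s)"
    proof
      fix s
      have mx: "max 0 (- a) = max 0 a - a" for a :: int by auto
      have kj: "k \<in> {1..m}" "j \<in> {1..m}" "k \<noteq> j" using j k nm False by auto
      have ck: "colv m C r k = C k r" for C r using kj unfolding colv_def by simp
      consider "s = k" | "s \<notin> {1..m}" "s \<noteq> k" | "s \<in> {1..m}" "s \<noteq> k" using kj by blast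
      then show "bj' s = \<sigma> * colv m (mut_mat k B) j s"
      proof cases
        case 1
        then show ?thesis unfolding bj'_def b_def by (simp add: ck mut_mat_def)
      next
        case 2
        then have "colv m C r s = 0" for C r by (auto simp: colv_def)
        then show ?thesis unfolding bj'_def b_def using 2 by simp
      next
        case 3
        then have cs: "colv m C r s = C s r" for C r by (auto simp: colv_def)
        show ?thesis
        proof (cases "B k j \<ge> 0")
          case True
          then show ?thesis unfolding bj'_def b_def cs ck \<sigma>_def using kj 3 by (simp add: mut_mat_alt)
        next
          case False
          then have "max 0 (- B k j) = - B k j" by simp
          then show ?thesis unfolding bj'_def b_def cs ck \<sigma>_def
            using kj 3 False by (simp add: mut_mat_alt mx[of "B s k"] algebra_simps)
        qed
      qed
    qed
    have ex': "exch {1..m} y bj' = exch {1..m} y (colv m (mut_mat k B) j)" for y :: "nat \<Rightarrow> 'a"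
      unfolding bj'_eq \<sigma>_def using exch_uminus[of "{1..m}" y "colv m (mut_mat k B) j"] by simp
    show ?thesis
    proof (rule exchange_transfer[OF R _ _ _ _ _ _ _ _ _ _ _ bj'_def])
      show "k \<in> {1..m}" "j \<in> {1..m}" "k \<noteq> j" using j k nm False by auto
      show "b k \<in> iexps {1..m}" "b j \<in> iexps {1..m}" unfolding b_def iexps_def colv_def by auto
      show "b k k = 0" "b j j = 0"
        using skew_sign(1)[OF skew] j k unfolding b_def colv_def by auto
      show "b j k \<ge> 0" "b k j \<le> 0" "b j k = 0 \<longleftrightarrow> b k j = 0"
        using skew_sign[OF skew k j] skew_sign[OF skew j k] j k nm unfolding b_def \<sigma>_def colv_def by auto
      show "\<exists>s r. b k s * b j r \<noteq> b k r * b j s"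
        using indep_cols_pair[OF ind k j] False unfolding b_def \<sigma>_def by auto
      show "mut_vars m k x B = x(k := exch {1..m} x (b k) / x k)" unfolding ex by (rule mut_vars_exch)
      show "mut_vars m j x B = x(j := exch {1..m} x (b j) / x j)" unfolding ex by (rule mut_vars_exch)
      show "mut_vars m j (mut_vars m k x B) (mut_mat k B) = (mut_vars m k x B)
          (j := exch {1..m} (mut_vars m k x B) bj' / mut_vars m k x B j)"
        unfolding ex' by (rule mut_vars_exch)
      show "f \<in> lspan K {1..m} (mut_vars m k x B) UNIV" "f \<in> lspan K {1..m} (mut_vars m j x B) UNIV"
        using f j k unfolding upper_bound_def by auto
    qed
  qed
  then show ?thesis using f k unfolding upper_bound_def by blast
qed

lemma cluster_in_upper_bound:
  fixes z :: "nat \<Rightarrow> 'a::field_char_0"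
  assumes z: "lseed K m n z D" and s: "s \<in> {1..m}"
  shows "z s \<in> upper_bound K m n z D"
proof -
  interpret laurent_ring K "{1..m}" z using z unfolding lseed_def by blast
  have "z s \<in> lspan K {1..m} (mut_vars m k z D) UNIV" if k: "k \<in> {1..n}" for k
  proof -
    interpret Z: laurent_exchange K "{1..m}" z k "exch {1..m} z (colv m D k)" "mut_vars m k z D"
      using lseed_exchange[OF z k] .
    show ?thesis
    proof (cases "s = k")
      case True
      then show ?thesis using Z.old_var_new by simp
    next
      case False
      then have "mut_vars m k z D s = z s" unfolding mut_vars_def by simp
      then show ?thesis using Z.new.L_var_powi[OF s, of 1 UNIV] by simp
    qed
  qed
  then show ?thesis using L_var_powi[OF s, of 1 UNIV] unfolding upper_bound_def by simp
qed

text \<open>A cluster lies in the upper bound of its own seed, and invariance of the upper bound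
  carries it back along the mutation sequence to the initial seed.\<close>

theorem laurent_phenomenon_indep:
  fixes x :: "nat \<Rightarrow> 'a::field_char_0"
  assumes "mut_equiv m n (x, B) (z, D)" and x: "lseed K m n x B" and ind: "indep_cols m n B"
    and s: "s \<in> {1..m}"
  shows "z s \<in> lspan K {1..m} x UNIV"
proof -
  have "indep_cols m n D \<and> upper_bound K m n z D \<subseteq> upper_bound K m n x B"
    using assms(1) x
  proof (induction rule: mut_equiv_induct(1))
    case refl
    show ?case using ind by simp
  next
    case (step y C k)
    have y': "lseed K m n (mut_vars m k y C) (mut_mat k C)" using lseed_mut step by blast
    have ind': "indep_cols m n (mut_mat k C)"
      using step indep_cols_mut[of n C k m] unfolding lseed_def by blast
    have "upper_bound K m n (mut_vars m k y C) (mut_mat k C) \<subseteq> upper_bound K m n y C"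
      using upper_bound_mut[OF y' ind' \<open>k \<in> {1..n}\<close>] mut_vars_involutive[OF step(2,3)]
      by (auto simp: mut_mat_involutive)
    then show ?case using ind' step by blast
  qed
  moreover have "z s \<in> upper_bound K m n z D"
    using cluster_in_upper_bound[OF mut_equiv_lseed[OF assms(1) x] s] .
  ultimately show ?thesis unfolding upper_bound_def by blast
qed

section \<open>Algebraically independent reals\<close>

lemma countable_lspan:
  assumes "countable K"
  shows "countable (lspan K {1..N} x W)"
proof -
  have "iexps {1..N} \<subseteq> range (\<lambda>l i. if i \<in> {1..N} then l ! i else 0)"
  proof
    fix e assume e: "e \<in> iexps {1..N}"
    have "e = (\<lambda>i. if i \<in> {1..N} then map e [0..<Suc N] ! i else 0)"
    proof
      fix i
      show "e i = (if i \<in> {1..N} then map e [0..<Suc N] ! i else 0)"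
        using e by (auto simp: iexps_def nth_map_upt simp del: upt_Suc)
    qed
    then show "e \<in> range (\<lambda>l i. if i \<in> {1..N} then l ! i else 0)" by blast
  qed
  then have "countable (iexps {1..N})" by (rule countable_subset) simp
  then have "countable ((\<lambda>(c, e). c * lmon {1..N} x e) ` (K \<times> iexps {1..N}))"
    using assms by (intro countable_image countable_SIGMA) auto
  then have c: "countable (sum_list ` lists ((\<lambda>(c, e). c * lmon {1..N} x e) ` (K \<times> iexps {1..N})))"
    (is "countable ?S") by (blast intro: countable_image countable_lists)
  have "f \<in> ?S" if "f \<in> lspan K {1..N} x W" for f
    using that
  proof (induction rule: lspan.induct)
    case zero
    show ?case by (rule image_eqI[of _ _ "[]"]) auto
  next
    case (add a e f)
    then obtain l where l: "l \<in> lists ((\<lambda>(c, e). c * lmon {1..N} x e) ` (K \<times> iexps {1..N}))" "f = sum_list l"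
      by blast
    show ?case using add.hyps l by (intro image_eqI[of _ _ "a * lmon {1..N} x e # l"]) auto
  qed
  then show ?thesis using c by (meson countable_subset subsetI)
qed

lemma countable_roots:
  fixes S :: "'b::{idom} set"
  assumes "countable S"
  shows "countable {r. \<exists>p. p \<noteq> 0 \<and> set (coeffs p) \<subseteq> S \<and> poly p r = 0}"
proof -
  have "{r. \<exists>p. p \<noteq> 0 \<and> set (coeffs p) \<subseteq> S \<and> poly p r = 0}
      \<subseteq> (\<Union>p\<in>Poly ` lists S - {0}. {r. poly p r = 0})"
  proof
    fix r assume "r \<in> {r. \<exists>p. p \<noteq> 0 \<and> set (coeffs p) \<subseteq> S \<and> poly p r = 0}"
    then obtain p where p: "p \<noteq> 0" "set (coeffs p) \<subseteq> S" "poly p r = 0" by blast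
    have "p = Poly (coeffs p)" by simp
    then have "p \<in> Poly ` lists S" using p(2) by blast
    then show "r \<in> (\<Union>p\<in>Poly ` lists S - {0}. {r. poly p r = 0})" using p by blast
  qed
  moreover have "countable (Poly ` lists S - {0})" using assms by (intro countable_Diff countable_image countable_lists)
  ultimately show ?thesis
    by (elim countable_subset) (auto intro!: countable_UN intro: countable_finite poly_roots_finite)
qed

lemma unital_subring_Ints: "unital_subring (\<int> :: 'a::field set)"
  unfolding unital_subring_def by auto

text \<open>The next real is chosen outside a countable set: zero and the roots of all nonzero
  polynomials over the countable Laurent ring of the reals already found.\<close>

lemma exists_laurent_indep: "\<exists>T :: nat \<Rightarrow> real. laurent_indep \<int> {1..N} T"
proof (induction N)
  case 0
  show ?case
    unfolding laurent_indep_def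
  proof (intro exI conjI allI impI ballI)
    fix M :: "(nat \<Rightarrow> int) set" and c :: "(nat \<Rightarrow> int) \<Rightarrow> real" and e
    assume M: "M \<subseteq> iexps {1..0}" "(\<Sum>e\<in>M. c e * lmon {1..0} (\<lambda>_. 1) e) = 0" "e \<in> M"
    have "iexps {1..0} = {\<lambda>_. 0}" unfolding iexps_def by auto
    then have "M = {e}" using M by auto
    then show "c e = 0" using M(2) by (simp add: lmon_def)
  qed simp
next
  case (Suc N)
  then obtain T :: "nat \<Rightarrow> real" where T: "laurent_indep \<int> {1..N} T" by blast
  interpret laurent_ring "\<int>" "{1..N}" T
    using T unital_subring_Ints by unfold_locales auto
  let ?S = "L UNIV"
  have "countable (\<int> :: real set)" unfolding Ints_def by simp
  then have "countable ({r. \<exists>p. p \<noteq> 0 \<and> set (coeffs p) \<subseteq> ?S \<and> poly p r = 0} \<union> {0})"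
    (is "countable ?B") by (intro countable_Un countable_roots countable_lspan) auto
  then have "\<not> UNIV \<subseteq> ?B" using uncountable_UNIV_real countable_subset by blast
  then obtain r where r: "r \<noteq> 0" "\<And>p. set (coeffs p) \<subseteq> ?S \<Longrightarrow> poly p r = 0 \<Longrightarrow> p = 0" by blast
  let ?k = "Suc N"
  let ?T = "T(?k := r)"
  have lm: "lmon {1..?k} ?T e = lmon {1..N} T (e(?k := 0)) * r powi e ?k" for e
  proof -
    have "lmon {1..?k} ?T e = ?T ?k powi e ?k * (\<Prod>i\<in>{1..N}. ?T i powi e i)"
      unfolding lmon_def by (simp add: prod.nat_ivl_Suc' mult.commute)
    also have "(\<Prod>i\<in>{1..N}. ?T i powi e i) = lmon {1..N} T (e(?k := 0))"
      unfolding lmon_def by (intro prod.cong) auto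
    finally show ?thesis by (simp only: fun_upd_same mult.commute)
  qed
  have "c e0 = 0" if M: "finite M" "M \<subseteq> iexps {1..?k}" "\<forall>e\<in>M. c e \<in> \<int>"
    and s: "(\<Sum>e\<in>M. c e * lmon {1..?k} ?T e) = 0" and e0: "e0 \<in> M" for M c e0
  proof -
    \<comment> \<open>Shifting the last exponent by \<open>D\<close> makes it nonnegative, which
      turns the relation into a polynomial equation for \<open>r\<close>.\<close>
    define D where "D = (\<Sum>e\<in>M. \<bar>e ?k\<bar>)"
    have D: "D + e ?k \<ge> 0" if "e \<in> M" for e
    proof -
      have "\<bar>e ?k\<bar> \<le> D" unfolding D_def using M(1) that by (intro member_le_sum) auto
      then show ?thesis by linarith
    qed
    define a where "a e = c e * lmon {1..N} T (e(?k := 0))" for e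
    have up: "e(?k := 0) \<in> iexps {1..N}" if "e \<in> M" for e
    proof -
      have "\<forall>i. i \<notin> {1..?k} \<longrightarrow> e i = 0" using M that unfolding iexps_def by blast
      then show ?thesis unfolding iexps_def by auto
    qed
    define p where "p = (\<Sum>e\<in>M. Polynomial.monom (a e) (nat (D + e ?k)))"
    have coeff: "poly.coeff p d = (\<Sum>e\<in>{e\<in>M. nat (D + e ?k) = d}. a e)" for d
      unfolding p_def using M(1) by (simp add: coeff_sum sum.inter_filter)
    have "poly p r = (\<Sum>e\<in>M. a e * r ^ nat (D + e ?k))"
      unfolding p_def by (simp add: poly_sum poly_monom)
    also have "\<dots> = (\<Sum>e\<in>M. r powi D * (c e * lmon {1..?k} ?T e))"
    proof (intro sum.cong refl)
      fix e assume "e \<in> M"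
      then have "r ^ nat (D + e ?k) = r powi D * r powi e ?k"
        using D[of e] r(1) by (simp add: power_int_add flip: power_int_of_nat)
      then show "a e * r ^ nat (D + e ?k) = r powi D * (c e * lmon {1..?k} ?T e)"
        unfolding lm a_def by simp
    qed
    also have "\<dots> = 0" using s by (simp flip: sum_distrib_left)
    finally have pz: "poly p r = 0" .
    have "poly.coeff p d \<in> ?S" for d
      unfolding coeff a_def using M up by (intro lspan_sum lspan_term) auto
    moreover have "set (coeffs p) \<subseteq> range (poly.coeff p)" unfolding coeffs_def by auto
    ultimately have "set (coeffs p) \<subseteq> ?S" by blast
    then have "p = 0" using r(2) pz by blast
    then have "poly.coeff p (nat (D + e0 ?k)) = 0" by simp
    moreover have "{e\<in>M. nat (D + e ?k) = nat (D + e0 ?k)} = {e\<in>M. e ?k = e0 ?k}"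
      using D D[OF e0] by fastforce
    ultimately have s0: "(\<Sum>e\<in>{e\<in>M. e ?k = e0 ?k}. a e) = 0" unfolding coeff by simp
    define M0 where "M0 = {e\<in>M. e ?k = e0 ?k}"
    define \<phi> where "\<phi> e = e(?k := 0)" for e :: "nat \<Rightarrow> int"
    define \<psi> where "\<psi> e = e(?k := e0 ?k)" for e :: "nat \<Rightarrow> int"
    have inv: "\<psi> (\<phi> e) = e" if "e \<in> M0" for e using that unfolding \<phi>_def \<psi>_def M0_def by auto
    then have inj: "inj_on \<phi> M0" by (metis inj_onI)
    have "(\<Sum>e\<in>\<phi> ` M0. c (\<psi> e) * lmon {1..N} T e) = (\<Sum>e\<in>M0. c (\<psi> (\<phi> e)) * lmon {1..N} T (\<phi> e))"
      by (subst sum.reindex[OF inj]) simp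
    also have "\<dots> = (\<Sum>e\<in>M0. a e)" using inv by (intro sum.cong) (auto simp: a_def \<phi>_def)
    also have "\<dots> = 0" using s0 unfolding M0_def .
    finally have "(\<Sum>e\<in>\<phi> ` M0. c (\<psi> e) * lmon {1..N} T e) = 0" .
    moreover have "finite (\<phi> ` M0)" using M unfolding M0_def by simp
    moreover have "\<phi> ` M0 \<subseteq> iexps {1..N}" using up unfolding \<phi>_def M0_def by blast
    moreover have "\<forall>e\<in>\<phi> ` M0. c (\<psi> e) \<in> \<int>" using M inv unfolding M0_def by force
    moreover have e0': "e0 \<in> M0" using e0 unfolding M0_def by simp
    ultimately have "c (\<psi> (\<phi> e0)) = 0" using indepD[of "\<phi> ` M0" "\<lambda>e. c (\<psi> e)" "\<phi> e0"] by blast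
    then show ?thesis using inv[OF e0'] by simp
  qed
  moreover have "\<forall>i\<in>{1..?k}. ?T i \<noteq> 0" using nz r(1) by auto
  ultimately show ?case unfolding laurent_indep_def by blast
qed

section \<open>Specialization and positivity\<close>

lemma (in laurent_ring) L_lowest:
  fixes \<phi> :: "(nat \<Rightarrow> int) \<Rightarrow> int"
  assumes "f \<in> L UNIV" "f \<noteq> 0"
  obtains k g h where "g \<in> L {e. \<phi> e = k}" "h \<in> L {e. \<phi> e > k}" "g \<noteq> 0" "f = g + h"
proof -
  obtain M c where M: "finite M" "M \<subseteq> iexps I" "\<forall>e\<in>M. c e \<in> K \<and> c e \<noteq> 0"
    "f = (\<Sum>e\<in>M. c e * lmon I x e)" using L_rep[OF assms(1)] by metis
  have "M \<noteq> {}" using M(4) assms(2) by auto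
  define k where "k = Min (\<phi> ` M)"
  define M0 where "M0 = {e\<in>M. \<phi> e = k}"
  have k: "k \<le> \<phi> e" if "e \<in> M" for e unfolding k_def using M(1) that by auto
  have "k \<in> \<phi> ` M" unfolding k_def using M(1) \<open>M \<noteq> {}\<close> by (intro Min_in) auto
  then obtain e0 where e0: "e0 \<in> M0" unfolding M0_def by blast
  show ?thesis
  proof
    show "(\<Sum>e\<in>M0. c e * lmon I x e) \<in> L {e. \<phi> e = k}"
      using M by (intro lspan_sum lspan_term) (auto simp: M0_def)
    show "(\<Sum>e\<in>M - M0. c e * lmon I x e) \<in> L {e. \<phi> e > k}"
    proof (intro lspan_sum lspan_term)
      fix e assume "e \<in> M - M0"
      then show "c e \<in> K" "e \<in> iexps I" using M by auto
      show "e \<in> {e. \<phi> e > k}" using k[of e] \<open>e \<in> M - M0\<close> by (auto simp: M0_def)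
    qed
    show "f = (\<Sum>e\<in>M0. c e * lmon I x e) + (\<Sum>e\<in>M - M0. c e * lmon I x e)"
      unfolding M(4) using M(1) by (subst sum.subset_diff[of M0 M]) (auto simp: M0_def)
    show "(\<Sum>e\<in>M0. c e * lmon I x e) \<noteq> 0"
    proof
      assume "(\<Sum>e\<in>M0. c e * lmon I x e) = 0"
      then have "c e0 = 0" using M e0 by (intro indepD[of M0 c e0]) (auto simp: M0_def)
      then show False using M e0 unfolding M0_def by blast
    qed
  qed
qed

text \<open>The graph of the specialization, kept as a relation because a field element comes
  without a chosen expansion. It is single-valued only when \<open>T\<close> is independent.\<close>

inductive lspec :: "nat set \<Rightarrow> (nat \<Rightarrow> 'a::field) \<Rightarrow> (nat \<Rightarrow> 'b::field) \<Rightarrow> 'a \<Rightarrow> 'b \<Rightarrow> bool"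
  for I T y where
  zero: "lspec I T y 0 0"
| add: "e \<in> iexps I \<Longrightarrow> lspec I T y f g \<Longrightarrow> lspec I T y (of_int c * lmon I T e + f) (of_int c * lmon I y e + g)"

text \<open>
  For independent \<open>T\<close> this is the ring homomorphism from the integral Laurent polynomials in \<open>T\<close>
  that maps \<open>T i\<close> to \<open>y i\<close>; elsewhere it is a junk value.
\<close>
definition lev :: "nat set \<Rightarrow> (nat \<Rightarrow> 'a::field) \<Rightarrow> (nat \<Rightarrow> 'b::field) \<Rightarrow> 'a \<Rightarrow> 'b" where
  "lev I T y f = (THE g. lspec I T y f g)"

lemma lspec_plus: "lspec I T y f g \<Longrightarrow> lspec I T y f' g' \<Longrightarrow> lspec I T y (f + f') (g + g')"
  by (induction rule: lspec.induct) (auto intro: lspec.add simp: add.assoc)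

lemma lspec_term: "e \<in> iexps I \<Longrightarrow> lspec I T y (of_int c * lmon I T e) (of_int c * lmon I y e)"
  using lspec.add[OF _ lspec.zero, of e I T y c] by simp

lemma lspec_uminus: "lspec I T y f g \<Longrightarrow> lspec I T y (- f) (- g)"
proof (induction rule: lspec.induct)
  case zero
  show ?case using lspec.zero by simp
next
  case (add e f g c)
  have "- (of_int c * lmon I T e + f) = of_int (- c) * lmon I T e + - f"
    "- (of_int c * lmon I y e + g) = of_int (- c) * lmon I y e + - g" by simp_all
  then show ?case using lspec.add[OF add(1,3), of "- c"] by (simp only:)
qed

lemma lspec_rep:
  assumes "lspec I T y f g"
  shows "\<exists>M c. finite M \<and> M \<subseteq> iexps I \<and> f = (\<Sum>e\<in>M. of_int (c e) * lmon I T e)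
    \<and> g = (\<Sum>e\<in>M. of_int (c e) * lmon I y e)"
  using assms
proof (induction rule: lspec.induct)
  case zero
  show ?case by (rule exI[of _ "{}"]) simp
next
  case (add e f g a)
  then obtain M c where M: "finite M" "M \<subseteq> iexps I" "f = (\<Sum>e\<in>M. of_int (c e) * lmon I T e)"
    "g = (\<Sum>e\<in>M. of_int (c e) * lmon I y e)" by blast
  define b where "b = (if e \<in> M then a + c e else a)"
  have "(\<Sum>r\<in>insert e M. of_int ((c(e := b)) r) * h r) = of_int a * h e + (\<Sum>e\<in>M. of_int (c e) * h e)"
    for h :: "(nat \<Rightarrow> int) \<Rightarrow> 'c::field"
  proof -
    have "(\<Sum>r\<in>insert e M. of_int ((c(e := b)) r) * h r)
        = of_int b * h e + (\<Sum>r\<in>M - {e}. of_int ((c(e := b)) r) * h r)"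
      using M(1) by (simp add: sum.insert_remove)
    also have "(\<Sum>r\<in>M - {e}. of_int ((c(e := b)) r) * h r) = (\<Sum>r\<in>M - {e}. of_int (c r) * h r)"
      by (intro sum.cong) auto
    also have "of_int b * h e + \<dots> = of_int a * h e + (\<Sum>e\<in>M. of_int (c e) * h e)"
      unfolding b_def using M(1) by (auto simp: sum.remove[of M e] algebra_simps)
    finally show ?thesis .
  qed
  from this[of "lmon I T"] this[of "lmon I y"] show ?case
    using M add.hyps by (intro exI[of _ "insert e M"] exI[of _ "c(e := b)"]) auto
qed

locale specialization = laurent_ring "\<int>" I T for I and T :: "nat \<Rightarrow> 'a::field_char_0" +
  fixes y :: "nat \<Rightarrow> 'b::field"
  assumes y_nz: "\<forall>i\<in>I. y i \<noteq> 0"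
begin

abbreviation "ev \<equiv> lev I T y"

text \<open>Both sides are expanded with the same integers, which independence of \<open>T\<close>
  and characteristic zero force to vanish.\<close>

lemma lspec_0: "lspec I T y 0 g \<Longrightarrow> g = 0"
proof -
  assume g: "lspec I T y 0 g"
  obtain M c where M: "finite M" "M \<subseteq> iexps I" "0 = (\<Sum>e\<in>M. of_int (c e) * lmon I T e)"
    "g = (\<Sum>e\<in>M. of_int (c e) * lmon I y e)" using lspec_rep[OF g] by blast
  then have "(of_int (c e) :: 'a) = 0" if "e \<in> M" for e
    using indepD[of M "\<lambda>e. of_int (c e)" e] that by simp
  then show ?thesis unfolding M(4) by simp
qed

lemma lspec_unique: "lspec I T y f g \<Longrightarrow> lspec I T y f g' \<Longrightarrow> g = g'"
  using lspec_plus[OF _ lspec_uminus, of I T y f g f g'] lspec_0[of "g - g'"] by simp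

lemma lev_eq: "lspec I T y f g \<Longrightarrow> ev f = g"
  unfolding lev_def using lspec_unique by blast

lemma lspec_total: "f \<in> L W \<Longrightarrow> \<exists>g. lspec I T y f g"
proof (induction rule: lspan.induct)
  case zero
  show ?case using lspec.zero by blast
next
  case (add c e f)
  then obtain a g where "c = of_int a" "lspec I T y f g" unfolding Ints_def by blast
  then show ?case using lspec.add[OF add.hyps(3), of T y f g a] by blast
qed

lemma lspec_lev: "f \<in> L W \<Longrightarrow> lspec I T y f (ev f)"
  using lspec_total lev_eq by blast

lemma lspec_mult: "lspec I T y f g \<Longrightarrow> lspec I T y f' g' \<Longrightarrow> lspec I T y (f * f') (g * g')"
proof (induction rule: lspec.induct)
  case zero
  show ?case using lspec.zero by simp
next
  case (add e f g c)
  have "lspec I T y (of_int c * lmon I T e * f') (of_int c * lmon I y e * g')" using add.prems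
  proof (induction rule: lspec.induct)
    case zero
    show ?case using lspec.zero by simp
  next
    case (add e' f g c')
    have eq1: "of_int c * lmon I T e * (of_int c' * lmon I T e' + f)
        = of_int (c * c') * lmon I T (\<lambda>i. e i + e' i) + of_int c * lmon I T e * f"
      by (simp add: lmon_plus algebra_simps)
    have eq2: "of_int c * lmon I y e * (of_int c' * lmon I y e' + g)
        = of_int (c * c') * lmon I y (\<lambda>i. e i + e' i) + of_int c * lmon I y e * g"
      by (simp add: lmon_add[OF y_nz] algebra_simps)
    show ?case
      unfolding eq1 eq2 by (rule lspec.add[OF iexps_add[OF \<open>e \<in> iexps I\<close> add.hyps(1)] add.IH])
  qed
  from lspec_plus[OF this add.IH[OF add.prems]] show ?case unfolding distrib_right .
qed

lemma ev_plus: "f \<in> L UNIV \<Longrightarrow> g \<in> L UNIV \<Longrightarrow> ev (f + g) = ev f + ev g"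
  by (intro lev_eq lspec_plus lspec_lev)

lemma ev_mult: "f \<in> L UNIV \<Longrightarrow> g \<in> L UNIV \<Longrightarrow> ev (f * g) = ev f * ev g"
  by (intro lev_eq lspec_mult lspec_lev)

lemma ev_term: "e \<in> iexps I \<Longrightarrow> ev (of_int c * lmon I T e) = of_int c * lmon I y e"
  by (intro lev_eq lspec_term)

lemma ev_zero: "ev 0 = 0"
  by (intro lev_eq lspec.zero)

lemma ev_one: "ev 1 = 1"
  using ev_term[of "\<lambda>_. 0" 1] by (simp add: iexps_zero)

lemma ev_var: "i \<in> I \<Longrightarrow> ev (T i) = y i"
  using ev_term[of "\<lambda>k. if k = i then 1 else 0" 1] lmon_single[OF fin, of i T 1] lmon_single[OF fin, of i y 1]
  by (simp add: iexps_single)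

lemma L_UNIV_power: "f \<in> L UNIV \<Longrightarrow> f ^ k \<in> L UNIV"
  by (rule L_power) auto

lemma ev_power: "f \<in> L UNIV \<Longrightarrow> ev (f ^ k) = ev f ^ k"
  by (induction k) (auto simp: ev_one ev_mult L_UNIV_power)

lemma ev_prod:
  "(\<And>i. i \<in> A \<Longrightarrow> f i \<in> L UNIV) \<Longrightarrow> ev (\<Prod>i\<in>A. f i) = (\<Prod>i\<in>A. ev (f i)) \<and> (\<Prod>i\<in>A. f i) \<in> L UNIV"
  by (induction A rule: infinite_finite_induct) (auto simp: ev_one ev_mult L_one intro: L_mult_UNIV)

lemma ev_sum:
  "(\<And>i. i \<in> A \<Longrightarrow> f i \<in> L UNIV) \<Longrightarrow> ev (\<Sum>i\<in>A. f i) = (\<Sum>i\<in>A. ev (f i))"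
  by (induction A rule: infinite_finite_induct) (auto simp: ev_zero ev_plus lspan_sum)

text \<open>Here \<open>z i\<close> is an arbitrary Laurent polynomial, whose inverse may leave the
  ring; hence the nonnegative exponents.\<close>

lemma ev_lmon_nonneg:
  assumes "\<And>i. i \<in> A \<Longrightarrow> z i \<in> L UNIV" "\<And>i. i \<in> A \<Longrightarrow> e i \<ge> 0"
  shows "ev (lmon A z e) = lmon A (\<lambda>i. ev (z i)) e" "lmon A z e \<in> L UNIV"
proof -
  have eq: "lmon A u e = (\<Prod>i\<in>A. u i ^ nat (e i))" for u :: "nat \<Rightarrow> 'c::field"
    unfolding lmon_def using assms(2) by (intro prod.cong) (auto simp: power_int_def)
  have "ev (\<Prod>i\<in>A. z i ^ nat (e i)) = (\<Prod>i\<in>A. ev (z i ^ nat (e i))) \<and> (\<Prod>i\<in>A. z i ^ nat (e i)) \<in> L UNIV"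
    using assms(1) by (intro ev_prod L_UNIV_power)
  moreover have "(\<Prod>i\<in>A. ev (z i ^ nat (e i))) = (\<Prod>i\<in>A. ev (z i) ^ nat (e i))"
    using assms(1) by (intro prod.cong) (auto simp: ev_power)
  ultimately show "ev (lmon A z e) = lmon A (\<lambda>i. ev (z i)) e" "lmon A z e \<in> L UNIV"
    unfolding eq by auto
qed

end

text \<open>
  \<open>f\<close> has no negative power of \<open>T j\<close>, and the sum of the coefficients of its part free of \<open>T j\<close>
  has sign \<open>S\<close>. For \<open>j \<notin> I\<close> this is a condition on the sum of all coefficients.
\<close>
definition sgn_at :: "(real \<Rightarrow> bool) \<Rightarrow> nat set \<Rightarrow> (nat \<Rightarrow> 'a::field) \<Rightarrow> nat \<Rightarrow> 'a \<Rightarrow> bool" where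
  "sgn_at S I T j f \<longleftrightarrow> (\<exists>f0\<in>lspan \<int> I T {e. e j = 0}. \<exists>f1\<in>lspan \<int> I T {e. e j > 0}.
     f = f0 + f1 \<and> S (lev I T (\<lambda>_. 1) f0))"

abbreviation "pos_at \<equiv> sgn_at (\<lambda>r. r > 0)"
abbreviation "nonneg_at \<equiv> sgn_at (\<lambda>r. r \<ge> 0)"

lemma sgn_at_mono: "sgn_at S I T j f \<Longrightarrow> (\<And>r. S r \<Longrightarrow> S' r) \<Longrightarrow> sgn_at S' I T j f"
  unfolding sgn_at_def by blast

locale unit_specialization = specialization I T "\<lambda>_. 1 :: real" for I T
begin

lemma sgn_atI: "f0 \<in> L {e. e j = 0} \<Longrightarrow> f1 \<in> L {e. e j > 0} \<Longrightarrow> f = f0 + f1 \<Longrightarrow> S (ev f0) \<Longrightarrow> sgn_at S I T j f"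
  unfolding sgn_at_def by blast

lemma sgn_at_mult:
  assumes "sgn_at S I T j f" "sgn_at S I T j g" "\<And>a b. S a \<Longrightarrow> S b \<Longrightarrow> S (a * b)"
  shows "sgn_at S I T j (f * g)"
proof -
  obtain f0 f1 where f: "f0 \<in> L {e. e j = 0}" "f1 \<in> L {e. e j > 0}" "f = f0 + f1" "S (ev f0)"
    using assms(1) unfolding sgn_at_def by blast
  obtain g0 g1 where g: "g0 \<in> L {e. e j = 0}" "g1 \<in> L {e. e j > 0}" "g = g0 + g1" "S (ev g0)"
    using assms(2) unfolding sgn_at_def by blast
  show ?thesis
  proof (rule sgn_atI)
    show "f0 * g0 \<in> L {e. e j = 0}" by (rule L_mult[OF f(1) g(1)]) auto
    show "f0 * g1 + f1 * g0 + f1 * g1 \<in> L {e. e j > 0}"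
      by (intro lspan_plus L_mult[OF f(1) g(2)] L_mult[OF f(2) g(1)] L_mult[OF f(2) g(2)]) auto
    show "f * g = f0 * g0 + (f0 * g1 + f1 * g0 + f1 * g1)" unfolding f g by (simp add: algebra_simps)
    show "S (ev (f0 * g0))" using assms(3) f(4) g(4) ev_mult L_UNIV f(1) g(1) by metis
  qed
qed

lemma sgn_at_add:
  assumes "sgn_at S I T j f" "sgn_at S' I T j g" "\<And>a b. S a \<Longrightarrow> S' b \<Longrightarrow> S'' (a + b)"
  shows "sgn_at S'' I T j (f + g)"
proof -
  obtain f0 f1 where f: "f0 \<in> L {e. e j = 0}" "f1 \<in> L {e. e j > 0}" "f = f0 + f1" "S (ev f0)"
    using assms(1) unfolding sgn_at_def by blast
  obtain g0 g1 where g: "g0 \<in> L {e. e j = 0}" "g1 \<in> L {e. e j > 0}" "g = g0 + g1" "S' (ev g0)"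
    using assms(2) unfolding sgn_at_def by blast
  show ?thesis
  proof (rule sgn_atI)
    show "f0 + g0 \<in> L {e. e j = 0}" "f1 + g1 \<in> L {e. e j > 0}" using f g lspan_plus by blast+
    show "f + g = f0 + g0 + (f1 + g1)" unfolding f g by simp
    show "S'' (ev (f0 + g0))" using assms(3) f(4) g(4) ev_plus L_UNIV f(1) g(1) by metis
  qed
qed

lemma sgn_at_one: "S 1 \<Longrightarrow> sgn_at S I T j 1"
  by (rule sgn_atI[of 1 _ 0]) (auto intro: L_one lspan.zero simp: ev_one)

lemma sgn_at_lmon:
  assumes "\<And>i. i \<in> A \<Longrightarrow> e i \<ge> 0" "\<And>i. i \<in> A \<Longrightarrow> e i \<noteq> 0 \<Longrightarrow> sgn_at S I T j (z i)"
    and S: "\<And>a b. S a \<Longrightarrow> S b \<Longrightarrow> S (a * b)" "S 1"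
  shows "sgn_at S I T j (lmon A z e)"
proof -
  have pow: "sgn_at S I T j (f ^ n)" if "sgn_at S I T j f" for f n
    by (induction n) (auto intro: that sgn_at_one sgn_at_mult S)
  have "sgn_at S I T j (z i powi e i)" if "i \<in> A" for i
    using pow[OF assms(2)[OF that]] assms(1)[OF that] sgn_at_one[of S j] S(2)
    by (cases "e i = 0") (auto simp: power_int_def)
  then show ?thesis unfolding lmon_def
    by (induction A rule: infinite_finite_induct) (auto intro: sgn_at_one sgn_at_mult S)
qed

text \<open>If \<open>g\<close> is the lowest \<open>T j\<close>-component of \<open>w\<close>, then
  \<open>z0 * g\<close> is that of \<open>z * w\<close>. As \<open>z * w\<close> starts in degree 0,
  so does \<open>w\<close>, and multiplicativity of \<open>ev\<close> yields the sign. Positivity of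
  each single coefficient would not survive such a division; positivity of their sum does.\<close>

lemma pos_at_quotient:
  assumes z: "pos_at I T j z" and w: "w \<in> L UNIV" and zw: "pos_at I T j (z * w)"
  shows "pos_at I T j w"
proof -
  obtain z0 z1 where z: "z0 \<in> L {e. e j = 0}" "z1 \<in> L {e. e j > 0}" "z = z0 + z1" "ev z0 > 0"
    using z unfolding sgn_at_def by blast
  obtain p0 p1 where p: "p0 \<in> L {e. e j = 0}" "p1 \<in> L {e. e j > 0}" "z * w = p0 + p1" "ev p0 > 0"
    using zw unfolding sgn_at_def by blast
  have "p0 \<noteq> 0" "z0 \<noteq> 0" using p(4) z(4) ev_zero by auto
  have "w \<noteq> 0"
  proof
    assume "w = 0"
    then have "p0 + p1 = 0 + 0" using p(3) by simp
    then have "p0 = 0" by (rule L_component_eq[OF _ p(1) lspan.zero p(2) lspan.zero]) auto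
    then show False using \<open>p0 \<noteq> 0\<close> by blast
  qed
  then obtain k g h where gh: "g \<in> L {e. e j = k}" "h \<in> L {e. e j > k}" "g \<noteq> 0" "w = g + h"
    using L_lowest[OF w, of "\<lambda>e. e j"] by blast
  have low: "z0 * g \<in> L {e. e j = k}" by (rule L_mult[OF z(1) gh(1)]) auto
  have high: "z0 * h + z1 * g + z1 * h \<in> L {e. e j > k}"
    by (intro lspan_plus L_mult[OF z(1) gh(2)] L_mult[OF z(2) gh(1)] L_mult[OF z(2) gh(2)]) auto
  have eq: "z0 * g + (z0 * h + z1 * g + z1 * h) = p0 + p1"
    using p(3) unfolding z gh by (simp add: algebra_simps)
  have ne: "z0 * g \<noteq> 0" using \<open>z0 \<noteq> 0\<close> gh by simp
  consider "k < 0" | "k > 0" | "k = 0" by linarith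
  then show ?thesis
  proof cases
    case 1
    have "z0 * g = 0"
    proof (rule L_component_eq)
      show "z0 * g + (z0 * h + z1 * g + z1 * h) = 0 + (p0 + p1)" using eq by simp
      show "p0 + p1 \<in> L {e. e j > k}"
        using 1 by (intro lspan_plus lspan_mono[OF p(1)] lspan_mono[OF p(2)]) auto
    qed (use low high in \<open>auto intro: lspan.zero\<close>)
    then show ?thesis using ne by simp
  next
    case 2
    have "p0 = 0"
    proof (rule L_component_eq)
      show "p0 + p1 = 0 + (z0 * g + (z0 * h + z1 * g + z1 * h))" using eq by simp
      show "z0 * g + (z0 * h + z1 * g + z1 * h) \<in> L {e. e j > 0}"
        using 2 by (intro lspan_plus[of "z0 * g"] lspan_mono[OF low] lspan_mono[OF high]) auto
    qed (use p in \<open>auto intro: lspan.zero\<close>)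
    then show ?thesis using \<open>p0 \<noteq> 0\<close> by simp
  next
    case 3
    then have "z0 * g = p0"
      using low high by (intro L_component_eq[OF eq _ p(1) _ p(2)]) auto
    then have "ev z0 * ev g > 0" using p(4) ev_mult L_UNIV z(1) gh(1) by metis
    then have "ev g > 0" using z(4) by (simp add: zero_less_mult_iff)
    then show ?thesis using 3 gh sgn_atI[of g j h w] by simp
  qed
qed

end

lemma unit_specializationI: "laurent_ring \<int> I (T :: nat \<Rightarrow> 'a::field_char_0) \<Longrightarrow> unit_specialization I T"
  unfolding unit_specialization_def specialization_def specialization_axioms_def by simp

section \<open>Positivity of coefficient sums along mutations\<close>

lemma mut_equiv_step:
  assumes "mut_equiv m n s (y, C)" "k \<in> {1..n}"
  shows "mut_equiv m n s (mut_vars m k y C, mut_mat k C)"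
  using assms unfolding mut_equiv_def
  by (elim rtranclp.rtrancl_into_rtrancl) (auto simp: mut_step_def)

lemma cluster_frozen:
  fixes x :: "nat \<Rightarrow> 'a::field_char_0"
  assumes "mut_equiv m n (x, B) (z, D)" "lseed K m n x B" "s \<notin> {1..n}"
  shows "z s = x s"
  using assms(1,2)
  by (induction rule: mut_equiv_induct(1)) (use assms(3) in \<open>auto simp: mut_vars_def\<close>)

text \<open>The exchange polynomial is \<open>y k\<close> times the new variable, so its positivity
  passes on by \<open>pos_at_quotient\<close>. The case \<open>s = j\<close> is excluded since the
  part of \<open>T j\<close> free of \<open>T j\<close> is zero. An index \<open>j\<close> outside
  \<open>1..m\<close> is allowed and gives the sum of all coefficients.\<close>

lemma cluster_positive:
  fixes T :: "nat \<Rightarrow> 'a::field_char_0"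
  assumes "mut_equiv m n (T, B) (z, D)" "lseed \<int> m n T B" "indep_cols m n B" "j \<notin> {1..n}"
  shows "\<forall>s\<in>{1..m}. s \<noteq> j \<longrightarrow> pos_at {1..m} T j (z s)"
proof -
  interpret unit_specialization "{1..m}" T
    using assms(2) unfolding lseed_def by (intro unit_specializationI) auto
  have one_var: "T i \<in> L {e. e i = 1 \<and> (\<forall>k. k \<noteq> i \<longrightarrow> e k = 0)}" if "i \<in> {1..m}" for i
    using L_var_powi[OF that, of 1 "{e. e i = 1 \<and> (\<forall>k. k \<noteq> i \<longrightarrow> e k = 0)}"] by simp
  have Tj: "nonneg_at {1..m} T j (T j)" if "j \<in> {1..m}"
  proof (rule sgn_atI[of 0 _ "T j"])
    show "T j \<in> L {e. e j > 0}" by (rule lspan_mono[OF one_var[OF that]]) auto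
  qed (auto intro: lspan.zero simp: ev_zero simp del: One_nat_def)
  show ?thesis
    using assms(1,2)
  proof (induction rule: mut_equiv_induct(1))
    case refl
    show ?case
    proof (intro ballI impI)
      fix s assume s: "s \<in> {1..m}" "s \<noteq> j"
      show "pos_at {1..m} T j (T s)"
      proof (rule sgn_atI[of "T s" _ 0])
        show "T s \<in> L {e. e j = 0}" by (rule lspan_mono[OF one_var[OF s(1)]]) (use s in auto)
      qed (auto intro: lspan.zero simp: ev_var[OF s(1)] simp del: One_nat_def)
    qed
  next
    case (step y C k)
    have nm: "n \<le> m" using assms(2) unfolding lseed_def by simp
    let ?c = "colv m C k"
    interpret E: laurent_exchange \<int> "{1..m}" y k "exch {1..m} y ?c" "mut_vars m k y C"
      using lseed_exchange[OF step(2,3)] .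
    have yj: "nonneg_at {1..m} T j (y i)" if "i \<in> {1..m}" for i
    proof (cases "i = j")
      case True
      then show ?thesis using Tj that cluster_frozen[OF step(1) assms(2,4)] by simp
    next
      case False
      then have "pos_at {1..m} T j (y i)" using bspec[OF step(4) that] by simp
      then show ?thesis by (rule sgn_at_mono) simp
    qed
    have nn: "nonneg_at {1..m} T j (lmon {1..m} y e)" if "\<And>i. e i \<ge> 0" for e
      using that yj by (intro sgn_at_lmon) auto
    have pp: "pos_at {1..m} T j (lmon {1..m} y e)" if "\<And>i. e i \<ge> 0" "e j = 0" for e
    proof (rule sgn_at_lmon)
      fix i assume i: "i \<in> {1..m}" "e i \<noteq> 0"
      then have "i \<noteq> j" using that(2) by auto
      then show "pos_at {1..m} T j (y i)" using bspec[OF step(4) i(1)] by simp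
    qed (use that in auto)
    have "pos_at {1..m} T j (exch {1..m} y ?c)"
    \<comment> \<open>\<open>T j\<close> occurs explicitly in at most one of the two exchange
      monomials; the other is positive and this one nonnegative, so the sum is positive.\<close>
    proof (cases "?c j \<le> 0")
      case True
      then show ?thesis unfolding exch_def by (intro sgn_at_add[OF pp nn]) auto
    next
      case False
      then show ?thesis unfolding exch_def by (intro sgn_at_add[OF nn pp]) auto
    qed
    moreover have "exch {1..m} y ?c = y k * mut_vars m k y C k"
      using E.v_j E.nzD[OF E.j] by simp
    ultimately have prod: "pos_at {1..m} T j (y k * mut_vars m k y C k)" by (simp only:)
    have mem: "mut_vars m k y C k \<in> L UNIV"
      using laurent_phenomenon_indep[OF mut_equiv_step[OF step(1,3)] assms(2,3) E.j] .
    have "pos_at {1..m} T j (y k)" using bspec[OF step(4) E.j] step(3) assms(4) by auto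
    from pos_at_quotient[OF this mem prod] have new: "pos_at {1..m} T j (mut_vars m k y C k)" .
    show ?case
    proof (intro ballI impI)
      fix s assume s: "s \<in> {1..m}" "s \<noteq> j"
      show "pos_at {1..m} T j (mut_vars m k y C s)"
      proof (cases "s = k")
        case True
        then show ?thesis using new by simp
      next
        case False
        then have "mut_vars m k y C s = y s" by (simp add: mut_vars_def)
        then show ?thesis using bspec[OF step(4) s(1)] s(2) by simp
      qed
    qed
  qed
qed

section \<open>The Laurent phenomenon\<close>

lemma lspec_sum: "(\<And>i. i \<in> A \<Longrightarrow> lspec I T y (f i) (g i)) \<Longrightarrow> lspec I T y (\<Sum>i\<in>A. f i) (\<Sum>i\<in>A. g i)"
  by (induction A rule: infinite_finite_induct) (auto intro: lspec.zero lspec_plus)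

text \<open>
  The matrix is extended by an identity block, which makes its columns independent; the expansion
  obtained for independent variables \<open>T\<close> is then specialized to \<open>x\<close> on the first \<open>m\<close> and to \<open>1\<close>
  on the last \<open>n\<close> coordinates.
\<close>
theorem laurent_phenomenon:
  fixes x :: "nat \<Rightarrow> 'a::field_char_0"
  assumes eq: "mut_equiv m n (x, B) (z, D)" and x: "lseed K m n x B" and s: "s \<in> {1..m}"
  shows "z s \<in> lspan \<int> {1..m} x {e. \<forall>i\<in>{n+1..m}. e i \<ge> 0}"
    and "\<exists>r>0. lspec {1..m} x (\<lambda>_. 1 :: real) (z s) r"
proof -
  let ?I = "{1..m + n}"
  have nm: "n \<le> m" and skew: "skew_symmetrizable n B" and xR: "laurent_ring K {1..m} x"
    using x unfolding lseed_def by auto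
  obtain T :: "nat \<Rightarrow> real" where T: "laurent_indep \<int> ?I T" using exists_laurent_indep by blast
  define E where "E i j = (if i \<le> m then B i j else if i = m + j then 1 else 0)" for i j
  have TR: "laurent_ring \<int> ?I T" using T unital_subring_Ints by unfold_locales auto
  have "skew_symmetrizable n E" using skew nm unfolding skew_symmetrizable_def E_def by auto
  then have TS: "lseed \<int> (m + n) n T E" unfolding lseed_def using TR by simp
  have ind: "indep_cols (m + n) n E" unfolding indep_cols_def
  proof (intro allI impI ballI)
    fix w :: "nat \<Rightarrow> int" and k
    assume w: "\<forall>s\<in>?I. (\<Sum>k\<in>{1..n}. E s k * w k) = 0" and k: "k \<in> {1..n}"
    have "(\<Sum>j\<in>{1..n}. E (m + k) j * w j) = (\<Sum>j\<in>{1..n}. if j = k then w j else 0)"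
      using k by (intro sum.cong) (auto simp: E_def)
    also have "\<dots> = w k" using k by simp
    finally show "w k = 0" using w k by auto
  qed
  define x' where "x' i = (if i \<le> m then x i else 1)" for i
  have x'nz: "\<forall>i\<in>?I. x' i \<noteq> 0" using laurent_ring.nzD[OF xR] unfolding x'_def by auto
  interpret SP: specialization ?I T x'
    using TR x'nz unfolding specialization_def specialization_axioms_def by blast
  interpret U: unit_specialization ?I T using unit_specializationI[OF TR] .
  \<comment> \<open>The same mutations are applied to the extended seed. Its first \<open>m\<close>
    rows evolve like the original matrix, since mutation at \<open>k \<le> n\<close> combines an
    entry only with entries of its own row and of row \<open>k\<close>.\<close>
  have "\<exists>zt Dt. mut_equiv (m + n) n (T, E) (zt, Dt) \<and> (\<forall>i\<in>{1..m}. \<forall>j. Dt i j = D i j)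
      \<and> (\<forall>s\<in>{1..m}. SP.ev (zt s) = z s)"
    using eq x
  proof (induction rule: mut_equiv_induct(1))
    case refl
    show ?case
    proof (intro exI conjI ballI)
      show "mut_equiv (m + n) n (T, E) (T, E)" by (simp add: mut_equiv_def)
      show "SP.ev (T s) = x s" if "s \<in> {1..m}" for s
        using that SP.ev_var[of s] by (auto simp: x'_def)
    qed (auto simp: E_def)
  next
    case (step y C k)
    then obtain yt Ct where t: "mut_equiv (m + n) n (T, E) (yt, Ct)" "\<forall>i\<in>{1..m}. \<forall>j. Ct i j = C i j"
      "\<forall>s\<in>{1..m}. SP.ev (yt s) = y s" by blast
    let ?yt = "mut_vars (m + n) k yt Ct"
    have t': "mut_equiv (m + n) n (T, E) (?yt, mut_mat k Ct)" using mut_equiv_step[OF t(1) step(3)] .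
    have ytS: "lseed \<int> (m + n) n yt Ct" using mut_equiv_lseed[OF t(1) TS] .
    have ytL: "yt i \<in> SP.L UNIV" if "i \<in> ?I" for i using laurent_phenomenon_indep[OF t(1) TS ind that] .
    interpret Y: laurent_exchange K "{1..m}" y k "exch {1..m} y (colv m C k)" "mut_vars m k y C"
      using lseed_exchange[OF step(2,3)] .
    interpret Z: laurent_exchange \<int> ?I yt k "exch ?I yt (colv (m + n) Ct k)" ?yt
      using lseed_exchange[OF ytS step(3)] .
    have evy: "SP.ev (yt i) = (if i \<le> m then y i else 1)" if "i \<in> ?I" for i
    proof (cases "i \<le> m")
      case True
      then show ?thesis using t(3) that by auto
    next
      case False
      then have "yt i = T i" using cluster_frozen[OF t(1) TS, of i] nm by auto
      then show ?thesis using SP.ev_var[OF that] False by (simp add: x'_def)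
    qed
    have lm: "SP.ev (lmon ?I yt e) = lmon {1..m} y e'"
      if "\<And>i. e i \<ge> 0" "\<And>i. i \<in> {1..m} \<Longrightarrow> e i = e' i" for e e'
    proof -
      have "SP.ev (lmon ?I yt e) = lmon ?I (\<lambda>i. SP.ev (yt i)) e"
        using ytL that by (intro SP.ev_lmon_nonneg) auto
      also have "\<dots> = lmon {1..m} y e'"
        unfolding lmon_def using that evy by (intro prod.mono_neutral_cong_right) auto
      finally show ?thesis .
    qed
    have colv: "colv (m + n) Ct k i = colv m C k i" if "i \<in> {1..m}" for i
      using that t(2) by (auto simp: colv_def)
    have "SP.ev (exch ?I yt (colv (m + n) Ct k)) = exch {1..m} y (colv m C k)"
    proof -
      have m: "lmon ?I yt (\<lambda>i. max 0 (colv (m + n) Ct k i)) \<in> SP.L UNIV"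
        "lmon ?I yt (\<lambda>i. max 0 (- colv (m + n) Ct k i)) \<in> SP.L UNIV"
        using ytL by (intro SP.ev_lmon_nonneg(2); auto)+
      show ?thesis unfolding exch_def SP.ev_plus[OF m]
        by (intro arg_cong2[where f = "(+)"] lm) (simp_all add: colv del: One_nat_def)
    qed
    \<comment> \<open>Both factors lie in the Laurent ring of \<open>T\<close> by the result for
      independent columns, so \<open>ev\<close> can be applied to the exchange relation, which is
      then solved for the new variable.\<close>
    moreover have "exch ?I yt (colv (m + n) Ct k) = yt k * ?yt k"
      using Z.v_j Z.nzD[OF Z.j] by simp
    moreover have "SP.ev (yt k * ?yt k) = SP.ev (yt k) * SP.ev (?yt k)"
      using SP.ev_mult ytL[OF Z.j] laurent_phenomenon_indep[OF t' TS ind Z.j] by blast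
    moreover have "SP.ev (yt k) = y k" using t(3) Y.j by blast
    ultimately have "y k * SP.ev (?yt k) = exch {1..m} y (colv m C k)" by (simp only:)
    then have new: "SP.ev (?yt k) = mut_vars m k y C k"
      unfolding Y.v_j using Y.nzD[OF Y.j] by (simp add: eq_divide_eq mult.commute)
    show ?case
    proof (intro exI conjI ballI)
      show "mut_equiv (m + n) n (T, E) (?yt, mut_mat k Ct)" by fact
      show "\<forall>j. mut_mat k Ct i j = mut_mat k C i j" if "i \<in> {1..m}" for i
        using that t(2) Y.j unfolding mut_mat_def by metis
      show "SP.ev (?yt i) = mut_vars m k y C i" if "i \<in> {1..m}" for i
      proof (cases "i = k")
        case True
        then show ?thesis using new by simp
      next
        case False
        then have "?yt i = yt i" "mut_vars m k y C i = y i" by (simp_all add: mut_vars_def)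
        then show ?thesis using t(3) that by simp
      qed
    qed
  qed
  then obtain zt Dt where zt: "mut_equiv (m + n) n (T, E) (zt, Dt)" "SP.ev (zt s) = z s"
    using s by blast
  have sI: "s \<in> ?I" using s by auto
  have "zt s \<in> SP.L UNIV" using laurent_phenomenon_indep[OF zt(1) TS ind sI] .
  then obtain M c where M: "finite M" "M \<subseteq> iexps ?I" "\<forall>e\<in>M. c e \<in> \<int> \<and> c e \<noteq> 0"
    "zt s = (\<Sum>e\<in>M. c e * lmon ?I T e)" "\<And>W. zt s \<in> SP.L W \<longleftrightarrow> M \<subseteq> W" by (rule SP.L_rep) blast
  have "\<forall>e\<in>M. \<exists>a::int. c e = of_int a" using M(3) unfolding Ints_def by blast
  then obtain a where a: "\<And>e. e \<in> M \<Longrightarrow> c e = of_int (a e :: int)" by metis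
  have nonneg: "e i \<ge> 0" if i: "i \<in> {n+1..m}" and e: "e \<in> M" for i e
  proof -
    have "zt s \<in> SP.L {e. e i \<ge> 0}"
    proof (cases "s = i")
      case True
      then have "zt s = T i powi 1" using cluster_frozen[OF zt(1) TS, of i] i by simp
      then show ?thesis using SP.L_var_powi[OF sI, of 1 "{e. e i \<ge> 0}"] True by simp
    next
      case False
      have "i \<notin> {1..n}" using i by simp
      then have "pos_at ?I T i (zt s)" using cluster_positive[OF zt(1) TS ind] sI False by blast
      then obtain f0 f1 where f: "f0 \<in> SP.L {e. e i = 0}" "f1 \<in> SP.L {e. e i > 0}" "zt s = f0 + f1"
        unfolding sgn_at_def by blast
      show ?thesis unfolding f(3) by (intro lspan_plus lspan_mono[OF f(1)] lspan_mono[OF f(2)]) auto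
    qed
    then have "M \<subseteq> {e. e i \<ge> 0}" unfolding M(5) .
    then show ?thesis using e by blast
  qed
  \<comment> \<open>\<open>x'\<close> is 1 on the last \<open>n\<close> coordinates, so specializing
    truncates exponents. Distinct \<open>e\<close> may share \<open>\<rho> e\<close>, which is why
    the sum stays indexed by \<open>M\<close>.\<close>
  define \<rho> where "\<rho> e i = (if i \<in> {1..m} then e i else 0)" for e :: "nat \<Rightarrow> int" and i
  have \<rho>: "\<rho> e \<in> iexps {1..m}" for e unfolding \<rho>_def iexps_def by auto
  have termL: "of_int (a e) * lmon ?I T e \<in> SP.L UNIV" if "e \<in> M" for e
    using M(2) that by (intro lspan_term) auto
  have zts: "zt s = (\<Sum>e\<in>M. of_int (a e) * lmon ?I T e)" unfolding M(4) using a by (intro sum.cong) auto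
  have "z s = (\<Sum>e\<in>M. SP.ev (of_int (a e) * lmon ?I T e))"
    unfolding zt(2)[symmetric] zts by (rule SP.ev_sum) (rule termL)
  also have "\<dots> = (\<Sum>e\<in>M. of_int (a e) * lmon ?I x' e)"
    using M(2) by (intro sum.cong SP.ev_term refl) blast
  also have "\<dots> = (\<Sum>e\<in>M. of_int (a e) * lmon {1..m} x (\<rho> e))"
  proof (intro sum.cong refl arg_cong[where f = "\<lambda>t. _ * t"])
    fix e
    show "lmon ?I x' e = lmon {1..m} x (\<rho> e)"
      unfolding lmon_def by (intro prod.mono_neutral_cong_right) (auto simp: x'_def \<rho>_def)
  qed
  finally have zs: "z s = (\<Sum>e\<in>M. of_int (a e) * lmon {1..m} x (\<rho> e))" .
  show "z s \<in> lspan \<int> {1..m} x {e. \<forall>i\<in>{n+1..m}. e i \<ge> 0}"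
    unfolding zs
  proof (intro lspan_sum lspan_term \<rho>)
    fix e assume "e \<in> M"
    then show "\<rho> e \<in> {e. \<forall>i\<in>{n+1..m}. e i \<ge> 0}" using nonneg unfolding \<rho>_def by auto
  qed simp
  \<comment> \<open>0 is not an index, so every exponent vanishes there and \<open>f1\<close> is
    zero; positivity then concerns the sum of all coefficients.\<close>
  have "pos_at ?I T 0 (zt s)" using cluster_positive[OF zt(1) TS ind, of 0] sI by force
  then obtain f0 f1 where f: "f1 \<in> SP.L {e. e 0 > 0}" "zt s = f0 + f1" "U.ev f0 > 0"
    unfolding sgn_at_def by blast
  have "f1 \<in> SP.L {}" by (rule lspan_mono[OF f(1)]) (auto simp: iexps_def)
  then have "f1 = 0" by (rule lspan_empty)
  then have "U.ev (zt s) > 0" using f by simp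
  moreover have "U.ev (zt s) = (\<Sum>e\<in>M. U.ev (of_int (a e) * lmon ?I T e))"
    unfolding zts by (rule U.ev_sum) (rule termL)
  moreover have "\<dots> = (\<Sum>e\<in>M. of_int (a e) * lmon ?I (\<lambda>_. 1) e)"
    using M(2) by (intro sum.cong U.ev_term refl) blast
  moreover have "lmon ?I (\<lambda>_. 1 :: real) e = lmon {1..m} (\<lambda>_. 1) (\<rho> e)" for e
    unfolding lmon_def by simp
  moreover have "lspec {1..m} x (\<lambda>_. 1 :: real) (z s) (\<Sum>e\<in>M. of_int (a e) * lmon {1..m} (\<lambda>_. 1) (\<rho> e))"
    unfolding zs by (intro lspec_sum lspec_term \<rho>)
  ultimately show "\<exists>r>0. lspec {1..m} x (\<lambda>_. 1 :: real) (z s) r" by auto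
qed

text \<open>Multiplying a Laurent relation by a monomial with large exponents, here all equal to
  \<open>N\<close>, gives a polynomial relation with the same coefficients.\<close>

lemma alg_indep_imp_laurent_indep:
  assumes K: "unital_subring K" and x: "alg_indep K m x"
  shows "laurent_indep K {1..m} x"
proof -
  have nz: "x i \<noteq> 0" if i: "i \<in> {1..m}" for i
  proof
    assume xi: "x i = 0"
    define \<alpha> where "\<alpha> k = (if k = i then 1 else 0 :: nat)" for k
    have "monom_val m x \<alpha> = 0" unfolding monom_val_def using i xi by (intro prod_zero) (auto simp: \<alpha>_def)
    then have "(\<Sum>\<alpha>\<in>{\<alpha>}. 1 * monom_val m x \<alpha>) = 0" by simp
    moreover have "{\<alpha>} \<subseteq> exps m" using i by (auto simp: exps_def \<alpha>_def)
    ultimately have "\<forall>\<alpha>\<in>{\<alpha>}. (1::'a) = 0"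
      using x[unfolded alg_indep_def, rule_format, of "{\<alpha>}" "\<lambda>_. 1"] unital_subringD(2)[OF K] by auto
    then show False by simp
  qed
  moreover have "c e0 = 0" if M: "finite M" "M \<subseteq> iexps {1..m}" "\<forall>e\<in>M. c e \<in> K"
    and s: "(\<Sum>e\<in>M. c e * lmon {1..m} x e) = 0" and e0: "e0 \<in> M" for M c e0
  proof -
    define N where "N = (\<Sum>e\<in>M. \<Sum>i\<in>{1..m}. \<bar>e i\<bar>)"
    have N: "e i + N \<ge> 0" if "e \<in> M" "i \<in> {1..m}" for e i
    proof -
      have "\<bar>e i\<bar> \<le> (\<Sum>i\<in>{1..m}. \<bar>e i\<bar>)" using that by (intro member_le_sum) auto
      also have "\<dots> \<le> N" unfolding N_def using M(1) that by (intro member_le_sum) (auto intro: sum_nonneg)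
      finally show ?thesis by linarith
    qed
    define \<theta> where "\<theta> e i = (if i \<in> {1..m} then nat (e i + N) else 0)" for e :: "nat \<Rightarrow> int" and i
    define \<psi> where "\<psi> \<alpha> i = (if i \<in> {1..m} then int (\<alpha> i) - N else 0)" for \<alpha> :: "nat \<Rightarrow> nat" and i
    have inv: "\<psi> (\<theta> e) = e" if "e \<in> M" for e
    proof
      fix i
      have "i \<notin> {1..m} \<Longrightarrow> e i = 0" using M(2) that unfolding iexps_def by blast
      then show "\<psi> (\<theta> e) i = e i" using N[OF that, of i] unfolding \<psi>_def \<theta>_def by auto
    qed
    then have inj: "inj_on \<theta> M" by (metis inj_onI)
    have mv: "monom_val m x (\<theta> e) = lmon {1..m} x e * lmon {1..m} x (\<lambda>_. N)" if "e \<in> M" for e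
    proof -
      have "monom_val m x (\<theta> e) = lmon {1..m} x (\<lambda>i. e i + N)"
        unfolding monom_val_def lmon_def using N[OF that] by (intro prod.cong) (auto simp: \<theta>_def power_int_def)
      then show ?thesis using nz by (simp add: lmon_add)
    qed
    have "(\<Sum>\<alpha>\<in>\<theta> ` M. c (\<psi> \<alpha>) * monom_val m x \<alpha>) = (\<Sum>e\<in>M. c (\<psi> (\<theta> e)) * monom_val m x (\<theta> e))"
      by (subst sum.reindex[OF inj]) simp
    also have "\<dots> = (\<Sum>e\<in>M. c e * lmon {1..m} x e) * lmon {1..m} x (\<lambda>_. N)"
      unfolding sum_distrib_right using inv mv by (intro sum.cong) (auto simp: mult.assoc)
    finally have z: "(\<Sum>\<alpha>\<in>\<theta> ` M. c (\<psi> \<alpha>) * monom_val m x \<alpha>) = 0" using s by simp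
    moreover have "\<theta> ` M \<subseteq> exps m" by (auto simp: exps_def \<theta>_def)
    moreover have "\<forall>\<alpha>\<in>\<theta> ` M. c (\<psi> \<alpha>) \<in> K" using M(3) inv by auto
    ultimately have "\<forall>\<alpha>\<in>\<theta> ` M. c (\<psi> \<alpha>) = 0"
      using x[unfolded alg_indep_def, rule_format, of "\<theta> ` M" "\<lambda>\<alpha>. c (\<psi> \<alpha>)"] M(1) by blast
    then show ?thesis using e0 inv by fastforce
  qed
  ultimately show ?thesis unfolding laurent_indep_def by blast
qed

section \<open>Generated subalgebras in terms of monomials\<close>

lemma subalg_gen_alg: "subalg K S \<Longrightarrow> G \<subseteq> S \<Longrightarrow> gen_alg K G \<subseteq> S"
  unfolding gen_alg_def by blast

lemma subalg_unital_subring: "subalg K S \<Longrightarrow> unital_subring S"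
  unfolding subalg_def unital_subring_def by blast

lemma subalg_gen: "unital_subring K \<Longrightarrow> subalg K (gen_alg K G)"
  unfolding gen_alg_def subalg_def by blast

lemma gen_alg_incl: "G \<subseteq> gen_alg K G"
  unfolding gen_alg_def by blast

lemma subalg_lmon:
  assumes S: "subalg K S" and "\<And>i. i \<in> A \<Longrightarrow> e i > 0 \<Longrightarrow> y i \<in> S" "\<And>i. i \<in> A \<Longrightarrow> e i < 0 \<Longrightarrow> inverse (y i) \<in> S"
  shows "lmon A y e \<in> S"
proof -
  note U = unital_subringD[OF subalg_unital_subring[OF S]]
  have "y i powi e i \<in> S" if "i \<in> A" for i
    using assms(2,3)[OF that] U(2,7) by (cases "e i" "0 :: int" rule: linorder_cases) (auto simp: power_int_def)
  then show ?thesis unfolding lmon_def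
    by (induction A rule: infinite_finite_induct) (auto intro: U(2,5))
qed

lemma (in laurent_ring) laurent_alg_eq:
  assumes I: "I = {1..m}" and pm: "p \<le> m"
  shows "laurent_alg K m p x = L {e. \<forall>i\<in>{p+1..m}. e i \<ge> 0}" (is "_ = L ?W")
proof
  let ?G = "x ` {1..p} \<union> (\<lambda>i. inverse (x i)) ` {1..p} \<union> x ` {p+1..m}"
  show "laurent_alg K m p x \<subseteq> L ?W"
    unfolding laurent_alg_def
  proof (rule subalg_gen_alg)
    have "c \<in> L ?W" if "c \<in> K" for c
      using lspan_term[OF that, of "\<lambda>_. 0" ?W I x] by (simp add: iexps_zero)
    moreover have "f * g \<in> L ?W" if "f \<in> L ?W" "g \<in> L ?W" for f g
      by (rule L_mult[OF that]) auto
    ultimately show "subalg K (L ?W)"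
      unfolding subalg_def using lspan.zero L_one[of ?W] L_diff[of _ ?W] lspan_plus[of _ K I x ?W] by auto
    have "x i powi 1 \<in> L ?W" if "i \<in> {1..m}" for i using that I by (intro L_var_powi) auto
    moreover have "x i powi (- 1) \<in> L ?W" if "i \<in> {1..p}" for i
      using that I pm by (intro L_var_powi) auto
    ultimately show "?G \<subseteq> L ?W" using pm by auto
  qed
  show "L ?W \<subseteq> laurent_alg K m p x"
  proof
    fix f assume "f \<in> L ?W"
    then show "f \<in> laurent_alg K m p x"
    proof (induction rule: lspan.induct)
      case zero
      show ?case using subalg_gen[OF K] unfolding laurent_alg_def subalg_def by blast
    next
      case (add c e f)
      have S: "subalg K (laurent_alg K m p x)" unfolding laurent_alg_def by (rule subalg_gen[OF K])
      have G: "?G \<subseteq> laurent_alg K m p x" unfolding laurent_alg_def by (rule gen_alg_incl)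
      have "lmon I x e \<in> laurent_alg K m p x"
      proof (rule subalg_lmon[OF S])
        fix i assume "i \<in> I"
        then have "i \<in> {1..p} \<or> i \<in> {p+1..m}" using I by auto
        then show "x i \<in> laurent_alg K m p x" using G by blast
      next
        fix i assume i: "i \<in> I" "e i < 0"
        then have "i \<notin> {p+1..m}" using add.hyps(2) by force
        then have "i \<in> {1..p}" using i I by auto
        then show "inverse (x i) \<in> laurent_alg K m p x" using G by blast
      qed
      moreover have "c \<in> laurent_alg K m p x" using S add.hyps unfolding subalg_def by blast
      ultimately show ?case using S add.IH unfolding subalg_def by blast
    qed
  qed
qed

section \<open>Factorization in Laurent rings and cluster algebras\<close>

context laurent_ring
begin

lemma L_term_mem: "c \<in> K \<Longrightarrow> c \<noteq> 0 \<Longrightarrow> \<alpha> \<in> iexps I \<Longrightarrow> c * lmon I x \<alpha> \<in> L W \<Longrightarrow> \<alpha> \<in> W"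
  using L_support[of "{\<alpha>}" "\<lambda>_. c" W] by simp

text \<open>Uniqueness of coefficients lets a restriction on coefficients and one on the support,
  known separately, be combined.\<close>

lemma L_subring:
  assumes K': "unital_subring K'" "K' \<subseteq> K" and f: "f \<in> lspan K' I x UNIV" "f \<in> L W"
  shows "f \<in> lspan K' I x W"
proof -
  obtain M c where M: "finite M" "M \<subseteq> UNIV \<inter> iexps I" "\<forall>e\<in>M. c e \<in> K' \<and> c e \<noteq> 0"
    "f = (\<Sum>e\<in>M. c e * lmon I x e)" using lspan_rep[OF K'(1) f(1)] by blast
  have "M \<subseteq> W" using M K'(2) f(2) by (intro L_support[of M c W]) auto
  then show ?thesis unfolding M(4) using M by (intro lspan_sum lspan_term) auto
qed

lemma lowest_degree_mult:
  fixes \<phi> :: "(nat \<Rightarrow> int) \<Rightarrow> int"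
  assumes \<phi>: "\<And>e e'. \<phi> (\<lambda>i. e i + e' i) = \<phi> e + \<phi> e'"
    and f: "f0 \<in> L {e. \<phi> e = k}" "f1 \<in> L {e. \<phi> e > k}" "f0 \<noteq> 0"
    and g: "g0 \<in> L {e. \<phi> e = l}" "g1 \<in> L {e. \<phi> e > l}" "g0 \<noteq> 0"
    and fg: "(f0 + f1) * (g0 + g1) \<in> L {e. \<phi> e = b}"
  shows "b = k + l"
proof (rule ccontr)
  assume "b \<noteq> k + l"
  have "f0 * g0 = 0"
  proof (rule L_component_eq)
    show "f0 * g0 + (f0 * g1 + f1 * g0 + f1 * g1) = 0 + (f0 + f1) * (g0 + g1)"
      by (simp add: algebra_simps)
    show "f0 * g0 \<in> L {e. \<phi> e = k + l}" by (rule L_mult[OF f(1) g(1)]) (auto simp: \<phi>)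
    show "f0 * g1 + f1 * g0 + f1 * g1 \<in> L {e. \<phi> e \<noteq> k + l}"
      by (intro lspan_plus L_mult[OF f(1) g(2)] L_mult[OF f(2) g(1)] L_mult[OF f(2) g(2)]) (auto simp: \<phi>)
    show "(f0 + f1) * (g0 + g1) \<in> L {e. \<phi> e \<noteq> k + l}"
      using \<open>b \<noteq> k + l\<close> by (intro lspan_mono[OF fg]) auto
  qed (auto intro: lspan.zero)
  then show False using f(3) g(3) by simp
qed

text \<open>In each coordinate the width between lowest and highest degree is additive under
  multiplication, and a monomial has width 0.\<close>

lemma L_homogeneous:
  assumes f: "f \<in> L UNIV" "g \<in> L UNIV" "f * g = lmon I x \<beta>" "\<beta> \<in> iexps I"
  shows "\<exists>k. f \<in> L {e. e i = k}"
proof -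
  have nz: "f \<noteq> 0" "g \<noteq> 0" using f(3) lmon_nz by (metis mult_zero_left mult_zero_right)+
  obtain k f0 f1 where f0: "f0 \<in> L {e. e i = k}" "f1 \<in> L {e. e i > k}" "f0 \<noteq> 0" "f = f0 + f1"
    using L_lowest[OF f(1) nz(1), of "\<lambda>e. e i"] by blast
  obtain l g0 g1 where g0: "g0 \<in> L {e. e i = l}" "g1 \<in> L {e. e i > l}" "g0 \<noteq> 0" "g = g0 + g1"
    using L_lowest[OF f(2) nz(2), of "\<lambda>e. e i"] by blast
  \<comment> \<open>The highest degree is obtained as the lowest one for the negated
    grading.\<close>
  obtain k' f2 f3 where f2: "f2 \<in> L {e. - e i = k'}" "f3 \<in> L {e. - e i > k'}" "f2 \<noteq> 0" "f = f2 + f3"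
    using L_lowest[OF f(1) nz(1), of "\<lambda>e. - e i"] by blast
  obtain l' g2 g3 where g2: "g2 \<in> L {e. - e i = l'}" "g3 \<in> L {e. - e i > l'}" "g2 \<noteq> 0" "g = g2 + g3"
    using L_lowest[OF f(2) nz(2), of "\<lambda>e. - e i"] by blast
  have "f * g \<in> L {e. e i = \<beta> i}" "f * g \<in> L {e. - e i = - \<beta> i}"
    unfolding f(3) using f(4) by (auto intro: L_mon)
  then have sum: "\<beta> i = k + l" "- \<beta> i = k' + l'"
    using lowest_degree_mult[of "\<lambda>e. e i", OF _ f0(1-3) g0(1-3)]
      lowest_degree_mult[of "\<lambda>e. - e i", OF _ f2(1-3) g2(1-3)] f0(4) g0(4) f2(4) g2(4) by auto
  have fI: "f \<in> L {e. k \<le> e i \<and> e i \<le> - k'}"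
  proof -
    have "f \<in> L {e. e i \<ge> k}"
      unfolding f0(4) by (intro lspan_plus lspan_mono[OF f0(1)] lspan_mono[OF f0(2)]) auto
    moreover have "f \<in> L {e. e i \<le> - k'}"
      unfolding f2(4) by (intro lspan_plus lspan_mono[OF f2(1)] lspan_mono[OF f2(2)]) auto
    ultimately show ?thesis using L_Int by (auto simp: Collect_conj_eq)
  qed
  have gI: "g \<in> L {e. l \<le> e i \<and> e i \<le> - l'}"
  proof -
    have "g \<in> L {e. e i \<ge> l}"
      unfolding g0(4) by (intro lspan_plus lspan_mono[OF g0(1)] lspan_mono[OF g0(2)]) auto
    moreover have "g \<in> L {e. e i \<le> - l'}"
      unfolding g2(4) by (intro lspan_plus lspan_mono[OF g2(1)] lspan_mono[OF g2(2)]) auto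
    ultimately show ?thesis using L_Int by (auto simp: Collect_conj_eq)
  qed
  have "k \<le> - k'"
  proof (rule ccontr)
    assume "\<not> k \<le> - k'"
    then have "f \<in> L {}" by (intro lspan_mono[OF fI]) auto
    then show False using lspan_empty nz by blast
  qed
  moreover have "l \<le> - l'"
  proof (rule ccontr)
    assume "\<not> l \<le> - l'"
    then have "g \<in> L {}" by (intro lspan_mono[OF gI]) auto
    then show False using lspan_empty nz by blast
  qed
  ultimately have "k = - k'" using sum by linarith
  then have "f \<in> L {e. e i = k}" by (intro lspan_mono[OF fI]) auto
  then show ?thesis by blast
qed

lemma L_monomial:
  assumes f: "f \<in> L UNIV" "g \<in> L UNIV" "f * g = lmon I x \<beta>" "\<beta> \<in> iexps I"
  shows "\<exists>c\<in>K. \<exists>\<alpha>\<in>iexps I. f = c * lmon I x \<alpha>"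
proof -
  have "\<forall>i. \<exists>k. f \<in> L {e. e i = k}" using L_homogeneous[OF f] by blast
  then obtain a where a: "\<And>i. f \<in> L {e. e i = a i}" by metis
  obtain M c where M: "finite M" "M \<subseteq> iexps I" "\<forall>e\<in>M. c e \<in> K \<and> c e \<noteq> 0"
    "f = (\<Sum>e\<in>M. c e * lmon I x e)" "\<And>W. f \<in> L W \<longleftrightarrow> M \<subseteq> W" by (rule L_rep[OF f(1)]) blast
  have "M \<subseteq> {e. e i = a i}" for i using a[of i] unfolding M(5) .
  then have "M \<subseteq> {a}" by (auto simp: fun_eq_iff)
  moreover have "M \<noteq> {}"
  proof
    assume "M = {}"
    then have "f = 0" using M(4) by simp
    then show False using f(3) lmon_nz[of \<beta>] by simp
  qed
  ultimately have "M = {a}" by blast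
  then show ?thesis using M by (intro bexI[of _ "c a"] bexI[of _ a]) auto
qed

lemma L_unit:
  assumes f: "f \<in> L UNIV" "g \<in> L UNIV" "f * g = lmon I x \<beta>" "\<beta> \<in> iexps I"
  obtains c c' \<alpha> \<alpha>' where "c \<in> K" "c' \<in> K" "c * c' = 1" "\<alpha> \<in> iexps I" "\<alpha>' \<in> iexps I"
    "f = c * lmon I x \<alpha>" "g = c' * lmon I x \<alpha>'" "\<And>i. \<alpha> i + \<alpha>' i = \<beta> i"
proof -
  obtain c \<alpha> where c: "c \<in> K" "\<alpha> \<in> iexps I" "f = c * lmon I x \<alpha>" using L_monomial[OF f] by blast
  have "g * f = lmon I x \<beta>" using f(3) by (simp add: mult.commute)
  then obtain c' \<alpha>' where c': "c' \<in> K" "\<alpha>' \<in> iexps I" "g = c' * lmon I x \<alpha>'"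
    using L_monomial[OF f(2,1) _ f(4)] by blast
  define \<gamma> where "\<gamma> i = \<alpha> i + \<alpha>' i" for i
  have \<gamma>: "\<gamma> \<in> iexps I" using c(2) c'(2) unfolding \<gamma>_def by (rule iexps_add)
  have eq: "(c * c') * lmon I x \<gamma> = lmon I x \<beta>"
    using f(3) unfolding c(3) c'(3) \<gamma>_def lmon_plus by (simp add: mult_ac)
  have "(c * c') * lmon I x \<gamma> \<in> L {\<beta>}" unfolding eq using f(4) by (intro L_mon) auto
  moreover have "c * c' \<noteq> 0" using eq lmon_nz[of \<beta>] by auto
  ultimately have "\<gamma> = \<beta>"
    using L_term_mem[of "c * c'" \<gamma> "{\<beta>}"] \<gamma> unital_subringD(5)[OF K c(1) c'(1)] by blast
  then have "c * c' = 1" using eq lmon_nz by simp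
  then show ?thesis using that c c' \<open>\<gamma> = \<beta>\<close> unfolding \<gamma>_def by blast
qed

text \<open>A unit is a single term, whereas for nonzero \<open>b\<close> the two exchange monomials
  differ. For \<open>b = 0\<close> the value is 2, which may be a unit of \<open>K\<close>.\<close>

lemma exch_not_unit:
  assumes b: "b \<in> iexps I" "b \<noteq> (\<lambda>_. 0)" and g: "g \<in> L UNIV"
  shows "exch I x b * g \<noteq> 1"
proof
  assume eq: "exch I x b * g = 1"
  define p where "p i = max 0 (b i)" for i
  define q where "q i = max 0 (- b i)" for i
  have pq: "p \<in> iexps I" "q \<in> iexps I" using b unfolding p_def q_def iexps_def by auto
  have "p \<noteq> q"
  proof
    assume "p = q"
    moreover have "b i = p i - q i" for i unfolding p_def q_def by (simp add: max_def)
    ultimately show False using b(2) by auto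
  qed
  have P: "exch I x b = lmon I x p + lmon I x q" unfolding exch_def p_def q_def ..
  have "exch I x b \<in> L UNIV" unfolding P using pq by (intro lspan_plus L_mon) auto
  then obtain c \<alpha> where c: "c \<in> K" "\<alpha> \<in> iexps I" "exch I x b = c * lmon I x \<alpha>"
    using L_monomial[OF _ g, of "exch I x b" "\<lambda>_. 0"] eq iexps_zero by auto
  have s: "(\<Sum>e\<in>{p, q}. 1 * lmon I x e) \<in> L {\<alpha>}"
    using \<open>p \<noteq> q\<close> P c lspan_term[of c K \<alpha> "{\<alpha>}" I x] by simp
  have "{p, q} \<subseteq> {\<alpha>}"
    by (rule L_support[OF _ _ _ s]) (use pq unital_subringD(2)[OF K] in simp_all)
  then show False using \<open>p \<noteq> q\<close> by auto
qed

end

lemma laurent_ring_subset: "laurent_ring K I x \<Longrightarrow> unital_subring K' \<Longrightarrow> K' \<subseteq> K \<Longrightarrow> laurent_ring K' I x"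
  unfolding laurent_ring_def laurent_indep_def by blast

lemma exponent_nonneg:
  fixes y :: "nat \<Rightarrow> 'a::field_char_0"
  assumes y: "lseed K m n y C" and k: "k \<in> {1..n}" and col: "\<exists>s\<in>{1..m}. C s k \<noteq> 0"
    and c: "c \<in> K" "c' \<in> K" "c * c' = 1" and \<alpha>: "\<alpha> \<in> iexps {1..m}"
    and mem: "c * lmon {1..m} y \<alpha> \<in> lspan K {1..m} (mut_vars m k y C) UNIV"
  shows "\<alpha> k \<ge> 0"
proof (rule ccontr)
  let ?I = "{1..m}" and ?v = "mut_vars m k y C"
  define P where "P = exch ?I y (colv m C k)"
  interpret E: laurent_exchange K ?I y k P ?v unfolding P_def using lseed_exchange[OF y k] .
  assume neg: "\<not> \<alpha> k \<ge> 0"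
  define d where "d = nat (- \<alpha> k)"
  have d: "\<alpha> k = - int d" "d > 0" using neg unfolding d_def by auto
  let ?\<alpha> = "\<alpha>(k := 0)"
  have \<alpha>0: "?\<alpha> \<in> iexps ?I" using \<alpha> E.j by (rule iexps_upd)
  have lm: "lmon ?I y \<alpha> = y k powi \<alpha> k * lmon ?I ?v ?\<alpha>"
    using lmon_remove[OF E.fin E.j, of y \<alpha>] by (simp add: E.v lmon_upd_zero)
  have yk: "y k powi \<alpha> k = ?v k ^ d * inverse (P ^ d)"
    unfolding d(1) E.v_j using E.nzD[OF E.j] by (simp add: power_int_minus power_divide field_simps E.Q)
  have vk: "?v k \<noteq> 0" using E.new.nzD[OF E.j] .
  \<comment> \<open>\<open>h\<close> cancels every factor of \<open>c * lmon ?I y \<alpha>\<close>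
    except \<open>inverse (P ^ d)\<close>, using only elements of the mutated Laurent ring.\<close>
  define h where "h = c' * lmon ?I ?v (\<lambda>i. - ?\<alpha> i) * ?v k powi (- int d)"
  have "(\<lambda>i. - ?\<alpha> i) \<in> iexps ?I" using \<alpha>0 unfolding iexps_def by auto
  then have "c' * lmon ?I ?v (\<lambda>i. - ?\<alpha> i) \<in> E.LV" using c(2) by (intro lspan_term) auto
  then have "h \<in> E.LV" unfolding h_def using E.new.L_mult_UNIV E.new.L_var_powi[OF E.j] by blast
  moreover have inv: "inverse (P ^ d) = c * lmon ?I y \<alpha> * h"
  proof -
    have "c * lmon ?I y \<alpha> * h = (c * c') * (lmon ?I ?v (\<lambda>i. - ?\<alpha> i) * lmon ?I ?v ?\<alpha>)
        * (?v k ^ d * ?v k powi (- int d)) * inverse (P ^ d)"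
      unfolding lm yk h_def by (simp only: mult_ac)
    also have "?v k ^ d * ?v k powi (- int d) = 1" using vk by (simp add: power_int_minus)
    finally show ?thesis unfolding c(3) E.new.lmon_uminus by simp
  qed
  ultimately have "inverse (P ^ d) \<in> E.LV" using E.new.L_mult_UNIV[OF mem] by simp
  moreover have PV: "P \<in> E.LV" using E.L0_new[OF E.Q(1)] .
  ultimately have g: "P ^ (d - 1) * inverse (P ^ d) \<in> E.LV"
    by (intro E.new.L_mult_UNIV E.new.L_power) auto
  have "P * (P ^ (d - 1) * inverse (P ^ d)) = P ^ Suc (d - 1) * inverse (P ^ d)" by simp
  then have one: "P * (P ^ (d - 1) * inverse (P ^ d)) = 1" using d(2) E.Q(2) by simp
  have "colv m C k k = 0" using y k skew_sign(1)[of n C k k] unfolding lseed_def colv_def by auto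
  then have "P = exch ?I ?v (colv m C k)" unfolding P_def E.v by (simp add: exch_upd)
  moreover have "colv m C k \<noteq> (\<lambda>_. 0)"
    using col unfolding colv_def fun_eq_iff by metis
  ultimately show False using E.new.exch_not_unit[OF colv_iexps _ g] one by metis
qed

text \<open>If \<open>C k j = 0\<close>, column \<open>j\<close> changes at most by signs; otherwise
  its entry in row \<open>k\<close> only changes sign.\<close>

lemma cols_nonzero_mut:
  assumes "\<forall>k\<in>{1..n}. \<exists>s\<in>{1..m}. C s k \<noteq> 0" "k \<in> {1..n}" "n \<le> m"
  shows "\<forall>j\<in>{1..n}. \<exists>s\<in>{1..m}. mut_mat k C s j \<noteq> 0"
proof
  fix j assume j: "j \<in> {1..n}"
  obtain s where s: "s \<in> {1..m}" "C s j \<noteq> 0" using assms(1) j by blast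
  show "\<exists>s\<in>{1..m}. mut_mat k C s j \<noteq> 0"
  proof (cases "C k j = 0")
    case True
    then have "mut_mat k C s j \<noteq> 0" using s by (auto simp: mut_mat_alt)
    then show ?thesis using s by blast
  next
    case False
    then have "mut_mat k C k j \<noteq> 0" by (simp add: mut_mat_alt)
    moreover have "k \<in> {1..m}" using assms by auto
    ultimately show ?thesis by blast
  qed
qed

text \<open>\<open>cols\<close> is what connectedness contributes: no exchange polynomial
  degenerates to the constant 2.\<close>

locale cluster_algebra =
  fixes K :: "'a::field_char_0 set" and m n p :: nat and x :: "nat \<Rightarrow> 'a" and B :: "nat \<Rightarrow> nat \<Rightarrow> int"
  assumes Ints: "\<int> \<subseteq> K" and np: "n \<le> p" and pm: "p \<le> m" and seed: "lseed K m n x B"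
    and cols: "\<forall>k\<in>{1..n}. \<exists>s\<in>{1..m}. B s k \<noteq> 0"
begin

abbreviation "A \<equiv> cluster_alg K m n p x B"
abbreviation "cluster y C \<equiv> mut_equiv m n (x, B) (y, C)"

lemma K: "unital_subring K"
  using seed unfolding lseed_def laurent_ring_def by blast

lemma cluster_seed: "cluster y C \<Longrightarrow> lseed K m n y C"
  using mut_equiv_lseed seed by blast

lemma cluster_ring: "cluster y C \<Longrightarrow> laurent_ring K {1..m} y"
  using cluster_seed unfolding lseed_def by blast

lemma cluster_cols:
  assumes "cluster y C" shows "\<forall>k\<in>{1..n}. \<exists>s\<in>{1..m}. C s k \<noteq> 0"
  using assms seed
proof (induction rule: mut_equiv_induct(1))
  case refl
  show ?case by (rule cols)
next
  case (step y C k)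
  then show ?case using cols_nonzero_mut[of n m C k] np pm by auto
qed

lemma cluster_trans: "cluster y C \<Longrightarrow> cluster z D \<Longrightarrow> mut_equiv m n (y, C) (z, D)"
  using mut_equiv_sym[OF _ seed] mut_equiv_trans by blast

lemma frozen: "cluster y C \<Longrightarrow> i \<notin> {1..n} \<Longrightarrow> y i = x i"
  using cluster_frozen[OF _ seed] by blast

lemma laurent_eq: "cluster y C \<Longrightarrow> laurent_alg K m p y = lspan K {1..m} y {e. \<forall>i\<in>{p+1..m}. e i \<ge> 0}"
  using laurent_ring.laurent_alg_eq[OF cluster_ring] pm by blast

lemma A_subset: assumes y: "cluster y C" shows "A \<subseteq> laurent_alg K m p y"
  unfolding cluster_alg_def
proof (rule subalg_gen_alg)
  show S: "subalg K (laurent_alg K m p y)" unfolding laurent_alg_def using subalg_gen[OF K] .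
  have G: "y ` {1..p} \<subseteq> laurent_alg K m p y" "(\<lambda>i. inverse (y i)) ` {1..p} \<subseteq> laurent_alg K m p y"
    "y ` {p+1..m} \<subseteq> laurent_alg K m p y"
    using gen_alg_incl[of "y ` {1..p} \<union> (\<lambda>i. inverse (y i)) ` {1..p} \<union> y ` {p+1..m}" K]
    unfolding laurent_alg_def by simp_all
  have f: "x i = y i" if "i \<ge> n + 1" for i using frozen[OF y, of i] that by simp
  have 1: "x ` {n+1..p} \<subseteq> y ` {1..p}" using f by (auto intro!: image_eqI)
  have 2: "(\<lambda>i. inverse (x i)) ` {n+1..p} \<subseteq> (\<lambda>i. inverse (y i)) ` {1..p}" using f by (auto intro!: image_eqI)
  have 3: "x ` {p+1..m} \<subseteq> y ` {p+1..m}" using f np by (auto intro!: image_eqI)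
  have "cluster_vars m n x B \<subseteq> laurent_alg K m p y"
  proof
    fix v assume "v \<in> cluster_vars m n x B"
    then obtain z D i where z: "cluster z D" "i \<in> {1..n}" "v = z i"
      unfolding cluster_vars_def is_cluster_def by blast
    have "i \<in> {1..m}" using z np pm by auto
    then have "z i \<in> lspan \<int> {1..m} y {e. \<forall>i\<in>{n+1..m}. e i \<ge> 0}"
      using laurent_phenomenon(1)[OF cluster_trans[OF y z(1)] cluster_seed[OF y]] by blast
    then show "v \<in> laurent_alg K m p y"
      unfolding laurent_eq[OF y] z(3) using Ints np by (elim lspan_mono) auto
  qed
  then show "x ` {n+1..p} \<union> (\<lambda>i. inverse (x i)) ` {n+1..p} \<union> x ` {p+1..m} \<union> cluster_vars m n x B
      \<subseteq> laurent_alg K m p y"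
    using subset_trans[OF 1 G(1)] subset_trans[OF 2 G(2)] subset_trans[OF 3 G(3)] by (intro Un_least)
qed

lemma A_subset_lspan: "cluster y C \<Longrightarrow> f \<in> A \<Longrightarrow> f \<in> lspan K {1..m} y UNIV"
  using A_subset laurent_eq lspan_mono[of f K "{1..m}" y _ K UNIV] by blast

text \<open>Both factors are monomials up to units of \<open>K\<close>. For a mutable index the
  bound comes from the cluster mutated there, for an index above \<open>p\<close> from the shape of
  \<open>laurent_alg\<close>; only the invertible frozen variables keep unrestricted
  exponents.\<close>

lemma A_factor:
  assumes y: "cluster y C" and uv: "u \<in> A" "v \<in> A" "u * v = lmon {1..m} y \<beta>" "\<beta> \<in> iexps {1..m}"
  obtains c c' \<alpha> \<alpha>' where "c \<in> K" "c' \<in> K" "c * c' = 1" "\<alpha> \<in> iexps {1..m}" "\<alpha>' \<in> iexps {1..m}"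
    "u = c * lmon {1..m} y \<alpha>" "v = c' * lmon {1..m} y \<alpha>'" "\<And>i. \<alpha> i + \<alpha>' i = \<beta> i"
    "\<And>i. i \<in> {1..n} \<union> {p+1..m} \<Longrightarrow> \<alpha> i \<ge> 0 \<and> \<alpha>' i \<ge> 0"
proof -
  interpret Y: laurent_ring K "{1..m}" y using cluster_ring[OF y] .
  obtain c c' \<alpha> \<alpha>' where c: "c \<in> K" "c' \<in> K" "c * c' = 1" "\<alpha> \<in> iexps {1..m}" "\<alpha>' \<in> iexps {1..m}"
    "u = c * lmon {1..m} y \<alpha>" "v = c' * lmon {1..m} y \<alpha>'" "\<And>i. \<alpha> i + \<alpha>' i = \<beta> i"
    by (rule Y.L_unit[OF A_subset_lspan[OF y uv(1)] A_subset_lspan[OF y uv(2)] uv(3,4)]) (rule that; assumption)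
  have nz: "c \<noteq> 0" "c' \<noteq> 0" using c(3) by auto
  have "\<alpha> i \<ge> 0 \<and> \<alpha>' i \<ge> 0" if "i \<in> {1..n}" for i
  proof -
    have "cluster (mut_vars m i y C) (mut_mat i C)" using mut_equiv_step[OF y that] .
    then have "u \<in> lspan K {1..m} (mut_vars m i y C) UNIV" "v \<in> lspan K {1..m} (mut_vars m i y C) UNIV"
      using A_subset_lspan uv by blast+
    moreover have "\<exists>s\<in>{1..m}. C s i \<noteq> 0" using cluster_cols[OF y] that by blast
    moreover have "c' * c = 1" using c(3) by (simp add: mult.commute)
    ultimately show ?thesis using exponent_nonneg[OF cluster_seed[OF y] that] c by metis
  qed
  moreover have "\<alpha> i \<ge> 0 \<and> \<alpha>' i \<ge> 0" if "i \<in> {p+1..m}" for i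
  proof -
    have "\<alpha> \<in> {e. \<forall>i\<in>{p+1..m}. e i \<ge> 0}" "\<alpha>' \<in> {e. \<forall>i\<in>{p+1..m}. e i \<ge> 0}"
      using A_subset[OF y] uv(1,2) c nz Y.L_term_mem unfolding laurent_eq[OF y] by blast+
    then show ?thesis using that by blast
  qed
  ultimately show ?thesis using that[OF c] by blast
qed

lemma A_unit:
  assumes y: "cluster y C" and uv: "u \<in> A" "v \<in> A" "u * v = 1"
  obtains c c' \<alpha> where "c \<in> K" "c' \<in> K" "c * c' = 1" "\<alpha> \<in> iexps {n+1..p}"
    "u = c * lmon {1..m} y \<alpha>" "v = c' * lmon {1..m} y (\<lambda>i. - \<alpha> i)"
proof -
  have e: "u * v = lmon {1..m} y (\<lambda>_. 0)" using uv by simp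
  obtain c c' \<alpha> \<alpha>' where c: "c \<in> K" "c' \<in> K" "c * c' = 1" "\<alpha> \<in> iexps {1..m}"
    "u = c * lmon {1..m} y \<alpha>" "v = c' * lmon {1..m} y \<alpha>'" "\<And>i. \<alpha> i + \<alpha>' i = 0"
    "\<And>i. i \<in> {1..n} \<union> {p+1..m} \<Longrightarrow> \<alpha> i \<ge> 0 \<and> \<alpha>' i \<ge> 0"
    by (rule A_factor[OF y uv(1,2) e iexps_zero]) (rule that; assumption)
  have "\<alpha>' = (\<lambda>i. - \<alpha> i)" using c(7) by (metis add_eq_0_iff)
  moreover have "\<alpha> \<in> iexps {n+1..p}" unfolding iexps_def
  proof (intro CollectI allI impI)
    fix i assume i: "i \<notin> {n+1..p}"
    show "\<alpha> i = 0"
    proof (cases "i \<in> {1..m}")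
      case True
      then have "i \<in> {1..n} \<union> {p+1..m}" using i by auto
      then show ?thesis using c(7)[of i] c(8)[of i] by linarith
    next
      case False
      then show ?thesis using c(4) unfolding iexps_def by blast
    qed
  qed
  ultimately show ?thesis using that c by blast
qed

lemma var_lmon: "i \<in> {1..m} \<Longrightarrow> y i = lmon {1..m} y (\<lambda>k. if k = i then 1 else 0)"
  using lmon_single[of "{1..m}" i y 1] by simp

lemma A_cluster_var: "cluster y C \<Longrightarrow> k \<in> {1..n} \<Longrightarrow> y k \<in> A"
proof -
  assume "cluster y C" "k \<in> {1..n}"
  then have "y k \<in> cluster_vars m n x B" unfolding cluster_vars_def is_cluster_def by blast
  then show ?thesis unfolding cluster_alg_def by (intro subsetD[OF gen_alg_incl] UnI2)
qed

lemma cluster_var_not_unit: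
  assumes y: "cluster y C" and k: "k \<in> {1..n}" and v: "v \<in> A"
  shows "y k * v \<noteq> 1"
proof
  assume "y k * v = 1"
  interpret Y: laurent_ring K "{1..m}" y using cluster_ring[OF y] .
  let ?d = "\<lambda>i. if i = k then 1 else 0 :: int"
  have km: "k \<in> {1..m}" using k np pm by auto
  obtain c \<alpha> where c: "c \<in> K" "\<alpha> \<in> iexps {n+1..p}" "y k = c * lmon {1..m} y \<alpha>"
    by (rule A_unit[OF y A_cluster_var[OF y k] v \<open>y k * v = 1\<close>]) (rule that; assumption)
  have "\<alpha> \<in> iexps {1..m}" "\<alpha> k = 0" using c(2) k pm unfolding iexps_def by auto
  moreover have "y k \<in> Y.L {?d}" using var_lmon[OF km, of y] iexps_single[OF km] by (metis Y.L_mon singletonI)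
  moreover have "c \<noteq> 0" using c(3) Y.nzD[OF km] by auto
  ultimately have "\<alpha> \<in> {?d}" using Y.L_term_mem[OF c(1), of \<alpha> "{?d}"] c(3) by simp
  then show False using \<open>\<alpha> k = 0\<close> by auto
qed

lemma frozen_monomial_unit:
  assumes S: "subalg K S" "x ` {n+1..p} \<subseteq> S" "(\<lambda>i. inverse (x i)) ` {n+1..p} \<subseteq> S"
    and y: "cluster y C" and c: "c \<in> K" "c' \<in> K" "c * c' = 1" and \<alpha>: "\<alpha> \<in> iexps {n+1..p}"
  shows "\<exists>w\<in>S. c * lmon {1..m} y \<alpha> * w = 1"
proof -
  interpret Y: laurent_ring K "{1..m}" y using cluster_ring[OF y] .
  have "lmon {1..m} y (\<lambda>i. - \<alpha> i) \<in> S"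
  proof (rule subalg_lmon[OF S(1)])
    fix i
    have "y i \<in> S \<and> inverse (y i) \<in> S" if "\<alpha> i \<noteq> 0"
    proof -
      have "i \<in> {n+1..p}" using that \<alpha> unfolding iexps_def by blast
      then show ?thesis using S frozen[OF y, of i] by auto
    qed
    then show "- \<alpha> i > 0 \<Longrightarrow> y i \<in> S" "- \<alpha> i < 0 \<Longrightarrow> inverse (y i) \<in> S" by auto
  qed
  then have "c' * lmon {1..m} y (\<lambda>i. - \<alpha> i) \<in> S" using S(1) c unfolding subalg_def by blast
  moreover have "c * lmon {1..m} y \<alpha> * (c' * lmon {1..m} y (\<lambda>i. - \<alpha> i))
      = (c * c') * (lmon {1..m} y (\<lambda>i. - \<alpha> i) * lmon {1..m} y \<alpha>)" by (simp only: mult_ac)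
  then have "c * lmon {1..m} y \<alpha> * (c' * lmon {1..m} y (\<lambda>i. - \<alpha> i)) = 1"
    unfolding c(3) Y.lmon_uminus by simp
  ultimately show ?thesis by blast
qed

text \<open>The two exponents of \<open>y k\<close> are nonnegative and add up to 1, so one factor
  is a unit of \<open>K\<close> times a monomial in the invertible frozen variables. The subalgebra
  \<open>S\<close> contains its inverse; \<open>S\<close> is kept general to serve both
  \<open>U\<close> and the cluster algebra.\<close>

lemma cluster_var_irreducible:
  assumes S: "subalg K S" "S \<subseteq> A" "x ` {n+1..p} \<subseteq> S" "(\<lambda>i. inverse (x i)) ` {n+1..p} \<subseteq> S"
    and y: "cluster y C" and k: "k \<in> {1..n}" and uv: "u \<in> S" "v \<in> S" "u * v = y k"
  shows "(\<exists>w\<in>S. u * w = 1) \<or> (\<exists>w\<in>S. v * w = 1)"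
proof -
  let ?d = "\<lambda>i. if i = k then 1 else 0 :: int"
  have km: "k \<in> {1..m}" using k np pm by auto
  have f: "u \<in> A" "v \<in> A" "u * v = lmon {1..m} y ?d" using uv S(2) var_lmon[OF km, of y] by auto
  obtain c c' \<alpha> \<alpha>' where c: "c \<in> K" "c' \<in> K" "c * c' = 1" "\<alpha> \<in> iexps {1..m}" "\<alpha>' \<in> iexps {1..m}"
    "u = c * lmon {1..m} y \<alpha>" "v = c' * lmon {1..m} y \<alpha>'" "\<And>i. \<alpha> i + \<alpha>' i = ?d i"
    "\<And>i. i \<in> {1..n} \<union> {p+1..m} \<Longrightarrow> \<alpha> i \<ge> 0 \<and> \<alpha>' i \<ge> 0"
    by (rule A_factor[OF y f iexps_single[OF km]]) (rule that; assumption)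
  have z: "\<alpha> i = 0 \<and> \<alpha>' i = 0" if "i \<noteq> k" "i \<notin> {n+1..p}" for i
  proof (cases "i \<in> {1..m}")
    case True
    then have "i \<in> {1..n} \<union> {p+1..m}" using that by auto
    then show ?thesis using c(8)[of i] c(9)[of i] that(1) by simp
  next
    case False
    then show ?thesis using c(4,5) unfolding iexps_def by blast
  qed
  have "\<alpha> k + \<alpha>' k = 1" "\<alpha> k \<ge> 0" "\<alpha>' k \<ge> 0" using c(8)[of k] c(9)[of k] k by auto
  then consider "\<alpha> k = 0" | "\<alpha>' k = 0" by linarith
  then show ?thesis
  proof cases
    case 1
    have "\<alpha> i = 0" if "i \<notin> {n+1..p}" for i
      using z[OF _ that] 1 by (cases "i = k") simp_all
    then have "\<alpha> \<in> iexps {n+1..p}" unfolding iexps_def by blast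
    then show ?thesis using frozen_monomial_unit[OF S(1,3,4) y c(1-3)] c(6) by blast
  next
    case 2
    have "\<alpha>' i = 0" if "i \<notin> {n+1..p}" for i
      using z[OF _ that] 2 by (cases "i = k") simp_all
    then have "\<alpha>' \<in> iexps {n+1..p}" unfolding iexps_def by blast
    moreover have "c' * c = 1" using c(3) by (simp add: mult.commute)
    ultimately show ?thesis using frozen_monomial_unit[OF S(1,3,4) y c(2,1)] c(7) by blast
  qed
qed

text \<open>The expansion of \<open>z j\<close> in \<open>y\<close> has integer coefficients with
  positive sum and nonnegative frozen exponents. Here it consists of one term, so \<open>c\<close>
  is that sum.\<close>

lemma associate_coefficient:
  assumes y: "cluster y C" and z: "cluster z D" and ij: "i \<in> {1..n}" "j \<in> {1..n}"
    and c: "c \<in> K" "c \<noteq> 0" and \<alpha>: "\<alpha> \<in> iexps {n+1..p}" and eq: "z j = c * lmon {1..m} y \<alpha> * y i"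
  shows "\<forall>r. \<alpha> r \<ge> 0" and "\<exists>a::int. a > 0 \<and> c = of_int a"
proof -
  interpret Y: laurent_ring K "{1..m}" y using cluster_ring[OF y] .
  have YZ: "laurent_ring \<int> {1..m} y"
    using laurent_ring_subset[OF Y.laurent_ring_axioms unital_subring_Ints Ints] .
  interpret U: unit_specialization "{1..m}" y using unit_specializationI[OF YZ] .
  have im: "i \<in> {1..m}" and jm: "j \<in> {1..m}" using ij np pm by auto
  define \<gamma> where "\<gamma> k = \<alpha> k + (if k = i then 1 else 0)" for k
  have \<alpha>m: "\<alpha> \<in> iexps {1..m}" using \<alpha> pm unfolding iexps_def by auto
  have \<gamma>: "\<gamma> \<in> iexps {1..m}" unfolding \<gamma>_def using iexps_add[OF \<alpha>m iexps_single[OF im]] .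
  have zj: "z j = c * lmon {1..m} y \<gamma>"
    unfolding eq \<gamma>_def Y.lmon_plus using var_lmon[OF im, of y] by simp
  note LP = laurent_phenomenon[OF cluster_trans[OF y z] cluster_seed[OF y] jm]
  have "z j \<in> Y.L {e. \<forall>i\<in>{n+1..m}. e i \<ge> 0}" using LP(1) Ints by (elim lspan_mono) auto
  then have pos: "\<gamma> \<in> {e. \<forall>i\<in>{n+1..m}. e i \<ge> 0}" using Y.L_term_mem[OF c \<gamma>] unfolding zj by blast
  show "\<forall>r. \<alpha> r \<ge> 0"
  proof
    fix r
    show "\<alpha> r \<ge> 0"
    proof (cases "r \<in> {n+1..p}")
      case True
      then have "r \<in> {n+1..m}" "r \<noteq> i" using pm ij by auto
      then show ?thesis using pos unfolding \<gamma>_def by force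
    next
      case False
      then show ?thesis using \<alpha> unfolding iexps_def by force
    qed
  qed
  have "z j \<in> lspan \<int> {1..m} y UNIV" using LP(1) by (elim lspan_mono) auto
  moreover have "z j \<in> Y.L {\<gamma>}" unfolding zj using c \<gamma> by (intro lspan_term) auto
  ultimately have "z j \<in> lspan \<int> {1..m} y {\<gamma>}" using Y.L_subring[OF unital_subring_Ints Ints] by blast
  then obtain a where a: "a \<in> \<int>" "z j = a * lmon {1..m} y \<gamma>" using lspan_singleton[OF unital_subring_Ints] by blast
  then obtain b :: int where b: "a = of_int b" unfolding Ints_def by blast
  have ca: "c = of_int b" using a(2) zj Y.lmon_nz b by simp
  obtain r where r: "r > 0" "lspec {1..m} y (\<lambda>_. 1 :: real) (z j) r" using LP(2) by blast
  have "lspec {1..m} y (\<lambda>_. 1 :: real) (z j) (of_int b * lmon {1..m} (\<lambda>_. 1) \<gamma>)"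
    unfolding a(2) b by (rule lspec_term[OF \<gamma>])
  then have "r = of_int b * lmon {1..m} (\<lambda>_. 1) \<gamma>" using U.lspec_unique r(2) by blast
  then have "r = of_int b" by (simp add: lmon_def)
  then show "\<exists>a::int. a > 0 \<and> c = of_int a" using r(1) ca by auto
qed

text \<open>The previous lemma is applied in both directions: \<open>c\<close> and \<open>c'\<close>
  are positive integers with product 1, and \<open>\<alpha>\<close> and its negative are
  nonnegative.\<close>

lemma associates_equal:
  assumes y: "cluster y C" and z: "cluster z D" and ij: "i \<in> {1..n}" "j \<in> {1..n}"
    and uw: "u \<in> A" "w \<in> A" "u * w = 1" and eq: "z j = y i * u"
  shows "z j = y i"
proof -
  interpret Y: laurent_ring K "{1..m}" y using cluster_ring[OF y] .
  obtain c c' \<alpha> where c: "c \<in> K" "c' \<in> K" "c * c' = 1" "\<alpha> \<in> iexps {n+1..p}"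
    "u = c * lmon {1..m} y \<alpha>" "w = c' * lmon {1..m} y (\<lambda>i. - \<alpha> i)"
    by (rule A_unit[OF y uw]) (rule that; assumption)
  have nz: "c \<noteq> 0" "c' \<noteq> 0" using c(3) by auto
  have 1: "z j = c * lmon {1..m} y \<alpha> * y i" using eq c(5) by (simp add: mult.commute)
  \<comment> \<open>Only frozen variables occur in this monomial, and \<open>y\<close> and
    \<open>z\<close> share them.\<close>
  have zy: "lmon {1..m} y (\<lambda>i. - \<alpha> i) = lmon {1..m} z (\<lambda>i. - \<alpha> i)"
    unfolding lmon_def
  proof (intro prod.cong refl)
    fix k
    show "y k powi - \<alpha> k = z k powi - \<alpha> k"
    proof (cases "k \<in> {1..n}")
      case True
      then have "\<alpha> k = 0" using c(4) unfolding iexps_def by auto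
      then show ?thesis by simp
    next
      case False
      then show ?thesis using frozen[OF y] frozen[OF z] by simp
    qed
  qed
  have "w * z j = y i * (u * w)" using eq by (simp add: mult_ac)
  then have "y i = w * z j" unfolding uw(3) by simp
  then have 2: "y i = c' * lmon {1..m} z (\<lambda>i. - \<alpha> i) * z j" unfolding c(6) zy .
  have \<alpha>': "(\<lambda>i. - \<alpha> i) \<in> iexps {n+1..p}" using c(4) unfolding iexps_def by auto
  obtain a b :: int where ab: "a > 0" "c = of_int a" "b > 0" "c' = of_int b"
    using associate_coefficient(2)[OF y z ij c(1) nz(1) c(4) 1]
      associate_coefficient(2)[OF z y ij(2,1) c(2) nz(2) \<alpha>' 2] by blast
  have "(of_int (a * b) :: 'a) = of_int 1" using c(3) ab by simp
  then have "a * b = 1" by (simp only: of_int_eq_iff)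
  then have "a = 1" using ab by (simp add: zmult_eq_1_iff)
  moreover have "\<alpha> = (\<lambda>_. 0)"
    using associate_coefficient(1)[OF y z ij c(1) nz(1) c(4) 1]
      associate_coefficient(1)[OF z y ij(2,1) c(2) nz(2) \<alpha>' 2] by (auto simp: fun_eq_iff intro: antisym)
  ultimately show ?thesis using 1 ab(2) by simp
qed

end

section \<open>Factorial subalgebras\<close>

lemma unital_subring_Ints_subset:
  assumes "unital_subring K" shows "\<int> \<subseteq> K"
proof
  note U = unital_subringD[OF assms]
  have nat: "of_nat k \<in> K" for k by (induction k) (auto intro: U)
  fix c assume "c \<in> (\<int> :: 'a set)"
  then obtain a :: int where a: "c = of_int a" unfolding Ints_def by blast
  show "c \<in> K"
  proof (cases "a \<ge> 0")
    case True
    then have "c = of_nat (nat a)" using a by simp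
    then show ?thesis using nat by simp
  next
    case False
    then have "c = - of_nat (nat (- a))" using a by simp
    then show ?thesis using nat U(6) by simp
  qed
qed

text \<open>That irreducible elements are prime is available for factorial monoids; for a domain the
  monoid is \<open>mult_of\<close>, through which both notions are transported.\<close>

lemma ring_prime_sub_ring:
  assumes "factorial_domain (sub_ring U)" and q: "q \<in> U" "q \<noteq> 0" and nu: "\<And>w. w \<in> U \<Longrightarrow> q * w \<noteq> 1"
    and irr: "\<And>u v. u \<in> U \<Longrightarrow> v \<in> U \<Longrightarrow> u * v = q \<Longrightarrow> (\<exists>w\<in>U. u * w = 1) \<or> (\<exists>w\<in>U. v * w = 1)"
  shows "ring_prime\<^bsub>sub_ring U\<^esub> q"
proof -
  interpret factorial_domain "sub_ring U" by fact
  have car: "carrier (sub_ring U) = U" "\<zero>\<^bsub>sub_ring U\<^esub> = 0" "\<one>\<^bsub>sub_ring U\<^esub> = 1"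
    "a \<otimes>\<^bsub>sub_ring U\<^esub> b = a * b" for a b by (simp_all add: sub_ring_def)
  have units: "u \<in> Units (sub_ring U) \<longleftrightarrow> u \<in> U \<and> (\<exists>w\<in>U. u * w = 1)" for u
    unfolding Units_def car by (auto simp: mult.commute)
  have "ring_irreducible\<^bsub>sub_ring U\<^esub> q"
    by (rule ring_irreducibleI) (use q nu irr in \<open>auto simp: car units\<close>)
  then have "irreducible (mult_of (sub_ring U)) q"
    using ring_irreducibleE(3)[of q] q car by simp
  then have "prime (mult_of (sub_ring U)) q"
    using factorial_monoid.irreducible_prime[OF factorial_monoid_axioms, of q] q car by simp
  then show ?thesis
    using prime_eq_prime_mult[of q] q car unfolding ring_prime_def by simp
qed

lemma ring_prime_sub_ringD:
  assumes "ring_prime\<^bsub>sub_ring U\<^esub> q" "a \<in> U" "b \<in> U" "c \<in> U" "a * b = q * c"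
  shows "(\<exists>d\<in>U. a = q * d) \<or> (\<exists>d\<in>U. b = q * d)"
  using assms unfolding ring_prime_def prime_def factor_def sub_ring_def by auto

context cluster_algebra
begin

text \<open>
  Clearing denominators gives \<open>f * Y \<in> U\<close> and \<open>f * R \<in> U\<close> for products \<open>Y\<close> of the \<open>y i\<close> and \<open>R\<close> of the
  \<open>z j\<close>; the factors of \<open>Y\<close> are primes of \<open>U\<close> not dividing \<open>R\<close> and can be cancelled one at a time.
\<close>
lemma laurent_inter_subset:
  assumes U: "subalg K U" "U \<subseteq> A" and fd: "factorial_domain (sub_ring U)"
    and cont: "y ` {1..n} \<subseteq> U" "z ` {1..n} \<subseteq> U" "x ` {n+1..p} \<subseteq> U"
      "(\<lambda>i. inverse (x i)) ` {n+1..p} \<subseteq> U" "x ` {p+1..m} \<subseteq> U"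
    and y: "cluster y C" and z: "cluster z D" and disj: "disjoint_clusters n y z"
    and f: "f \<in> laurent_alg K m p y" "f \<in> laurent_alg K m p z"
  shows "f \<in> U"
proof -
  note S = unital_subringD[OF subalg_unital_subring[OF U(1)]]
  have nm: "n \<le> m" using np pm by simp
  have prime: "ring_prime\<^bsub>sub_ring U\<^esub> (t k)" if t: "cluster t E" "t ` {1..n} \<subseteq> U" and k: "k \<in> {1..n}" for t E k
  proof (rule ring_prime_sub_ring[OF fd])
    show "t k \<in> U" using t k by blast
    show "t k \<noteq> 0" using laurent_ring.nzD[OF cluster_ring[OF t(1)], of k] k nm by auto
    show "t k * w \<noteq> 1" if "w \<in> U" for w using cluster_var_not_unit[OF t(1) k] U(2) that by blast
    show "(\<exists>w\<in>U. u * w = 1) \<or> (\<exists>w\<in>U. v * w = 1)" if "u \<in> U" "v \<in> U" "u * v = t k" for u v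
      using cluster_var_irreducible[OF U cont(3,4) t(1) k that] .
  qed
  have clear: "\<exists>N. g * (\<Prod>i\<in>{1..n}. t i) ^ N \<in> U"
    if t: "cluster t E" "t ` {1..n} \<subseteq> U" and g: "g \<in> laurent_alg K m p t" for t E g
  proof -
    interpret T: laurent_ring K "{1..m}" t using cluster_ring[OF t(1)] .
    let ?P = "\<Prod>i\<in>{1..n}. t i"
    have PU: "?P \<in> U"
    proof -
      have "lmon {1..n} t (\<lambda>_. 1) \<in> U" using t(2) by (intro subalg_lmon[OF U(1)]) auto
      then show ?thesis by (simp add: lmon_def)
    qed
    have P: "?P ^ N = lmon {1..m} t (\<lambda>i. if i \<in> {1..n} then int N else 0)" for N
    proof -
      have "?P ^ N = (\<Prod>i\<in>{1..n}. t i powi int N)" by (simp add: prod_power_distrib)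
      also have "\<dots> = lmon {1..m} t (\<lambda>i. if i \<in> {1..n} then int N else 0)"
        unfolding lmon_def using nm by (intro prod.mono_neutral_cong_left) auto
      finally show ?thesis .
    qed
    \<comment> \<open>Again a threshold, because different terms need different powers.\<close>
    have "\<exists>N0. \<forall>N\<ge>N0. g * ?P ^ N \<in> U"
      using g unfolding laurent_eq[OF t(1)]
    proof (induction rule: lspan.induct)
      case zero
      show ?case using S(1) by simp
    next
      case (add c e g)
      then obtain N0 where N0: "\<And>N. N \<ge> N0 \<Longrightarrow> g * ?P ^ N \<in> U" by blast
      define N1 where "N1 = nat (\<Sum>i\<in>{1..n}. \<bar>e i\<bar>)"
      have "(c * lmon {1..m} t e + g) * ?P ^ N \<in> U" if N: "N \<ge> N0 + N1" for N
      proof -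
        have "lmon {1..m} t (\<lambda>i. e i + (if i \<in> {1..n} then int N else 0)) \<in> U"
        proof (rule subalg_lmon[OF U(1)])
          fix i assume i: "i \<in> {1..m}"
          have fr: "t i = x i" if "i \<notin> {1..n}" using frozen[OF t(1) that] .
          have tU: "t i \<in> U"
          proof (cases "i \<in> {1..n}")
            case True
            then show ?thesis using t(2) by blast
          next
            case False
            then have "i \<in> {n+1..p} \<or> i \<in> {p+1..m}" using i by auto
            then show ?thesis using fr[OF False] cont(3,5) by auto
          qed
          then show "t i \<in> U" .
          assume neg: "e i + (if i \<in> {1..n} then int N else 0) < 0"
          have "i \<notin> {1..n}"
          proof
            assume in_n: "i \<in> {1..n}"
            then have "\<bar>e i\<bar> \<le> (\<Sum>i\<in>{1..n}. \<bar>e i\<bar>)" by (intro member_le_sum) auto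
            then have "\<bar>e i\<bar> \<le> int N1" unfolding N1_def by simp
            then show False using neg in_n N by simp
          qed
          moreover have "i \<notin> {p+1..m}" using neg add.hyps(2) calculation by force
          ultimately have "i \<in> {n+1..p}" using i by auto
          then show "inverse (t i) \<in> U" using fr[OF \<open>i \<notin> {1..n}\<close>] cont(4) by auto
        qed
        then have "lmon {1..m} t e * ?P ^ N \<in> U" unfolding P T.lmon_plus .
        moreover have "c \<in> U" using U(1) add.hyps(1) unfolding subalg_def by blast
        ultimately have "c * (lmon {1..m} t e * ?P ^ N) + g * ?P ^ N \<in> U"
          using N0[of N] N S(3,5) by simp
        then show ?thesis by (simp only: distrib_right mult.assoc)
      qed
      then show ?case by blast
    qed
    then show ?thesis by blast
  qed
  obtain N where N: "f * (\<Prod>i\<in>{1..n}. y i) ^ N \<in> U" using clear[OF y cont(1) f(1)] by blast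
  obtain M where M: "f * (\<Prod>i\<in>{1..n}. z i) ^ M \<in> U" using clear[OF z cont(2) f(2)] by blast
  define R where "R = (\<Prod>i\<in>{1..n}. z i) ^ M"
  have not_dvd: "R \<in> U \<and> \<not> (\<exists>d\<in>U. R = y i * d)" if i: "i \<in> {1..n}" for i
  proof -
    \<comment> \<open>Since \<open>y i\<close> is prime in \<open>U\<close>, non-divisibility by
      \<open>y i\<close> is closed under products, which leaves only the single factors
      \<open>z j\<close> of \<open>R\<close>.\<close>
    define nd where "nd r \<longleftrightarrow> r \<in> U \<and> \<not> (\<exists>d\<in>U. r = y i * d)" for r
    have mult: "nd (a * b)" if "nd a" "nd b" for a b
      using that ring_prime_sub_ringD[OF prime[OF y cont(1) i], of a b] S(5) unfolding nd_def by blast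
    have one: "nd 1"
      unfolding nd_def using S(2) cluster_var_not_unit[OF y i] U(2) by (metis subsetD)
    have var: "nd (z j)" if j: "j \<in> {1..n}" for j
    proof -
      have zU: "z j \<in> U" and yU: "y i \<in> U" using cont i j by auto
      have False if d: "d \<in> U" "z j = y i * d" for d
      proof -
        \<comment> \<open>\<open>z j\<close> is irreducible and \<open>y i\<close> is not a unit, so
          \<open>d\<close> is one; associates are equal, contradicting disjointness.\<close>
        have "(\<exists>w\<in>U. y i * w = 1) \<or> (\<exists>w\<in>U. d * w = 1)"
          using cluster_var_irreducible[OF U cont(3,4) z j yU d(1)] d(2) by simp
        then obtain w where w: "w \<in> U" "d * w = 1"
          using cluster_var_not_unit[OF y i] U(2) by (metis subsetD)
        have "z j = y i" using associates_equal[OF y z i j _ _ w(2) d(2)] U(2) d(1) w(1) by blast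
        then show False using disj i j unfolding disjoint_clusters_def by blast
      qed
      then show ?thesis using zU unfolding nd_def by blast
    qed
    have "nd (\<Prod>i\<in>J. z i)" if "finite J" "J \<subseteq> {1..n}" for J
      using that by (induction J rule: finite_induct) (auto intro!: one mult var simp del: One_nat_def)
    then have p: "nd (\<Prod>i\<in>{1..n}. z i)" by simp
    have "nd ((\<Prod>i\<in>{1..n}. z i) ^ k)" for k by (induction k) (simp_all add: one mult p del: One_nat_def)
    then show ?thesis unfolding R_def nd_def by blast
  qed
  define can where "can E \<longleftrightarrow> E \<in> U \<and> (\<forall>w. w * E \<in> U \<longrightarrow> w * R \<in> U \<longrightarrow> w \<in> U)" for E
  have can_one: "can 1" unfolding can_def using S(2) by simp
  have can_mult: "can (E * E')" if "can E" "can E'" for E E'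
    unfolding can_def
  proof (intro conjI allI impI)
    show "E * E' \<in> U" using that S(5) unfolding can_def by blast
    fix w assume w: "w * (E * E') \<in> U" "w * R \<in> U"
    have eq: "(w * E) * R = E * (w * R)" by (simp only: mult_ac)
    have "(w * E) * R \<in> U" unfolding eq using w(2) that(1) S(5) unfolding can_def by blast
    moreover have "(w * E) * E' \<in> U" using w(1) by (simp add: mult.assoc)
    ultimately have "w * E \<in> U" using that(2) unfolding can_def by blast
    then show "w \<in> U" using w(2) that(1) unfolding can_def by blast
  qed
  have can_var: "can (y i)" if i: "i \<in> {1..n}" for i
    unfolding can_def
  proof (intro conjI allI impI)
    show "y i \<in> U" using cont(1) i by blast
    fix w assume w: "w * y i \<in> U" "w * R \<in> U"
    have eq: "(w * y i) * R = y i * (w * R)" by (simp only: mult_ac)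
    \<comment> \<open>The prime \<open>y i\<close> divides the product of \<open>w * y i\<close> and
      \<open>R\<close> but not \<open>R\<close>; dividing \<open>w * y i\<close> by it inside
      \<open>U\<close> gives \<open>w\<close> back.\<close>
    obtain d where d: "d \<in> U" "w * y i = y i * d"
      using ring_prime_sub_ringD[OF prime[OF y cont(1) i] w(1) _ w(2) eq] not_dvd[OF i] by blast
    moreover have "y i \<noteq> 0" using laurent_ring.nzD[OF cluster_ring[OF y], of i] i nm by auto
    ultimately have "w = d" by (simp add: mult.commute)
    then show "w \<in> U" using d(1) by simp
  qed
  have "can (\<Prod>i\<in>J. y i)" if "finite J" "J \<subseteq> {1..n}" for J
    using that by (induction J rule: finite_induct) (auto intro!: can_one can_mult can_var simp del: One_nat_def)
  then have p: "can (\<Prod>i\<in>{1..n}. y i)" by simp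
  have "can ((\<Prod>i\<in>{1..n}. y i) ^ k)" for k by (induction k) (simp_all add: can_one can_mult p del: One_nat_def)
  then show ?thesis using N M unfolding can_def R_def by blast
qed

end

text \<open>As \<open>m > 1\<close>, there is a path from \<open>k\<close> to another vertex, and
  its first edge gives a nonzero entry in row or column \<open>k\<close>. Inside the principal part
  the sign symmetry moves a row entry to the column.\<close>

lemma connected_cols_nonzero:
  assumes conn: "connected_mat m n B" and skew: "skew_symmetrizable n B" and dims: "n \<le> m" "m > 1" and k: "k \<in> {1..n}"
  shows "\<exists>s\<in>{1..m}. B s k \<noteq> 0"
proof -
  define E where "E = {(i,j). i \<in> {1..m} \<and> j \<in> {1..m} \<and>
                ((j \<in> {1..n} \<and> B i j \<noteq> 0) \<or> (i \<in> {1..n} \<and> B j i \<noteq> 0))}"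
  have km: "k \<in> {1..m}" using k dims by auto
  obtain j where j: "j \<in> {1..m}" "j \<noteq> k"
  proof (cases "k = 1")
    case True
    then show ?thesis using that[of 2] dims by auto
  next
    case False
    then show ?thesis using that[of 1] dims by auto
  qed
  have "(k, j) \<in> E\<^sup>*" using conn km j unfolding connected_mat_def E_def by (simp add: Let_def)
  then obtain s where "(k, s) \<in> E" using j(2) by (metis converse_rtranclE)
  then have s: "s \<in> {1..m}" "(s \<in> {1..n} \<and> B k s \<noteq> 0) \<or> B s k \<noteq> 0" unfolding E_def by auto
  then show ?thesis using skew_sign(3)[OF skew k] by blast
qed

theorem theorem1p4:
  fixes K :: "'a::field_char_0 set" and X :: "nat \<Rightarrow> 'a"
    and m n p :: nat and x y z :: "nat \<Rightarrow> 'a" and B :: "nat \<Rightarrow> nat \<Rightarrow> int"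
    and U :: "'a set"
  assumes K: "subfield K \<or> K = Ints"
    and F: "rational_function_field K m X"
    and dims: "m \<ge> p" "p \<ge> n" "n \<ge> 1" "m > 1"
    and seed: "is_seed K m n x B"
    and y: "is_cluster m n x B y" and z: "is_cluster m n x B z"
    and disj: "disjoint_clusters n y z"
    and U_sub: "subalg K U" "U \<subseteq> cluster_alg K m n p x B"
    and U_fact: "factorial_domain (sub_ring U)"
    and U_cont: "y ` {1..n} \<subseteq> U" "z ` {1..n} \<subseteq> U"
       "x ` {n+1..p} \<subseteq> U" "(\<lambda>i. inverse (x i)) ` {n+1..p} \<subseteq> U" "x ` {p+1..m} \<subseteq> U"
  shows "U = cluster_alg K m n p x B
    \<and> cluster_alg K m n p x B = laurent_alg K m p y \<inter> laurent_alg K m p z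
    \<and> factorial_domain (sub_ring (cluster_alg K m n p x B))
    \<and> (\<forall>v \<in> cluster_vars m n x B. ring_prime\<^bsub>sub_ring (cluster_alg K m n p x B)\<^esub> v)"
proof -
  have Ks: "unital_subring K"
    using K unital_subring_Ints unfolding subfield_def unital_subring_def by blast
  have skew: "skew_symmetrizable n B" and conn: "connected_mat m n B" and ind: "alg_indep K m x"
    using seed unfolding is_seed_def by auto
  have "laurent_ring K {1..m} x"
    using Ks alg_indep_imp_laurent_indep[OF Ks ind] by unfold_locales auto
  then have "lseed K m n x B" unfolding lseed_def using dims skew by simp
  then interpret cluster_algebra K m n p x B
    using dims unital_subring_Ints_subset[OF Ks] connected_cols_nonzero[OF conn skew] by unfold_locales auto
  obtain C D where yz: "cluster y C" "cluster z D" using y z unfolding is_cluster_def by blast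
  have "A \<subseteq> laurent_alg K m p y \<inter> laurent_alg K m p z" using A_subset yz by blast
  moreover have "laurent_alg K m p y \<inter> laurent_alg K m p z \<subseteq> U"
    using laurent_inter_subset[OF U_sub U_fact U_cont yz disj] by blast
  ultimately have UA: "U = A" and AL: "A = laurent_alg K m p y \<inter> laurent_alg K m p z" using U_sub(2) by auto
  have fd: "factorial_domain (sub_ring A)" using U_fact UA by simp
  have sub: "subalg K A" using U_sub(1) UA by simp
  have "ring_prime\<^bsub>sub_ring A\<^esub> v" if v: "v \<in> cluster_vars m n x B" for v
  proof -
    obtain t E k where t: "cluster t E" "k \<in> {1..n}" "v = t k"
      using v unfolding cluster_vars_def is_cluster_def by blast
    show ?thesis unfolding t(3)
    proof (rule ring_prime_sub_ring[OF fd])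
      show "t k \<in> A" using A_cluster_var[OF t(1,2)] .
      show "t k \<noteq> 0" using laurent_ring.nzD[OF cluster_ring[OF t(1)], of k] t(2) dims by auto
      show "t k * w \<noteq> 1" if "w \<in> A" for w using cluster_var_not_unit[OF t(1,2) that] .
      show "(\<exists>w\<in>A. u * w = 1) \<or> (\<exists>w\<in>A. v * w = 1)" if "u \<in> A" "v \<in> A" "u * v = t k" for u v
        using cluster_var_irreducible[OF sub order_refl _ _ t(1,2) that] U_cont(3,4) UA by simp
    qed
  qed
  then show ?thesis using UA AL fd by blast
qed

end
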